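(* Let $R$ be a commutative ring with $1$ containing $\mathbb Q$ as a subring, let $\mathfrak g$ be a differential graded Lie algebra over $R$, let $(M,\mathfrak g,\nabla,\pi,h)$ be a contraction of chain complexes, and let the coalgebra perturbation $\mathcal D$ of the differential $d^0$ on $\mathcal S^{\mathrm c}[sM]$, the Lie algebra twisting cochain $\tau\colon\mathcal S^{\mathrm c}_{\mathcal D}[sM]\to\mathfrak g$, and the contraction of chain complexes $\big(\mathcal S^{\mathrm c}_{\mathcal D}[sM],\mathcal C[\mathfrak g],\overline\tau,\Pi,H\big)$, with $\overline\tau$ the adjoint of $\tau$, be those determined by the given contraction and the Lie algebra structure via the Lie algebra perturbation lemma; in particular $\pi\tau=\tau_M$ and $h\tau=0$. Suppose that $M$ is connected. Let $t_{\mathcal L}\colon\mathcal S^{\mathrm c}_{\mathcal D}[sM]\to\mathcal L\,\mathcal S^{\mathrm c}_{\mathcal D}[sM]$ be the universal loop Lie algebra twisting cochain. Then the recursive construction $$\vartheta=t_{\mathcal L}\Pi+\tfrac12[\vartheta,\vartheta]H\colon\mathcal C[\mathfrak g]\longrightarrow\mathcal L\,\mathcal S^{\mathrm c}_{\mathcal D}[sM]$$ yields a Lie algebra twisting cochain $\vartheta\colon\mathcal C[\mathfrak g]\to\mathcal L\,\mathcal S^{\mathrm c}_{\mathcal D}[sM]$ such that $$\vartheta\,\overline\tau=t_{\mathcal L}\colon\mathcal S^{\mathrm c}_{\mathcal D}[sM]\longrightarrow\mathcal L\,\mathcal S^{\mathrm c}_{\mathcal D}[sM].$$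
   Context: Chain complexes are differential $\mathbb Z$-graded $R$-modules, with differential of degree $-1$; the Koszul sign convention is used. $s$ is the suspension, $(sX)_j=X_{j-1}$, with $ds+sd=0$; $s^{-1}$ is the desuspension. For a homogeneous morphism $\phi$, $D\phi=d\phi-(-1)^{|\phi|}\phi d$. "$M$ connected" means that $M$ is concentrated either in (strictly) positive or in (strictly) negative degrees. Contraction $(N,P,\nabla,\pi,h)$: chain complexes $N,P$, chain maps $\nabla\colon N\to P$, $\pi\colon P\to N$ and a degree $1$ morphism $h\colon P\to P$ of graded modules with $\pi\nabla=\mathrm{Id}$, $Dh=\mathrm{Id}-\nabla\pi$, $\pi h=0$, $h\nabla=0$, $hh=0$. For a coaugmented differential graded (dg) coalgebra $C$ with coaugmentation $\eta$ and diagonal $\Delta$, $JC=\mathrm{coker}(\eta)$ and $F_nC=\ker(C\to (JC)^{\otimes(n+1)})$ is the coaugmentation filtration. A coalgebra perturbation of the differential $d$ of $C$ is a degree $-1$ morphism $\partial$ lowering this filtration with $(d+\partial)^2=0$ and $d+\partial$ compatible with the coaugmented graded coalgebra structure; $C_\partial$ denotes $C$ with differential $d+\partial$. $\mathcal S^{\mathrm c}[V]$ is the cofree coaugmented dg cocommutative (symmetric) coalgebra on the chain complex $V$ (symmetric tensors in the tensor coalgebra), with the induced differential, written $d^0$ for $V=sM$; $\tau_X\colon\mathcal S^{\mathrm c}[sX]\to X$ is the projection to $sX$ followed by $s^{-1}$. For a coaugmented dg cocommutative coalgebra $C$ and a dg Lie algebra $\mathfrak h$, the cup bracket of $a,b\colon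 C\to\mathfrak h$ is $[a,b]=[\cdot,\cdot]\circ(a\otimes b)\circ\Delta$. A Lie algebra twisting cochain is a degree $-1$ morphism $t\colon C\to\mathfrak h$ with $t\eta=0$ and $Dt=\tfrac12[t,t]$. $\mathcal C[\mathfrak h]=\mathcal S^{\mathrm c}_{\partial}[s\mathfrak h]$ is the classifying coalgebra, $\partial$ being the coderivation with $\tau_{\mathfrak h}\partial=\tfrac12[\tau_{\mathfrak h},\tau_{\mathfrak h}]$. The adjoint $\overline t\colon C\to\mathcal C[\mathfrak h]$ ($C$ cocomplete, i.e. $C=\bigcup F_nC$) is the unique morphism of coaugmented dg coalgebras with $\tau_{\mathfrak h}\overline t=t$. Loop Lie algebra: for $C$ coaugmented dg cocommutative, $\mathcal LC$ is the graded Lie subalgebra $\mathrm L[s^{-1}JC]$ generated by $s^{-1}JC$ in $\mathrm T[s^{-1}JC]$ under the graded commutator, with differential $d+\partial_\Delta$, $\partial_\Delta$ being induced by the diagonal, i.e. the differential making the composite $t_{\mathcal L}\colon C\to JC\xrightarrow{s^{-1}}s^{-1}JC\subset\mathcal LC$ a Lie algebra twisting cochain (the universal one). Lie algebra perturbation lemma (known): the given contraction and the dg Lie algebra structure on $\mathfrak g$ determine, naturally, a coalgebra perturbation $\mathcal D$, a Lie algebra twisting cochain $\tau\colon\mathcal S^{\mathrm c}_{\mathcal D}[sM]\to\mathfrak g$ with $\pi\tau=\tau_M$ and $h\tau=0$, and a contraction of chain complexes $(\mathcal S^{\mathrm c}_{\mathcal D}[sM],\mathcal C[\mathfrak g],\overline\tau,\Pi,H)$;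 $\overline\tau$ is a morphism of coaugmented dg coalgebras. Only these properties of $\mathcal D,\tau,\Pi,H$ are to be used. The recursive construction means $\vartheta=\vartheta_1+\vartheta_2+\cdots$ with $\vartheta_1=t_{\mathcal L}\Pi$, $\vartheta_2=\tfrac12[\vartheta_1,\vartheta_1]H$, $\vartheta_3=[\vartheta_1,\vartheta_2]H$, and generally $\vartheta_n=\tfrac12\sum_{i+j=n}[\vartheta_i,\vartheta_j]H$ for $n\ge2$. *)

theory Defs
  imports Complex_Main "HOL-Algebra.Module" "HOL-Algebra.QuotRing"
begin

text \<open>
  Conventions.  A graded \<open>R\<close>-module is a module (in the sense of HOL-Algebra) that is the internal
  direct sum of the submodules \<open>grade V i\<close>.  The \<open>mult\<close> and \<open>one\<close> fields that a module record
  inherits from the ring record are only meaningful for tensor algebras.  Homogeneous morphisms are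
  functions constrained on the carrier only, so equations between them are stated on carriers.
  All signs follow the Koszul convention.
\<close>

definition rat_ring :: "rat ring" where
  "rat_ring = \<lparr>carrier = UNIV, mult = (*), one = 1, zero = 0, add = (+)\<rparr>"

definition contains_rat :: "'r ring \<Rightarrow> bool" where
  "contains_rat R \<longleftrightarrow> (\<exists>\<phi>\<in>ring_hom rat_ring R. inj \<phi>)"


section \<open>Graded modules and chain complexes\<close>

record ('r, 'a) gmod = "('r, 'a) module" +
  grade :: "int \<Rightarrow> 'a set"

definition decomposes :: "('r, 'a, 'z) gmod_scheme \<Rightarrow> (int \<Rightarrow> 'a) \<Rightarrow> 'a \<Rightarrow> bool" where
  "decomposes V c x \<longleftrightarrow>
     (\<forall>i. c i \<in> grade V i) \<and> finite {i. c i \<noteq> \<zero>\<^bsub>V\<^esub>} \<and>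
     x = (\<Oplus>\<^bsub>V\<^esub> i \<in> {i. c i \<noteq> \<zero>\<^bsub>V\<^esub>}. c i)"

definition graded_module :: "'r ring \<Rightarrow> ('r, 'a, 'z) gmod_scheme \<Rightarrow> bool" where
  "graded_module R V \<longleftrightarrow>
     Module.module R V \<and> (\<forall>i. submodule (grade V i) R V) \<and>
     (\<forall>x\<in>carrier V. \<exists>!c. decomposes V c x)"

definition gcomp :: "('r, 'a, 'z) gmod_scheme \<Rightarrow> int \<Rightarrow> 'a \<Rightarrow> 'a" where
  "gcomp V i x = (THE c. decomposes V c x) i"

definition gsupp :: "('r, 'a, 'z) gmod_scheme \<Rightarrow> 'a \<Rightarrow> int set" where
  "gsupp V x = {i. gcomp V i x \<noteq> \<zero>\<^bsub>V\<^esub>}"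

text \<open>Multiplication by the sign \<open>(-1)^k\<close>.\<close>

definition ksgn :: "('r, 'a, 'z) gmod_scheme \<Rightarrow> int \<Rightarrow> 'a \<Rightarrow> 'a" where
  "ksgn V k x = (if even k then x else \<ominus>\<^bsub>V\<^esub> x)"

definition half :: "'r ring \<Rightarrow> ('r, 'a, 'z) gmod_scheme \<Rightarrow> 'a \<Rightarrow> 'a" where
  "half R V x = (inv\<^bsub>R\<^esub> (\<one>\<^bsub>R\<^esub> \<oplus>\<^bsub>R\<^esub> \<one>\<^bsub>R\<^esub>)) \<odot>\<^bsub>V\<^esub> x"

definition gmor ::
  "'r ring \<Rightarrow> ('r, 'a, 'y) gmod_scheme \<Rightarrow> ('r, 'b, 'z) gmod_scheme \<Rightarrow> int \<Rightarrow> ('a \<Rightarrow> 'b) set" where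
  "gmor R V W k =
     {f. (\<forall>x\<in>carrier V. f x \<in> carrier W) \<and>
         (\<forall>x\<in>carrier V. \<forall>y\<in>carrier V. f (x \<oplus>\<^bsub>V\<^esub> y) = f x \<oplus>\<^bsub>W\<^esub> f y) \<and>
         (\<forall>r\<in>carrier R. \<forall>x\<in>carrier V. f (r \<odot>\<^bsub>V\<^esub> x) = r \<odot>\<^bsub>W\<^esub> f x) \<and>
         (\<forall>i. \<forall>x\<in>grade V i. f x \<in> grade W (i + k))}"

definition add_map :: "('r, 'b, 'z) gmod_scheme \<Rightarrow> ('a \<Rightarrow> 'b) \<Rightarrow> ('a \<Rightarrow> 'b) \<Rightarrow> 'a \<Rightarrow> 'b" where
  "add_map W f g = (\<lambda>x. f x \<oplus>\<^bsub>W\<^esub> g x)"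

definition chain_complex :: "'r ring \<Rightarrow> ('r, 'a, 'z) gmod_scheme \<Rightarrow> ('a \<Rightarrow> 'a) \<Rightarrow> bool" where
  "chain_complex R V d \<longleftrightarrow>
     graded_module R V \<and> d \<in> gmor R V V (-1) \<and> (\<forall>x\<in>carrier V. d (d x) = \<zero>\<^bsub>V\<^esub>)"

text \<open>\<open>hom_diff W dW dV k f\<close> is \<open>D f = d f - (-1)^k f d\<close> for \<open>f\<close> of degree \<open>k\<close>.\<close>

definition hom_diff ::
  "('r, 'b, 'z) gmod_scheme \<Rightarrow> ('b \<Rightarrow> 'b) \<Rightarrow> ('a \<Rightarrow> 'a) \<Rightarrow> int \<Rightarrow> ('a \<Rightarrow> 'b) \<Rightarrow> 'a \<Rightarrow> 'b" where
  "hom_diff W dW dV k f x = dW (f x) \<ominus>\<^bsub>W\<^esub> ksgn W k (f (dV x))"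

definition chain_map ::
  "'r ring \<Rightarrow> ('r, 'a, 'y) gmod_scheme \<Rightarrow> ('a \<Rightarrow> 'a) \<Rightarrow> ('r, 'b, 'z) gmod_scheme \<Rightarrow> ('b \<Rightarrow> 'b) \<Rightarrow>
     ('a \<Rightarrow> 'b) \<Rightarrow> bool" where
  "chain_map R V dV W dW f \<longleftrightarrow>
     f \<in> gmor R V W 0 \<and> (\<forall>x\<in>carrier V. dW (f x) = f (dV x))"

definition contraction ::
  "'r ring \<Rightarrow> ('r, 'n, 'y) gmod_scheme \<Rightarrow> ('n \<Rightarrow> 'n) \<Rightarrow> ('r, 'p, 'z) gmod_scheme \<Rightarrow> ('p \<Rightarrow> 'p) \<Rightarrow>
     ('n \<Rightarrow> 'p) \<Rightarrow> ('p \<Rightarrow> 'n) \<Rightarrow> ('p \<Rightarrow> 'p) \<Rightarrow> bool" where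
  "contraction R N dN P dP nabla prj h \<longleftrightarrow>
     chain_complex R N dN \<and> chain_complex R P dP \<and>
     chain_map R N dN P dP nabla \<and> chain_map R P dP N dN prj \<and> h \<in> gmor R P P 1 \<and>
     (\<forall>x\<in>carrier N. prj (nabla x) = x) \<and>
     (\<forall>x\<in>carrier P. hom_diff P dP dP 1 h x = x \<ominus>\<^bsub>P\<^esub> nabla (prj x)) \<and>
     (\<forall>x\<in>carrier P. prj (h x) = \<zero>\<^bsub>N\<^esub>) \<and>
     (\<forall>x\<in>carrier N. h (nabla x) = \<zero>\<^bsub>P\<^esub>) \<and>
     (\<forall>x\<in>carrier P. h (h x) = \<zero>\<^bsub>P\<^esub>)"

definition connected_gmod :: "('r, 'a, 'z) gmod_scheme \<Rightarrow> bool" where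
  "connected_gmod V \<longleftrightarrow> (\<forall>i\<le>0. grade V i = {\<zero>\<^bsub>V\<^esub>}) \<or> (\<forall>i\<ge>0. grade V i = {\<zero>\<^bsub>V\<^esub>})"

text \<open>
  \<open>shift p V\<close> is the \<open>p\<close>-fold suspension, on the same underlying elements: \<open>s\<close> and its inverse
  are the identity on elements, viewed as maps of degree \<open>1\<close> and \<open>-1\<close>.
  Since \<open>d s + s d = 0\<close>, the differential of a single suspension or desuspension is \<open>- d\<close>.
\<close>

definition shift :: "int \<Rightarrow> ('r, 'a, 'z) gmod_scheme \<Rightarrow> ('r, 'a) gmod" where
  "shift p V =
     \<lparr>carrier = carrier V, mult = mult V, one = one V, zero = zero V, add = add V,
      smult = smult V, grade = (\<lambda>j. grade V (j - p))\<rparr>"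

definition shift_diff :: "('r, 'a, 'z) gmod_scheme \<Rightarrow> ('a \<Rightarrow> 'a) \<Rightarrow> 'a \<Rightarrow> 'a" where
  "shift_diff V d x = \<ominus>\<^bsub>V\<^esub> d x"


section \<open>The graded tensor algebra\<close>

text \<open>
  \<open>tens R V\<close> is the quotient of the free associative \<open>R\<close>-algebra on the homogeneous elements of
  \<open>V\<close> by the two-sided ideal generated by the \<open>R\<close>-linearity relations in each degree.  A letter is
  a pair \<open>(i, x)\<close> with \<open>x \<in> grade V i\<close>; carrying the degree along makes it unambiguous also for
  \<open>x = 0\<close>.  All tensor powers, in particular \<open>V \<otimes> V\<close>, are the word length components of
  \<open>tens R V\<close>.
\<close>

type_synonym ('r, 'v) tensor = "((int \<times> 'v) list \<Rightarrow> 'r) set"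

definition letters :: "('r, 'v, 'z) gmod_scheme \<Rightarrow> (int \<times> 'v) set" where
  "letters V = {(i, x). x \<in> grade V i}"

definition wdeg :: "(int \<times> 'v) list \<Rightarrow> int" where
  "wdeg w = sum_list (map fst w)"

definition free_alg :: "'r ring \<Rightarrow> ('r, 'v, 'z) gmod_scheme \<Rightarrow> ((int \<times> 'v) list \<Rightarrow> 'r) ring" where
  "free_alg R V =
     \<lparr>carrier = {f. (\<forall>w. f w \<in> carrier R) \<and> finite {w. f w \<noteq> \<zero>\<^bsub>R\<^esub>} \<and>
                    {w. f w \<noteq> \<zero>\<^bsub>R\<^esub>} \<subseteq> lists (letters V)},
      mult = (\<lambda>f g w. \<Oplus>\<^bsub>R\<^esub> k \<in> {..length w}. f (take k w) \<otimes>\<^bsub>R\<^esub> g (drop k w)),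
      one = (\<lambda>w. if w = [] then \<one>\<^bsub>R\<^esub> else \<zero>\<^bsub>R\<^esub>),
      zero = (\<lambda>w. \<zero>\<^bsub>R\<^esub>),
      add = (\<lambda>f g w. f w \<oplus>\<^bsub>R\<^esub> g w)\<rparr>"

definition monom_word :: "'r ring \<Rightarrow> 'r \<Rightarrow> (int \<times> 'v) list \<Rightarrow> (int \<times> 'v) list \<Rightarrow> 'r" where
  "monom_word R r w = (\<lambda>u. if u = w then r else \<zero>\<^bsub>R\<^esub>)"

definition tens_rels :: "'r ring \<Rightarrow> ('r, 'v, 'z) gmod_scheme \<Rightarrow> ((int \<times> 'v) list \<Rightarrow> 'r) set" where
  "tens_rels R V =
     {monom_word R \<one>\<^bsub>R\<^esub> [(i, x \<oplus>\<^bsub>V\<^esub> y)] \<ominus>\<^bsub>free_alg R V\<^esub>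
        (monom_word R \<one>\<^bsub>R\<^esub> [(i, x)] \<oplus>\<^bsub>free_alg R V\<^esub> monom_word R \<one>\<^bsub>R\<^esub> [(i, y)])
        | i x y. x \<in> grade V i \<and> y \<in> grade V i} \<union>
     {monom_word R \<one>\<^bsub>R\<^esub> [(i, r \<odot>\<^bsub>V\<^esub> x)] \<ominus>\<^bsub>free_alg R V\<^esub> monom_word R r [(i, x)]
        | i r x. r \<in> carrier R \<and> x \<in> grade V i}"

definition tens_ideal :: "'r ring \<Rightarrow> ('r, 'v, 'z) gmod_scheme \<Rightarrow> ((int \<times> 'v) list \<Rightarrow> 'r) set" where
  "tens_ideal R V = Idl\<^bsub>free_alg R V\<^esub> (tens_rels R V)"

definition tclass ::
  "'r ring \<Rightarrow> ('r, 'v, 'z) gmod_scheme \<Rightarrow> ((int \<times> 'v) list \<Rightarrow> 'r) \<Rightarrow> ('r, 'v) tensor" where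
  "tclass R V f = tens_ideal R V +>\<^bsub>free_alg R V\<^esub> f"

definition tens :: "'r ring \<Rightarrow> ('r, 'v, 'z) gmod_scheme \<Rightarrow> ('r, ('r, 'v) tensor) gmod" where
  "tens R V = (let Q = free_alg R V Quot tens_ideal R V in
     \<lparr>carrier = carrier Q, mult = mult Q, one = one Q, zero = zero Q, add = add Q,
      smult = (\<lambda>r A. tclass R V (monom_word R r []) \<otimes>\<^bsub>Q\<^esub> A),
      grade = (\<lambda>k. {tclass R V f | f. f \<in> carrier (free_alg R V) \<and>
                                       (\<forall>w. f w \<noteq> \<zero>\<^bsub>R\<^esub> \<longrightarrow> wdeg w = k)})\<rparr>)"

definition tlength :: "'r ring \<Rightarrow> ('r, 'v, 'z) gmod_scheme \<Rightarrow> nat \<Rightarrow> ('r, 'v) tensor set" where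
  "tlength R V n = {tclass R V f | f. f \<in> carrier (free_alg R V) \<and>
                                       (\<forall>w. f w \<noteq> \<zero>\<^bsub>R\<^esub> \<longrightarrow> length w = n)}"

definition tpow ::
  "'r ring \<Rightarrow> ('r, 'v, 'z) gmod_scheme \<Rightarrow> nat \<Rightarrow> ('r, ('r, 'v) tensor) gmod" where
  "tpow R V n = (tens R V)\<lparr>carrier := tlength R V n,
                           grade := (\<lambda>k. grade (tens R V) k \<inter> tlength R V n)\<rparr>"

text \<open>The pure tensor given by a word, and the inclusion of \<open>V\<close> as the words of length one.\<close>

definition tword :: "'r ring \<Rightarrow> ('r, 'v, 'z) gmod_scheme \<Rightarrow> (int \<times> 'v) list \<Rightarrow> ('r, 'v) tensor" where
  "tword R V w = tclass R V (monom_word R \<one>\<^bsub>R\<^esub> w)"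

definition tgen :: "'r ring \<Rightarrow> ('r, 'v, 'z) gmod_scheme \<Rightarrow> 'v \<Rightarrow> ('r, 'v) tensor" where
  "tgen R V x = (\<Oplus>\<^bsub>tens R V\<^esub> i \<in> gsupp V x. tword R V [(i, gcomp V i x)])"

text \<open>
  \<open>tlift R N \<phi>\<close> is the \<open>R\<close>-linear map from a tensor algebra to \<open>N\<close> whose value on the pure tensor
  of a word \<open>w\<close> is \<open>\<phi> w\<close>.  It does not depend on the chosen representative when \<open>\<phi>\<close> is linear in
  each letter, which is the case in all uses below.
\<close>

definition tlift ::
  "'r ring \<Rightarrow> ('r, 'b, 'z) gmod_scheme \<Rightarrow> ((int \<times> 'v) list \<Rightarrow> 'b) \<Rightarrow> ('r, 'v) tensor \<Rightarrow> 'b" where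
  "tlift R N \<phi> A = (let f = (SOME f. f \<in> A) in
     \<Oplus>\<^bsub>N\<^esub> w \<in> {w. f w \<noteq> \<zero>\<^bsub>R\<^esub>}. f w \<odot>\<^bsub>N\<^esub> \<phi> w)"

text \<open>The algebra map induced by a map of degree \<open>0\<close>.\<close>

definition tmap ::
  "'r ring \<Rightarrow> ('r, 'w, 'z) gmod_scheme \<Rightarrow> ('v \<Rightarrow> 'w) \<Rightarrow> ('r, 'v) tensor \<Rightarrow> ('r, 'w) tensor" where
  "tmap R W f = tlift R (tens R W) (\<lambda>w. tword R W (map (\<lambda>(i, x). (i, f x)) w))"

text \<open>
  The sum of all \<open>1 \<otimes> \<dots> \<otimes> f \<otimes> \<dots> \<otimes> 1\<close> for a map \<open>f\<close> of degree \<open>k\<close>; on \<open>V \<otimes> V\<close> it is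
  \<open>f \<otimes> 1 + 1 \<otimes> f\<close>.
\<close>

definition tder ::
  "'r ring \<Rightarrow> ('r, 'v, 'z) gmod_scheme \<Rightarrow> int \<Rightarrow> ('v \<Rightarrow> 'v) \<Rightarrow> ('r, 'v) tensor \<Rightarrow> ('r, 'v) tensor"
  where
  "tder R V k f = tlift R (tens R V) (\<lambda>w.
     \<Oplus>\<^bsub>tens R V\<^esub> i \<in> {..<length w}.
       ksgn (tens R V) (k * wdeg (take i w))
         (tword R V (w[i := (fst (w ! i) + k, f (snd (w ! i)))])))"

text \<open>The graded interchange of the tensor factors in positions \<open>i\<close> and \<open>i + 1\<close>.\<close>

definition tswap ::
  "'r ring \<Rightarrow> ('r, 'v, 'z) gmod_scheme \<Rightarrow> nat \<Rightarrow> ('r, 'v) tensor \<Rightarrow> ('r, 'v) tensor" where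
  "tswap R V i = tlift R (tens R V) (\<lambda>w.
     if Suc i < length w
     then ksgn (tens R V) (fst (w ! i) * fst (w ! Suc i))
            (tword R V (w[i := w ! Suc i, Suc i := w ! i]))
     else tword R V w)"


section \<open>Coaugmented dg coalgebras\<close>

record ('r, 'c) coalg = "('r, 'c) gmod" +
  counit :: "'c \<Rightarrow> 'r"
  coaug :: "'r \<Rightarrow> 'c"
  comult :: "'c \<Rightarrow> ('r, 'c) tensor"

text \<open>
  Applying the comultiplication to the first factor, or to the second factor of \<open>C \<otimes> C\<close>, where
  \<open>C \<otimes> C\<close> and \<open>C \<otimes> C \<otimes> C\<close> are components of the tensor algebra on \<open>C\<close>.
\<close>

definition comult_first :: "'r ring \<Rightarrow> ('r, 'c, 'z) coalg_scheme \<Rightarrow> ('r, 'c) tensor \<Rightarrow> ('r, 'c) tensor"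
  where
  "comult_first R C = tlift R (tens R C) (\<lambda>w. case w of
       [] \<Rightarrow> \<zero>\<^bsub>tens R C\<^esub>
     | p # u \<Rightarrow> comult C (snd p) \<otimes>\<^bsub>tens R C\<^esub> tword R C u)"

definition comult_second :: "'r ring \<Rightarrow> ('r, 'c, 'z) coalg_scheme \<Rightarrow> ('r, 'c) tensor \<Rightarrow> ('r, 'c) tensor"
  where
  "comult_second R C = tlift R (tens R C) (\<lambda>w. case w of
       [p, q] \<Rightarrow> tword R C [p] \<otimes>\<^bsub>tens R C\<^esub> comult C (snd q)
     | _ \<Rightarrow> \<zero>\<^bsub>tens R C\<^esub>)"

definition counit_first :: "'r ring \<Rightarrow> ('r, 'c, 'z) coalg_scheme \<Rightarrow> ('r, 'c) tensor \<Rightarrow> 'c" where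
  "counit_first R C = tlift R C (\<lambda>w. case w of
       [p, q] \<Rightarrow> counit C (snd p) \<odot>\<^bsub>C\<^esub> snd q
     | _ \<Rightarrow> \<zero>\<^bsub>C\<^esub>)"

definition counit_second :: "'r ring \<Rightarrow> ('r, 'c, 'z) coalg_scheme \<Rightarrow> ('r, 'c) tensor \<Rightarrow> 'c" where
  "counit_second R C = tlift R C (\<lambda>w. case w of
       [p, q] \<Rightarrow> counit C (snd q) \<odot>\<^bsub>C\<^esub> snd p
     | _ \<Rightarrow> \<zero>\<^bsub>C\<^esub>)"

definition coaug_graded_coalgebra :: "'r ring \<Rightarrow> ('r, 'c, 'z) coalg_scheme \<Rightarrow> bool" where
  "coaug_graded_coalgebra R C \<longleftrightarrow>
     graded_module R C \<and>
     comult C \<in> gmor R C (tpow R C 2) 0 \<and>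
     (\<forall>x\<in>carrier C. counit C x \<in> carrier R) \<and>
     (\<forall>x\<in>carrier C. \<forall>y\<in>carrier C. counit C (x \<oplus>\<^bsub>C\<^esub> y) = counit C x \<oplus>\<^bsub>R\<^esub> counit C y) \<and>
     (\<forall>r\<in>carrier R. \<forall>x\<in>carrier C. counit C (r \<odot>\<^bsub>C\<^esub> x) = r \<otimes>\<^bsub>R\<^esub> counit C x) \<and>
     (\<forall>i. i \<noteq> 0 \<longrightarrow> (\<forall>x\<in>grade C i. counit C x = \<zero>\<^bsub>R\<^esub>)) \<and>
     (\<forall>x\<in>carrier C. comult_first R C (comult C x) = comult_second R C (comult C x)) \<and>
     (\<forall>x\<in>carrier C. counit_first R C (comult C x) = x) \<and>
     (\<forall>x\<in>carrier C. counit_second R C (comult C x) = x) \<and>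
     coaug C \<one>\<^bsub>R\<^esub> \<in> grade C 0 \<and>
     (\<forall>r\<in>carrier R. coaug C r = r \<odot>\<^bsub>C\<^esub> coaug C \<one>\<^bsub>R\<^esub>) \<and>
     counit C (coaug C \<one>\<^bsub>R\<^esub>) = \<one>\<^bsub>R\<^esub> \<and>
     comult C (coaug C \<one>\<^bsub>R\<^esub>) = tword R C [(0, coaug C \<one>\<^bsub>R\<^esub>), (0, coaug C \<one>\<^bsub>R\<^esub>)]"

definition cocommutative :: "'r ring \<Rightarrow> ('r, 'c, 'z) coalg_scheme \<Rightarrow> bool" where
  "cocommutative R C \<longleftrightarrow> (\<forall>x\<in>carrier C. tswap R C 0 (comult C x) = comult C x)"

definition coderivation :: "'r ring \<Rightarrow> ('r, 'c, 'z) coalg_scheme \<Rightarrow> int \<Rightarrow> ('c \<Rightarrow> 'c) \<Rightarrow> bool" where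
  "coderivation R C k f \<longleftrightarrow>
     f \<in> gmor R C C k \<and> (\<forall>x\<in>carrier C. comult C (f x) = tder R C k f (comult C x))"

definition coaug_dg_coalgebra :: "'r ring \<Rightarrow> ('r, 'c, 'z) coalg_scheme \<Rightarrow> ('c \<Rightarrow> 'c) \<Rightarrow> bool" where
  "coaug_dg_coalgebra R C d \<longleftrightarrow>
     coaug_graded_coalgebra R C \<and> chain_complex R C d \<and> coderivation R C (-1) d \<and>
     (\<forall>x\<in>carrier C. counit C (d x) = \<zero>\<^bsub>R\<^esub>) \<and>
     (\<forall>r\<in>carrier R. d (coaug C r) = \<zero>\<^bsub>C\<^esub>)"

definition coaug_dg_cocomm_coalgebra ::
  "'r ring \<Rightarrow> ('r, 'c, 'z) coalg_scheme \<Rightarrow> ('c \<Rightarrow> 'c) \<Rightarrow> bool" where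
  "coaug_dg_cocomm_coalgebra R C d \<longleftrightarrow> coaug_dg_coalgebra R C d \<and> cocommutative R C"

text \<open>Morphisms in the category of coaugmented dg cocommutative coalgebras.\<close>

definition dg_cocomm_coalgebra_hom ::
  "'r ring \<Rightarrow> ('r, 'c, 'y) coalg_scheme \<Rightarrow> ('c \<Rightarrow> 'c) \<Rightarrow> ('r, 'e, 'z) coalg_scheme \<Rightarrow> ('e \<Rightarrow> 'e) \<Rightarrow>
     ('c \<Rightarrow> 'e) \<Rightarrow> bool" where
  "dg_cocomm_coalgebra_hom R C dC E dE f \<longleftrightarrow>
     coaug_dg_cocomm_coalgebra R C dC \<and> coaug_dg_cocomm_coalgebra R E dE \<and>
     chain_map R C dC E dE f \<and>
     (\<forall>x\<in>carrier C. counit E (f x) = counit C x) \<and>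
     (\<forall>r\<in>carrier R. f (coaug C r) = coaug E r) \<and>
     (\<forall>x\<in>carrier C. comult E (f x) = tmap R E f (comult C x))"

text \<open>The quotient module \<open>JC\<close>, the cokernel of the coaugmentation; its elements are cosets.\<close>

definition J_proj :: "'r ring \<Rightarrow> ('r, 'c, 'z) coalg_scheme \<Rightarrow> 'c \<Rightarrow> 'c set" where
  "J_proj R C x = (coaug C ` carrier R) +>\<^bsub>C\<^esub> x"

definition J_mod :: "'r ring \<Rightarrow> ('r, 'c, 'z) coalg_scheme \<Rightarrow> ('r, 'c set) gmod" where
  "J_mod R C =
     \<lparr>carrier = a_rcosets\<^bsub>C\<^esub> (coaug C ` carrier R),
      mult = (\<lambda>A B. undefined), one = undefined,
      zero = coaug C ` carrier R, add = set_add C,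
      smult = (\<lambda>r A. (coaug C ` carrier R) <+>\<^bsub>C\<^esub> ((\<lambda>x. r \<odot>\<^bsub>C\<^esub> x) ` A)),
      grade = (\<lambda>i. J_proj R C ` grade C i)\<rparr>"

text \<open>
  \<open>iter_comult R C n\<close> is the iterated diagonal from \<open>C\<close> to the \<open>(n+1)\<close>-fold tensor power of \<open>C\<close>.
\<close>

primrec iter_comult :: "'r ring \<Rightarrow> ('r, 'c, 'z) coalg_scheme \<Rightarrow> nat \<Rightarrow> 'c \<Rightarrow> ('r, 'c) tensor" where
  "iter_comult R C 0 x = tgen R C x"
| "iter_comult R C (Suc n) x = comult_first R C (iter_comult R C n x)"

definition coaug_filt :: "'r ring \<Rightarrow> ('r, 'c, 'z) coalg_scheme \<Rightarrow> nat \<Rightarrow> 'c set" where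
  "coaug_filt R C n =
     {x \<in> carrier C. tmap R (J_mod R C) (J_proj R C) (iter_comult R C n x) = \<zero>\<^bsub>tens R (J_mod R C)\<^esub>}"

text \<open>
  The case of \<open>coaug_filt R C 0\<close>, which is the image of the coaugmentation and has to be mapped to
  zero, is subsumed in \<open>d + \<partial>\<close> (and \<open>d\<close>) being compatible with the coaugmentation.
\<close>

definition coalgebra_perturbation ::
  "'r ring \<Rightarrow> ('r, 'c, 'z) coalg_scheme \<Rightarrow> ('c \<Rightarrow> 'c) \<Rightarrow> ('c \<Rightarrow> 'c) \<Rightarrow> bool" where
  "coalgebra_perturbation R C d p \<longleftrightarrow>
     coaug_dg_coalgebra R C d \<and> p \<in> gmor R C C (-1) \<and>
     (\<forall>n. p ` coaug_filt R C (Suc n) \<subseteq> coaug_filt R C n) \<and>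
     coaug_dg_coalgebra R C (add_map C d p)"


section \<open>The symmetric coalgebra\<close>

text \<open>The symmetric tensors, i.e. the invariants of the graded action of the symmetric groups.\<close>

definition sym_mod :: "'r ring \<Rightarrow> ('r, 'v, 'z) gmod_scheme \<Rightarrow> ('r, ('r, 'v) tensor) gmod" where
  "sym_mod R V = (let S = {A \<in> carrier (tens R V). \<forall>i. tswap R V i A = A} in
     (tens R V)\<lparr>carrier := S, grade := (\<lambda>k. grade (tens R V) k \<inter> S)\<rparr>)"

text \<open>The diagonal of the tensor coalgebra, with values in \<open>T V \<otimes> T V\<close>.\<close>

definition deconcat ::
  "'r ring \<Rightarrow> ('r, 'v, 'z) gmod_scheme \<Rightarrow> ('r, 'v) tensor \<Rightarrow> ('r, ('r, 'v) tensor) tensor" where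
  "deconcat R V = tlift R (tens R (tens R V)) (\<lambda>w.
     \<Oplus>\<^bsub>tens R (tens R V)\<^esub> k \<in> {..length w}.
       tword R (tens R V)
         [(wdeg (take k w), tword R V (take k w)), (wdeg (drop k w), tword R V (drop k w))])"

text \<open>
  The symmetric coalgebra as a subcoalgebra of the tensor coalgebra.  As \<open>R\<close> contains the rationals,
  the map from \<open>S \<otimes> S\<close> to \<open>T V \<otimes> T V\<close> induced by the inclusion is injective, and its image contains
  the diagonals of the symmetric tensors.  The counit is the component in tensor degree \<open>0\<close>, i.e.
  the coefficient of the empty word; it does not depend on the representative.
\<close>

definition sym_coalg :: "'r ring \<Rightarrow> ('r, 'v, 'z) gmod_scheme \<Rightarrow> ('r, ('r, 'v) tensor) coalg" where
  "sym_coalg R V = (let S = sym_mod R V in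
     \<lparr>carrier = carrier S, mult = mult S, one = one S, zero = zero S, add = add S,
      smult = smult S, grade = grade S,
      counit = (\<lambda>A. (SOME f. f \<in> A) []),
      coaug = (\<lambda>r. r \<odot>\<^bsub>S\<^esub> tword R V []),
      comult = (\<lambda>A. THE z. z \<in> carrier (tpow R S 2) \<and>
                            tmap R (tens R V) (\<lambda>x. x) z = deconcat R V A)\<rparr>)"

text \<open>\<open>Sc R X\<close> is the symmetric coalgebra on \<open>sX\<close>, with the differential \<open>d0 R X dX\<close> induced by
  that of \<open>sX\<close>.\<close>

definition Sc :: "'r ring \<Rightarrow> ('r, 'x, 'z) gmod_scheme \<Rightarrow> ('r, ('r, 'x) tensor) coalg" where
  "Sc R X = sym_coalg R (shift 1 X)"

definition d0 ::
  "'r ring \<Rightarrow> ('r, 'x, 'z) gmod_scheme \<Rightarrow> ('x \<Rightarrow> 'x) \<Rightarrow> ('r, 'x) tensor \<Rightarrow> ('r, 'x) tensor" where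
  "d0 R X dX = tder R (shift 1 X) (-1) (shift_diff X dX)"

text \<open>The projection to \<open>sX\<close> followed by the desuspension.\<close>

definition tau_univ :: "'r ring \<Rightarrow> ('r, 'x, 'z) gmod_scheme \<Rightarrow> ('r, 'x) tensor \<Rightarrow> 'x" where
  "tau_univ R X = tlift R X (\<lambda>w. case w of [p] \<Rightarrow> snd p | _ \<Rightarrow> \<zero>\<^bsub>X\<^esub>)"


section \<open>Dg Lie algebras and Lie algebra twisting cochains\<close>

record ('r, 'a) glie = "('r, 'a) gmod" +
  lbracket :: "'a \<Rightarrow> 'a \<Rightarrow> 'a"

definition dg_lie_algebra :: "'r ring \<Rightarrow> ('r, 'a, 'z) glie_scheme \<Rightarrow> ('a \<Rightarrow> 'a) \<Rightarrow> bool" where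
  "dg_lie_algebra R L d \<longleftrightarrow>
     chain_complex R L d \<and>
     (\<forall>x\<in>carrier L. \<forall>y\<in>carrier L. lbracket L x y \<in> carrier L) \<and>
     (\<forall>x\<in>carrier L. \<forall>y\<in>carrier L. \<forall>z\<in>carrier L.
        lbracket L (x \<oplus>\<^bsub>L\<^esub> y) z = lbracket L x z \<oplus>\<^bsub>L\<^esub> lbracket L y z \<and>
        lbracket L z (x \<oplus>\<^bsub>L\<^esub> y) = lbracket L z x \<oplus>\<^bsub>L\<^esub> lbracket L z y) \<and>
     (\<forall>r\<in>carrier R. \<forall>x\<in>carrier L. \<forall>y\<in>carrier L.
        lbracket L (r \<odot>\<^bsub>L\<^esub> x) y = r \<odot>\<^bsub>L\<^esub> lbracket L x y \<and>
        lbracket L x (r \<odot>\<^bsub>L\<^esub> y) = r \<odot>\<^bsub>L\<^esub> lbracket L x y) \<and>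
     (\<forall>i j. \<forall>x\<in>grade L i. \<forall>y\<in>grade L j.
        lbracket L x y \<in> grade L (i + j) \<and>
        lbracket L x y = \<ominus>\<^bsub>L\<^esub> ksgn L (i * j) (lbracket L y x) \<and>
        d (lbracket L x y) = lbracket L (d x) y \<oplus>\<^bsub>L\<^esub> ksgn L i (lbracket L x (d y)) \<and>
        (\<forall>z\<in>carrier L. lbracket L x (lbracket L y z) =
           lbracket L (lbracket L x y) z \<oplus>\<^bsub>L\<^esub> ksgn L (i * j) (lbracket L y (lbracket L x z))))"

text \<open>
  The cup bracket of \<open>a\<close> and \<open>b\<close>, where \<open>b\<close> has degree \<open>q\<close>; the degree enters in
  \<open>(a \<otimes> b) (u \<otimes> v) = (-1)^(q |u|) a u \<otimes> b v\<close>.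
\<close>

definition cup_bracket ::
  "'r ring \<Rightarrow> ('r, 'c, 'y) coalg_scheme \<Rightarrow> ('r, 'a, 'z) glie_scheme \<Rightarrow> int \<Rightarrow>
     ('c \<Rightarrow> 'a) \<Rightarrow> ('c \<Rightarrow> 'a) \<Rightarrow> 'c \<Rightarrow> 'a" where
  "cup_bracket R C L q a b x = tlift R L (\<lambda>w. case w of
       [(i, u), (j, v)] \<Rightarrow> ksgn L (q * i) (lbracket L (a u) (b v))
     | _ \<Rightarrow> \<zero>\<^bsub>L\<^esub>) (comult C x)"

definition lie_twisting_cochain ::
  "'r ring \<Rightarrow> ('r, 'c, 'y) coalg_scheme \<Rightarrow> ('c \<Rightarrow> 'c) \<Rightarrow> ('r, 'a, 'z) glie_scheme \<Rightarrow> ('a \<Rightarrow> 'a) \<Rightarrow>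
     ('c \<Rightarrow> 'a) \<Rightarrow> bool" where
  "lie_twisting_cochain R C dC L dL t \<longleftrightarrow>
     coaug_dg_cocomm_coalgebra R C dC \<and> dg_lie_algebra R L dL \<and>
     t \<in> gmor R C L (-1) \<and>
     (\<forall>r\<in>carrier R. t (coaug C r) = \<zero>\<^bsub>L\<^esub>) \<and>
     (\<forall>x\<in>carrier C. hom_diff L dL dC (-1) t x = half R L (cup_bracket R C L (-1) t t x))"

text \<open>
  The coderivation \<open>p\<close> of \<open>Sc R L\<close> defining the classifying coalgebra, which is \<open>Sc R L\<close> with
  the differential \<open>d0 + p\<close>; it is uniquely determined by \<open>tau p = 1/2 [tau, tau]\<close>.
\<close>

definition classifying_coderivation ::
  "'r ring \<Rightarrow> ('r, 'a, 'z) glie_scheme \<Rightarrow> (('r, 'a) tensor \<Rightarrow> ('r, 'a) tensor) \<Rightarrow> bool" where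
  "classifying_coderivation R L p \<longleftrightarrow>
     coderivation R (Sc R L) (-1) p \<and>
     (\<forall>x\<in>carrier (Sc R L). tau_univ R L (p x) =
        half R L (cup_bracket R (Sc R L) L (-1) (tau_univ R L) (tau_univ R L) x))"

text \<open>
  \<open>tb\<close> is the adjoint of the twisting cochain \<open>t\<close>; it is uniquely determined when \<open>C\<close> is
  cocomplete.
\<close>

definition lie_adjoint ::
  "'r ring \<Rightarrow> ('r, 'c, 'y) coalg_scheme \<Rightarrow> ('c \<Rightarrow> 'c) \<Rightarrow> ('r, 'a, 'z) glie_scheme \<Rightarrow> ('a \<Rightarrow> 'a) \<Rightarrow>
     (('r, 'a) tensor \<Rightarrow> ('r, 'a) tensor) \<Rightarrow> ('c \<Rightarrow> 'a) \<Rightarrow> ('c \<Rightarrow> ('r, 'a) tensor) \<Rightarrow> bool" where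
  "lie_adjoint R C dC L dL p t tb \<longleftrightarrow>
     dg_cocomm_coalgebra_hom R C dC (Sc R L) (add_map (Sc R L) (d0 R L dL) p) tb \<and>
     (\<forall>x\<in>carrier C. tau_univ R L (tb x) = t x)"


section \<open>The loop Lie algebra\<close>

definition gcommutator :: "('r, 'a, 'z) gmod_scheme \<Rightarrow> 'a \<Rightarrow> 'a \<Rightarrow> 'a" where
  "gcommutator T x y =
     (\<Oplus>\<^bsub>T\<^esub> i \<in> gsupp T x. \<Oplus>\<^bsub>T\<^esub> j \<in> gsupp T y.
        (gcomp T i x \<otimes>\<^bsub>T\<^esub> gcomp T j y) \<ominus>\<^bsub>T\<^esub> ksgn T (i * j) (gcomp T j y \<otimes>\<^bsub>T\<^esub> gcomp T i x))"

text \<open>The graded Lie subalgebra of the tensor algebra on \<open>V\<close> generated by \<open>V\<close>.\<close>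

definition gen_lie :: "'r ring \<Rightarrow> ('r, 'v, 'z) gmod_scheme \<Rightarrow> ('r, ('r, 'v) tensor) glie" where
  "gen_lie R V = (let T = tens R V;
       S = \<Inter>{H. submodule H R T \<and> tgen R V ` carrier V \<subseteq> H \<and>
               (\<forall>x\<in>H. \<forall>y\<in>H. gcommutator T x y \<in> H)} in
     \<lparr>carrier = S, mult = mult T, one = one T, zero = zero T, add = add T, smult = smult T,
      grade = (\<lambda>k. grade T k \<inter> S), lbracket = gcommutator T\<rparr>)"

definition loop_lie ::
  "'r ring \<Rightarrow> ('r, 'c, 'z) coalg_scheme \<Rightarrow> ('r, ('r, 'c set) tensor) glie" where
  "loop_lie R C = gen_lie R (shift (-1) (J_mod R C))"

definition t_loop :: "'r ring \<Rightarrow> ('r, 'c, 'z) coalg_scheme \<Rightarrow> 'c \<Rightarrow> ('r, 'c set) tensor" where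
  "t_loop R C x = tgen R (shift (-1) (J_mod R C)) (J_proj R C x)"

text \<open>
  The differential of the loop Lie algebra: the one for which \<open>t_loop\<close> is a Lie algebra twisting
  cochain (part of which is that \<open>dL\<close> makes \<open>loop_lie R C\<close> into a dg Lie algebra).  It is unique, as
  the image of \<open>t_loop\<close> generates \<open>loop_lie R C\<close>.
\<close>

definition loop_differential ::
  "'r ring \<Rightarrow> ('r, 'c, 'z) coalg_scheme \<Rightarrow> ('c \<Rightarrow> 'c) \<Rightarrow>
     (('r, 'c set) tensor \<Rightarrow> ('r, 'c set) tensor) \<Rightarrow> bool" where
  "loop_differential R C dC dL \<longleftrightarrow>
     lie_twisting_cochain R C dC (loop_lie R C) dL (t_loop R C)"


section \<open>The recursive construction\<close>

lemma finsum_fundef_cong [fundef_cong]: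
  assumes "A = B" "G = G'" and eq: "\<And>x. x \<in> B \<Longrightarrow> f x = g x"
  shows "finsum G f A = finsum G' g B"
proof -
  have *: "(X, z) \<in> foldSetD D (\<lambda>x. m (f2 x)) e"
    if "(X, z) \<in> foldSetD D (\<lambda>x. m (f1 x)) e" "\<And>x. x \<in> X \<Longrightarrow> f1 x = f2 x"
    for X z D e f1 f2 and m :: "'b \<Rightarrow> 'b \<Rightarrow> 'b"
    using that
  proof (induction rule: foldSetD.induct)
    case emptyI
    then show ?case by (auto intro: foldSetD.emptyI)
  next
    case (insertI x A y)
    then have "f1 x = f2 x" by simp
    with insertI show ?case
      using foldSetD.insertI[of x A "\<lambda>x. m (f2 x)" y D e] by simp
  qed
  have "(B, z) \<in> foldSetD D (\<lambda>x. m (f x)) e \<longleftrightarrow> (B, z) \<in> foldSetD D (\<lambda>x. m (g x)) e"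
    for z D e and m :: "'b \<Rightarrow> 'b \<Rightarrow> 'b"
    using *[of B z D m f e g] *[of B z D m g e f] eq by auto
  then show ?thesis
    using assms(1,2) by (simp add: finsum_def finprod_def foldD_def comp_def)
qed

text \<open>
  For \<open>n \<ge> 1\<close>, the terms \<open>\<theta> 1 = t1\<close> and \<open>\<theta> n = 1/2 (sum over i + j = n of [\<theta> i, \<theta> j]) H\<close>, all of
  degree \<open>-1\<close>, with \<open>i, j \<ge> 1\<close>; the term with index \<open>0\<close> is a dummy.
\<close>

function theta ::
  "'r ring \<Rightarrow> ('r, 'c, 'y) coalg_scheme \<Rightarrow> ('r, 'a, 'z) glie_scheme \<Rightarrow> ('c \<Rightarrow> 'a) \<Rightarrow> ('c \<Rightarrow> 'c) \<Rightarrow>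
     nat \<Rightarrow> 'c \<Rightarrow> 'a" where
  "theta R C L t1 H n =
     (if n = 0 then (\<lambda>x. \<zero>\<^bsub>L\<^esub>)
      else if n = 1 then t1
      else (\<lambda>x. half R L (\<Oplus>\<^bsub>L\<^esub> i \<in> {1..<n}.
             cup_bracket R C L (-1) (theta R C L t1 H i) (theta R C L t1 H (n - i)) (H x))))"
  by pat_completeness auto
termination
  by (relation "measure (\<lambda>(R, C, L, t1, H, n). n)") auto

declare theta.simps [simp del]

definition theta_sum ::
  "'r ring \<Rightarrow> ('r, 'c, 'y) coalg_scheme \<Rightarrow> ('r, 'a, 'z) glie_scheme \<Rightarrow> ('c \<Rightarrow> 'a) \<Rightarrow> ('c \<Rightarrow> 'c) \<Rightarrow>
     'c \<Rightarrow> 'a" where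
  "theta_sum R C L t1 H x =
     (\<Oplus>\<^bsub>L\<^esub> n \<in> {n. theta R C L t1 H n x \<noteq> \<zero>\<^bsub>L\<^esub>}. theta R C L t1 H n x)"

end

theory Submission
  imports Defs
begin

text \<open>
  As \<open>M\<close> is connected, the loop Lie algebra is concentrated in positive or in negative degrees.
  All terms \<open>\<theta>\<^sub>n\<close> have degree \<open>-1\<close>, so \<open>\<theta>\<^sub>n\<close> vanishes in degree \<open>k\<close> once \<open>n\<close> exceeds the absolute
  value of \<open>k - 1\<close>; hence \<open>\<theta>\<close> is a locally finite sum and satisfies the fixed point equation.
  Since \<open>H \<tau>' = 0\<close> for the adjoint \<open>\<tau>'\<close> of \<open>\<tau>\<close>, this equation restricts to \<open>\<theta> \<tau>' = t\<close>, where \<open>t\<close> is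
  the universal twisting cochain.  From \<open>D H = 1 - \<tau>' \<Pi>\<close>, \<open>D t = 1/2 [t, t]\<close> and the naturality of the
  cup bracket under \<open>\<tau>'\<close> one gets \<open>D \<theta> = 1/2 [\<theta>, \<theta>] + [D \<theta>, \<theta>] H\<close>.  The Jacobi identity
  \<open>[[\<theta>, \<theta>], \<theta>] = 0\<close> turns this into \<open>\<Psi> = [\<Psi>, \<theta>] H\<close> for \<open>\<Psi> = D \<theta> - 1/2 [\<theta>, \<theta>]\<close>, and \<open>\<Psi> = 0\<close>
  follows by induction on the degree.
\<close>

text \<open>A tensor is a coset of functions on words, and every map out of a tensor algebra is
  defined by \<open>tlift\<close> through a chosen representative. Much of the work is therefore to
  show that such maps are well defined and linear; identities between cup brackets can then be
  tested on pairs of homogeneous letters, where only brackets and signs are left. The equation for D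
  theta comes from applying D to the fixed point equation. Since D [theta, theta] = 2
  [D theta, theta], this gives (D t) Pi + 1/2 [theta, theta] (d H + H d) + [D theta, theta] H. The
  homotopy identity replaces d H + H d by 1 - tau' Pi, and [theta, theta] tau' = [t, t] makes the
  correction cancel (D t) Pi. The suspension makes the two cases of connectedness asymmetric: sM
  lies in degrees at least 2 or at most 0. The desuspension in the loop Lie algebra restores the
  symmetry, with degrees at least 1 or at most -1, so that a sign \<open>s\<close> handles both
  cases in one argument.\<close>

declare in_lists_conv_set [simp del] in_listsD [rule del] in_listsI [rule del]

section \<open>The free algebra on words\<close>

lemma (in abelian_monoid) finsum_mono_neutral_left:
  assumes "finite B" "A \<subseteq> B" "\<And>i. i \<in> B - A \<Longrightarrow> h i = \<zero>" "h \<in> B \<rightarrow> carrier G"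
  shows "finsum G h A = finsum G h B"
  using add.finprod_mono_neutral_cong_left[of B A h h] assms by auto

text \<open>Closure of the grades is all that the linearity relations of the tensor algebra require.
  Asking for no more lets the locale also cover the desuspended quotient
  \<open>shift (-1) (J_mod R C)\<close> without a proof that it is a graded module.\<close>

locale graded_letters = R?: cring R for R :: "'r ring" (structure) +
  fixes V :: "('r, 'v, 'z) gmod_scheme"
  assumes grade_add_closed: "\<lbrakk>x \<in> grade V i; y \<in> grade V i\<rbrakk> \<Longrightarrow> x \<oplus>\<^bsub>V\<^esub> y \<in> grade V i"
    and grade_smult_closed: "\<lbrakk>r \<in> carrier R; x \<in> grade V i\<rbrakk> \<Longrightarrow> r \<odot>\<^bsub>V\<^esub> x \<in> grade V i"
begin

abbreviation "F \<equiv> free_alg R V"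
abbreviation "T \<equiv> tens R V"
abbreviation "words \<equiv> lists (letters V)"

definition conv :: "((int \<times> 'v) list \<Rightarrow> 'r) \<Rightarrow> ((int \<times> 'v) list \<Rightarrow> 'r) \<Rightarrow> (int \<times> 'v) list \<Rightarrow> 'r" where
  "conv f g w = (\<Oplus>k\<in>{..length w}. f (take k w) \<otimes> g (drop k w))"

abbreviation "vals \<equiv> (UNIV :: (int \<times> 'v) list set) \<rightarrow> carrier R"

lemma F_simps: "mult F = conv" "add F = (\<lambda>f g w. f w \<oplus> g w)" "zero F = (\<lambda>w. \<zero>)"
  "one F = (\<lambda>w. if w = [] then \<one> else \<zero>)"
  by (auto simp: free_alg_def conv_def fun_eq_iff)

lemma F_carrier: "f \<in> carrier F \<longleftrightarrow> f \<in> vals \<and> finite {w. f w \<noteq> \<zero>} \<and> {w. f w \<noteq> \<zero>} \<subseteq> words"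
  by (auto simp: free_alg_def)

lemma F_vals: "f \<in> carrier F \<Longrightarrow> f \<in> vals"
  by (simp add: F_carrier)

lemma F_val: "f \<in> carrier F \<Longrightarrow> f w \<in> carrier R"
  by (auto simp: F_carrier)

lemma conv_Nil: "f \<in> vals \<Longrightarrow> g \<in> vals \<Longrightarrow> conv f g [] = f [] \<otimes> g []"
  unfolding conv_def by (auto simp: Pi_iff)

text \<open>The factorisation with empty prefix is split off; the others are those of
  \<open>w\<close> for the left quotient of \<open>f\<close> by the letter \<open>a\<close>.
  Identities for \<open>conv\<close> thus follow by induction on the word with \<open>f\<close>
  generalised.\<close>

lemma conv_Cons:
  assumes "f \<in> vals" "g \<in> vals"
  shows "conv f g (a # w) = f [] \<otimes> g (a # w) \<oplus> conv (\<lambda>u. f (a # u)) g w"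
proof -
  have "conv f g (a # w) = (\<Oplus>k\<in>{..Suc (length w)}. f (take k (a # w)) \<otimes> g (drop k (a # w)))"
    by (simp add: conv_def)
  also have "\<dots> = conv (\<lambda>u. f (a # u)) g w \<oplus> f [] \<otimes> g (a # w)"
    using assms unfolding conv_def by (subst finsum_Suc2) (auto simp: Pi_iff)
  finally show ?thesis
    using assms by (simp add: conv_def Pi_iff finsum_closed R.a_comm)
qed

lemma conv_vals: "f \<in> vals \<Longrightarrow> g \<in> vals \<Longrightarrow> conv f g \<in> vals"
  by (auto simp: conv_def Pi_iff intro!: finsum_closed)

lemma conv_val: "f \<in> vals \<Longrightarrow> g \<in> vals \<Longrightarrow> conv f g w \<in> carrier R"
  using conv_vals by blast

lemma conv_add_left:
  assumes "f \<in> vals" "f' \<in> vals" "g \<in> vals"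
  shows "conv (\<lambda>w. f w \<oplus> f' w) g w = conv f g w \<oplus> conv f' g w"
  using assms unfolding conv_def
  by (subst finsum_addf[symmetric]) (auto simp: Pi_iff l_distr intro!: finsum_cong')

lemma conv_add_right:
  assumes "f \<in> vals" "g \<in> vals" "g' \<in> vals"
  shows "conv f (\<lambda>w. g w \<oplus> g' w) w = conv f g w \<oplus> conv f g' w"
  using assms unfolding conv_def
  by (subst finsum_addf[symmetric]) (auto simp: Pi_iff r_distr intro!: finsum_cong')

lemma conv_smult_left:
  assumes "r \<in> carrier R" "f \<in> vals" "g \<in> vals"
  shows "conv (\<lambda>w. r \<otimes> f w) g w = r \<otimes> conv f g w"
  using assms unfolding conv_def
  by (subst finsum_rdistr) (auto simp: Pi_iff m_assoc intro!: finsum_cong')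

lemma conv_assoc:
  assumes "f \<in> vals" "g \<in> vals" "h \<in> vals"
  shows "conv (conv f g) h w = conv f (conv g h) w"
  using assms
proof (induction w arbitrary: f g)
  case Nil
  then show ?case
    by (simp add: conv_Nil conv_vals Pi_iff m_assoc conv_val)
next
  case (Cons a w)
  note vs = Cons.prems
  have d: "(\<lambda>u. f (a # u)) \<in> vals" "(\<lambda>u. g (a # u)) \<in> vals" "(\<lambda>u. f [] \<otimes> g (a # u)) \<in> vals"
    using vs by (auto simp: Pi_iff)
  have 1: "(\<lambda>u. conv f g (a # u)) = (\<lambda>u. f [] \<otimes> g (a # u) \<oplus> conv (\<lambda>u. f (a # u)) g u)"
    using vs by (simp add: conv_Cons)
  have c: "f [] \<in> carrier R" "g [] \<in> carrier R" "h (a # w) \<in> carrier R"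
    using vs by auto
  have s: "conv (\<lambda>u. f [] \<otimes> g (a # u)) h w = f [] \<otimes> conv (\<lambda>u. g (a # u)) h w"
    using c d vs by (intro conv_smult_left)
  have "conv (conv f g) h (a # w) =
      f [] \<otimes> g [] \<otimes> h (a # w) \<oplus> (f [] \<otimes> conv (\<lambda>u. g (a # u)) h w
        \<oplus> conv (conv (\<lambda>u. f (a # u)) g) h w)"
    using vs d s by (simp add: conv_Cons conv_vals conv_Nil 1 conv_add_left)
  also have "conv (conv (\<lambda>u. f (a # u)) g) h w = conv (\<lambda>u. f (a # u)) (conv g h) w"
    by (rule Cons.IH) (use vs d in auto)
  also have "f [] \<otimes> g [] \<otimes> h (a # w) \<oplus> (f [] \<otimes> conv (\<lambda>u. g (a # u)) h w
        \<oplus> conv (\<lambda>u. f (a # u)) (conv g h) w) = conv f (conv g h) (a # w)"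
    using vs c d by (simp add: conv_Cons[of f] conv_Cons[of g] conv_vals conv_val r_distr m_assoc a_assoc)
  finally show ?case .
qed

lemma conv_one_left: "g \<in> vals \<Longrightarrow> conv (\<one>\<^bsub>F\<^esub>) g w = g w"
proof (cases w)
  case (Cons a u)
  assume g: "g \<in> vals"
  have "conv (\<lambda>u. \<zero>) g u = \<zero>"
    using g unfolding conv_def by (intro add.finprod_one_eqI) (auto simp: Pi_iff)
  then show ?thesis using Cons g by (simp add: conv_Cons F_simps Pi_iff)
qed (auto simp: conv_Nil F_simps Pi_iff)

lemma conv_one_right:
  assumes "f \<in> vals" shows "conv f (\<one>\<^bsub>F\<^esub>) w = f w"
  using assms
proof (induction w arbitrary: f)
  case (Cons a w)
  have "conv (\<lambda>u. f (a # u)) (\<one>\<^bsub>F\<^esub>) w = f (a # w)"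
    by (rule Cons.IH) (use Cons.prems in auto)
  then show ?case using Cons.prems by (simp add: conv_Cons F_simps Pi_iff)
qed (auto simp: conv_Nil F_simps Pi_iff)

lemma conv_support:
  assumes "f \<in> vals" "g \<in> vals" "conv f g w \<noteq> \<zero>"
  obtains u v where "w = u @ v" "f u \<noteq> \<zero>" "g v \<noteq> \<zero>"
proof (rule ccontr)
  assume n: "\<not> thesis"
  have "f (take k w) \<otimes> g (drop k w) = \<zero>" for k
  proof (rule ccontr)
    assume "f (take k w) \<otimes> g (drop k w) \<noteq> \<zero>"
    then have "f (take k w) \<noteq> \<zero>" "g (drop k w) \<noteq> \<zero>" using assms(1,2) by (auto simp: Pi_iff)
    then show False using n that[of "take k w" "drop k w"] by simp
  qed
  then have "conv f g w = \<zero>" unfolding conv_def by (simp add: R.add.finprod_one_eqI)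
  with assms(3) show False by simp
qed

lemma conv_closed:
  assumes f: "f \<in> carrier F" and g: "g \<in> carrier F" shows "conv f g \<in> carrier F"
proof -
  let ?S = "(\<lambda>(u, v). u @ v) ` ({w. f w \<noteq> \<zero>} \<times> {w. g w \<noteq> \<zero>})"
  note v = F_vals[OF f] F_vals[OF g]
  have "{w. conv f g w \<noteq> \<zero>} \<subseteq> ?S"
  proof
    fix w assume "w \<in> {w. conv f g w \<noteq> \<zero>}"
    then have "conv f g w \<noteq> \<zero>" by simp
    then obtain u u' where "w = u @ u'" "f u \<noteq> \<zero>" "g u' \<noteq> \<zero>" by (rule conv_support[OF v])
    then show "w \<in> ?S" by force
  qed
  moreover have "finite ?S" using f g by (auto simp: F_carrier)
  moreover have "?S \<subseteq> words" using f g by (force simp: F_carrier)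
  ultimately show ?thesis using conv_vals[OF v]
    unfolding F_carrier by (blast intro: finite_subset)
qed

lemma F_add_closed:
  assumes "f \<in> carrier F" "g \<in> carrier F" shows "(\<lambda>w. f w \<oplus> g w) \<in> carrier F"
proof -
  have "{w. f w \<oplus> g w \<noteq> \<zero>} \<subseteq> {w. f w \<noteq> \<zero>} \<union> {w. g w \<noteq> \<zero>}" by auto
  moreover have "finite ({w. f w \<noteq> \<zero>} \<union> {w. g w \<noteq> \<zero>})"
    "{w. f w \<noteq> \<zero>} \<union> {w. g w \<noteq> \<zero>} \<subseteq> words"
    using assms unfolding F_carrier by auto
  ultimately show ?thesis
    using assms unfolding F_carrier by (blast intro: finite_subset R.a_closed)
qed

lemma F_smult_closed:
  assumes "r \<in> carrier R" "f \<in> carrier F" shows "(\<lambda>w. r \<otimes> f w) \<in> carrier F"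
proof -
  have "{w. r \<otimes> f w \<noteq> \<zero>} \<subseteq> {w. f w \<noteq> \<zero>}" using assms by auto
  then show ?thesis using assms unfolding F_carrier by (blast intro: finite_subset R.m_closed)
qed

lemma F_ring: "ring F"
proof (rule ringI)
  show "abelian_group F"
  proof (rule abelian_groupI)
    fix f assume f: "f \<in> carrier F"
    have "(\<lambda>w. \<ominus> f w) \<in> carrier F"
      using F_smult_closed[of "\<ominus> \<one>" f] f by (simp add: R.l_minus F_val)
    then show "\<exists>g\<in>carrier F. g \<oplus>\<^bsub>F\<^esub> f = \<zero>\<^bsub>F\<^esub>"
      using f by (intro bexI) (auto simp: F_simps R.l_neg F_val)
  qed (auto simp: F_simps F_add_closed R.a_ac F_val, auto simp: F_carrier)
next
  show "Group.monoid F"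
    by (rule monoidI) (auto simp: F_simps[symmetric] fun_eq_iff conv_closed,
        (auto simp: F_simps(1,2,3) conv_assoc conv_one_left conv_one_right conv_closed F_vals),
        auto simp: F_carrier F_simps)
qed (auto simp: F_simps conv_add_left conv_add_right F_vals)

lemma F_carrier_monom: "r \<in> carrier R \<Longrightarrow> w \<in> words \<Longrightarrow> monom_word R r w \<in> carrier F"
  by (auto simp: F_carrier monom_word_def)

lemma F_minus:
  assumes "f \<in> carrier F" shows "\<ominus>\<^bsub>F\<^esub> f = (\<lambda>w. \<ominus> f w)"
proof -
  interpret F: ring F by (rule F_ring)
  have "(\<lambda>w. \<ominus> f w) \<in> carrier F"
    using F_smult_closed[of "\<ominus> \<one>" f] assms by (simp add: R.l_minus F_val)
  moreover have "(\<lambda>w. \<ominus> f w) \<oplus>\<^bsub>F\<^esub> f = \<zero>\<^bsub>F\<^esub>"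
    using assms by (auto simp: F_simps R.l_neg F_val)
  ultimately show ?thesis using F.minus_equality assms by blast
qed

text \<open>Induction over the finite support, one word at a time. The set \<open>W\<close> carries
  knowledge about the support, such as a fixed degree or length, into the inductive step.\<close>

lemma F_induct:
  assumes f: "f \<in> carrier F" and W: "{w. f w \<noteq> \<zero>} \<subseteq> W" and zero: "P (\<lambda>w. \<zero>)"
    and add: "\<And>f r w. \<lbrakk>f \<in> carrier F; P f; r \<in> carrier R; w \<in> words; w \<in> W\<rbrakk>
      \<Longrightarrow> P (\<lambda>u. f u \<oplus> monom_word R r w u)"
  shows "P f"
proof -
  have "\<lbrakk>f \<in> carrier F; {w. f w \<noteq> \<zero>} = S; S \<subseteq> W\<rbrakk> \<Longrightarrow> P f" if "finite S" for S f
    using that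
  proof (induction S arbitrary: f rule: finite_induct)
    case empty
    then have "f = (\<lambda>w. \<zero>)" by auto
    then show ?case using zero by simp
  next
    case (insert w S)
    let ?f = "\<lambda>u. if u = w then \<zero> else f u"
    have fw: "f w \<noteq> \<zero>" using insert.prems(2) by auto
    have sub: "{u. ?f u \<noteq> \<zero>} \<subseteq> {u. f u \<noteq> \<zero>}" by auto
    then have c: "?f \<in> carrier F" using insert.prems(1) unfolding F_carrier
      by (auto intro: finite_subset)
    have "{u. ?f u \<noteq> \<zero>} = S" using insert.prems(2) insert.hyps by auto
    then have "P ?f" using insert.prems by (intro insert.IH[OF c]) auto
    moreover have "w \<in> words" using insert.prems(1) fw by (auto simp: F_carrier)
    ultimately have "P (\<lambda>u. ?f u \<oplus> monom_word R (f w) w u)"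
      using insert.prems c by (intro add) (auto simp: F_val)
    also have "(\<lambda>u. ?f u \<oplus> monom_word R (f w) w u) = f"
      using insert.prems(1) by (auto simp: monom_word_def F_val)
    finally show ?case .
  qed
  from this[of "{w. f w \<noteq> \<zero>}" f] show ?thesis using f W by (auto simp: F_carrier)
qed

lemma conv_monom:
  assumes "r \<in> carrier R" "g \<in> vals"
  shows "conv (monom_word R r u) g (u @ v) = r \<otimes> g v"
    and "(\<And>v. w \<noteq> u @ v) \<Longrightarrow> conv (monom_word R r u) g w = \<zero>"
proof -
  have m: "monom_word R r u \<in> vals" using assms by (auto simp: monom_word_def)
  have "conv (monom_word R r u) g (u @ v) =
      (\<Oplus>k\<in>{..length (u @ v)}. if length u = k then r \<otimes> g (drop k (u @ v)) else \<zero>)"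
  proof (unfold conv_def, intro finsum_cong' refl)
    fix k assume k: "k \<in> {..length (u @ v)}"
    have "take k (u @ v) = u \<longleftrightarrow> length u = k"
    proof
      assume "take k (u @ v) = u"
      then have "length (take k (u @ v)) = length u" by simp
      then show "length u = k" using k by simp
    qed simp
    then show "monom_word R r u (take k (u @ v)) \<otimes> g (drop k (u @ v)) =
        (if length u = k then r \<otimes> g (drop k (u @ v)) else \<zero>)"
      using assms by (auto simp: monom_word_def Pi_iff)
  qed (use assms in \<open>auto simp: Pi_iff\<close>)
  also have "\<dots> = r \<otimes> g v"
    using assms by (subst R.add.finprod_singleton) (auto simp: Pi_iff)
  finally show "conv (monom_word R r u) g (u @ v) = r \<otimes> g v" .
  assume "\<And>v. w \<noteq> u @ v"
  then have "take k w \<noteq> u" for k by (metis append_take_drop_id)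
  then show "conv (monom_word R r u) g w = \<zero>"
    unfolding conv_def using assms by (intro R.add.finprod_one_eqI) (auto simp: monom_word_def Pi_iff)
qed

lemma conv_monom_monom:
  assumes "r \<in> carrier R" "s \<in> carrier R"
  shows "conv (monom_word R r u) (monom_word R s v) = monom_word R (r \<otimes> s) (u @ v)"
proof
  fix w
  have m: "monom_word R s v \<in> vals" using assms by (auto simp: monom_word_def)
  show "conv (monom_word R r u) (monom_word R s v) w = monom_word R (r \<otimes> s) (u @ v) w"
  proof (cases "\<exists>x. w = u @ x")
    case True
    then show ?thesis using conv_monom(1)[OF assms(1) m, of u] assms
      by (auto simp: monom_word_def split: if_splits)
  next
    case False
    then show ?thesis using conv_monom(2)[OF assms(1) m, where w=w] by (auto simp: monom_word_def)
  qed
qed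

section \<open>The tensor algebra as a module\<close>

lemma rels_closed: "tens_rels R V \<subseteq> carrier F"
proof -
  interpret F: ring F by (rule F_ring)
  have "monom_word R r [(i, x)] \<in> carrier F" if "r \<in> carrier R" "x \<in> grade V i" for r i x
    using that by (intro F_carrier_monom) (auto simp: letters_def)
  then show ?thesis unfolding tens_rels_def
    by (auto intro!: F.minus_closed F.add.m_closed grade_add_closed grade_smult_closed)
qed

abbreviation "I \<equiv> tens_ideal R V"

lemma I_ideal: "ideal I F"
  unfolding tens_ideal_def by (rule ring.genideal_ideal[OF F_ring rels_closed])

lemma T_simps:
  "carrier T = {tclass R V f | f. f \<in> carrier F}"
  "zero T = I" "add T = set_add F" "mult T = rcoset_mult F I" "one T = tclass R V \<one>\<^bsub>F\<^esub>"
  by (auto simp: tens_def FactRing_def A_RCOSETS_def' tclass_def Let_def)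

lemma T_carrierI: "f \<in> carrier F \<Longrightarrow> tclass R V f \<in> carrier T"
  by (auto simp: T_simps)

lemma T_carrierE: assumes "A \<in> carrier T" obtains f where "f \<in> carrier F" "A = tclass R V f"
  using assms by (auto simp: T_simps)

lemma tclass_add:
  "f \<in> carrier F \<Longrightarrow> g \<in> carrier F \<Longrightarrow>
   tclass R V f \<oplus>\<^bsub>T\<^esub> tclass R V g = tclass R V (\<lambda>w. f w \<oplus> g w)"
  using ideal.a_rcos_sum[OF I_ideal] by (simp add: T_simps tclass_def F_simps)

lemma tclass_mult:
  "f \<in> carrier F \<Longrightarrow> g \<in> carrier F \<Longrightarrow> tclass R V f \<otimes>\<^bsub>T\<^esub> tclass R V g = tclass R V (conv f g)"
  using ideal.rcoset_mult_add[OF I_ideal] by (simp add: T_simps tclass_def F_simps)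

lemma conv_const: "r \<in> carrier R \<Longrightarrow> f \<in> vals \<Longrightarrow> conv (monom_word R r []) f = (\<lambda>w. r \<otimes> f w)"
  using conv_monom(1)[of r f "[]"] by (auto simp: fun_eq_iff)

lemma tclass_smult:
  "r \<in> carrier R \<Longrightarrow> f \<in> carrier F \<Longrightarrow> r \<odot>\<^bsub>T\<^esub> tclass R V f = tclass R V (\<lambda>w. r \<otimes> f w)"
proof -
  assume *: "r \<in> carrier R" "f \<in> carrier F"
  have "r \<odot>\<^bsub>T\<^esub> tclass R V f = tclass R V (monom_word R r []) \<otimes>\<^bsub>T\<^esub> tclass R V f"
    by (simp add: tens_def Let_def)
  also have "\<dots> = tclass R V (conv (monom_word R r []) f)"
    using * by (intro tclass_mult F_carrier_monom) auto
  finally show ?thesis using * by (simp add: conv_const F_vals)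
qed

text \<open>\<open>T\<close> copies the ring fields of the quotient \<open>F Quot I\<close> into a
  larger record, so the ring laws have to be transferred field by field.\<close>

lemma T_ring: "ring T"
proof -
  interpret Q: ring "F Quot I" by (rule ideal.quotient_is_ring[OF I_ideal])
  have eqs: "carrier T = carrier (F Quot I)" "add T = add (F Quot I)" "mult T = mult (F Quot I)"
    "one T = one (F Quot I)" "zero T = zero (F Quot I)"
    by (simp_all add: tens_def Let_def)
  show ?thesis
  proof (rule ringI)
    show "abelian_group T"
    proof (rule abelian_groupI)
      fix x assume "x \<in> carrier T"
      then show "\<exists>y\<in>carrier T. y \<oplus>\<^bsub>T\<^esub> x = \<zero>\<^bsub>T\<^esub>"
        using Q.l_neg[of x] Q.a_inv_closed[of x] by (auto simp: eqs)
    qed (simp_all add: eqs Q.a_ac)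
    show "Group.monoid T"
      by (rule monoidI) (simp_all add: eqs Q.m_assoc)
  qed (simp_all add: eqs Q.l_distr Q.r_distr)
qed

sublocale T: ring T by (rule T_ring)

lemma T_module: "Module.module R T"
proof (rule moduleI)
  show "abelian_group T" by (rule T.abelian_group_axioms)
qed (auto elim!: T_carrierE simp: tclass_smult tclass_add F_smult_closed F_add_closed T_carrierI
     l_distr r_distr F_val m_assoc R.is_cring)

sublocale TM: Module.module R T by (rule T_module)

lemma T_smult_assoc2:
  "\<lbrakk>r \<in> carrier R; A \<in> carrier T; B \<in> carrier T\<rbrakk> \<Longrightarrow> (r \<odot>\<^bsub>T\<^esub> A) \<otimes>\<^bsub>T\<^esub> B = r \<odot>\<^bsub>T\<^esub> (A \<otimes>\<^bsub>T\<^esub> B)"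
  by (elim T_carrierE) (simp add: tclass_smult tclass_mult F_smult_closed conv_closed F_vals ext[OF
    conv_smult_left])

lemma conv_smult_right:
  "\<lbrakk>r \<in> carrier R; f \<in> vals; g \<in> vals\<rbrakk> \<Longrightarrow> conv f (\<lambda>w. r \<otimes> g w) w = r \<otimes> conv f g w"
  unfolding conv_def by (subst finsum_rdistr) (auto simp: Pi_iff R.m_lcomm intro!: finsum_cong')

lemma T_smult_right:
  "\<lbrakk>r \<in> carrier R; A \<in> carrier T; B \<in> carrier T\<rbrakk> \<Longrightarrow> A \<otimes>\<^bsub>T\<^esub> (r \<odot>\<^bsub>T\<^esub> B) = r \<odot>\<^bsub>T\<^esub> (A \<otimes>\<^bsub>T\<^esub> B)"
  by (elim T_carrierE) (simp add: tclass_smult tclass_mult F_smult_closed conv_closed F_vals ext[OF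
    conv_smult_right])

lemma tclass_zero: "tclass R V (\<lambda>w. \<zero>) = \<zero>\<^bsub>T\<^esub>"
proof -
  interpret F: ring F by (rule F_ring)
  have "I +>\<^bsub>F\<^esub> \<zero>\<^bsub>F\<^esub> = I" using I_ideal by (metis F.a_rcos_zero additive_subgroup.zero_closed ideal_def)
  then show ?thesis by (simp add: tclass_def T_simps F_simps)
qed

lemma tword_closed [simp]: "w \<in> words \<Longrightarrow> tword R V w \<in> carrier T"
  unfolding tword_def by (intro T_carrierI F_carrier_monom) auto

lemma tclass_monom: "r \<in> carrier R \<Longrightarrow> w \<in> words \<Longrightarrow> tclass R V (monom_word R r w) = r \<odot>\<^bsub>T\<^esub> tword R V w"
  unfolding tword_def
  by (subst tclass_smult)
     (simp_all add: F_carrier_monom, auto simp: monom_word_def intro!: arg_cong[of _ _ "tclass R V"])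

lemma tword_append:
  "u \<in> words \<Longrightarrow> v \<in> words \<Longrightarrow> tword R V (u @ v) = tword R V u \<otimes>\<^bsub>T\<^esub> tword R V v"
  unfolding tword_def by (simp add: tclass_mult F_carrier_monom conv_monom_monom)

lemma T_induct:
  assumes "f \<in> carrier F" "{w. f w \<noteq> \<zero>} \<subseteq> W" "P \<zero>\<^bsub>T\<^esub>"
    and "\<And>A r w. \<lbrakk>A \<in> carrier T; P A; r \<in> carrier R; w \<in> words; w \<in> W\<rbrakk> \<Longrightarrow> P (A \<oplus>\<^bsub>T\<^esub> r \<odot>\<^bsub>T\<^esub> tword R V w)"
  shows "P (tclass R V f)"
proof (rule F_induct[OF assms(1,2), where P = "\<lambda>f. P (tclass R V f)"])
  fix f r w assume "f \<in> carrier F" "P (tclass R V f)" "r \<in> carrier R" "w \<in> words" "w \<in> W"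
  then show "P (tclass R V (\<lambda>u. f u \<oplus> monom_word R r w u))"
    using assms(4)[of "tclass R V f" r w]
    by (simp add: tclass_add F_carrier_monom T_carrierI flip: tclass_monom)
qed (use assms in \<open>auto simp: tclass_zero\<close>)

end

section \<open>Linear maps out of the tensor algebra\<close>

text \<open>\<open>gmor\<close> with the condition on degrees dropped. Sums, compositions and sign
  changes stay in this class, which is enough for comparing maps on pure tensors.\<close>

definition rlin :: "'r ring \<Rightarrow> ('r, 'a, 'y) gmod_scheme \<Rightarrow> ('r, 'b, 'z) gmod_scheme \<Rightarrow> ('a \<Rightarrow> 'b)
  \<Rightarrow> bool" where
  "rlin R V W f \<longleftrightarrow>
     (\<forall>x\<in>carrier V. f x \<in> carrier W) \<and>
     (\<forall>x\<in>carrier V. \<forall>y\<in>carrier V. f (x \<oplus>\<^bsub>V\<^esub> y) = f x \<oplus>\<^bsub>W\<^esub> f y) \<and>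
     (\<forall>r\<in>carrier R. \<forall>x\<in>carrier V. f (r \<odot>\<^bsub>V\<^esub> x) = r \<odot>\<^bsub>W\<^esub> f x)"

definition grade_linear ::
  "'r ring \<Rightarrow> ('r, 'v, 'y) gmod_scheme \<Rightarrow> ('r, 'b, 'z) gmod_scheme \<Rightarrow> int \<Rightarrow> ('v \<Rightarrow> 'b) \<Rightarrow> bool" where
  "grade_linear R V N i h \<longleftrightarrow>
     (\<forall>x\<in>grade V i. \<forall>y\<in>grade V i. h (x \<oplus>\<^bsub>V\<^esub> y) = h x \<oplus>\<^bsub>N\<^esub> h y) \<and>
     (\<forall>r\<in>carrier R. \<forall>x\<in>grade V i. h (r \<odot>\<^bsub>V\<^esub> x) = r \<odot>\<^bsub>N\<^esub> h x)"

text \<open>Linearity in each letter is demanded only within one degree, in parallel with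
  \<open>tens_rels\<close>. This is what makes the linear extension of \<open>phi\<close> vanish on
  the ideal generated by these relations.\<close>

definition multilinear ::
  "'r ring \<Rightarrow> ('r, 'v, 'y) gmod_scheme \<Rightarrow> ('r, 'b, 'z) gmod_scheme \<Rightarrow> ((int \<times> 'v) list \<Rightarrow> 'b) \<Rightarrow> bool" where
  "multilinear R V N \<phi> \<longleftrightarrow>
     (\<forall>w\<in>lists (letters V). \<phi> w \<in> carrier N) \<and>
     (\<forall>u\<in>lists (letters V). \<forall>v\<in>lists (letters V). \<forall>i. grade_linear R V N i (\<lambda>x. \<phi> (u @ (i, x) # v)))"

definition word_eval ::
  "'r ring \<Rightarrow> ('r, 'b, 'z) gmod_scheme \<Rightarrow> ((int \<times> 'v) list \<Rightarrow> 'b) \<Rightarrow> ((int \<times> 'v) list \<Rightarrow> 'r) \<Rightarrow> 'b" where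
  "word_eval R N \<phi> f = (\<Oplus>\<^bsub>N\<^esub> w \<in> {w. f w \<noteq> \<zero>\<^bsub>R\<^esub>}. f w \<odot>\<^bsub>N\<^esub> \<phi> w)"

lemma tlift_eq: "tlift R N \<phi> A = word_eval R N \<phi> (SOME f. f \<in> A)"
  by (simp only: tlift_def word_eval_def Let_def)

context graded_letters
begin

lemma word_eval_superset:
  assumes "Module.module R N" and f: "f \<in> carrier F" and \<phi>: "\<And>w. w \<in> words \<Longrightarrow> \<phi> w \<in> carrier N"
    and "finite W" "{w. f w \<noteq> \<zero>} \<subseteq> W" "W \<subseteq> words"
  shows "word_eval R N \<phi> f = (\<Oplus>\<^bsub>N\<^esub> w \<in> W. f w \<odot>\<^bsub>N\<^esub> \<phi> w)"
proof -
  interpret N: Module.module R N by fact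
  show ?thesis unfolding word_eval_def
    using assms by (intro N.finsum_mono_neutral_left) (auto simp: F_val subset_iff)
qed

lemma word_eval_closed:
  assumes "Module.module R N" and f: "f \<in> carrier F" and \<phi>: "\<And>w. w \<in> words \<Longrightarrow> \<phi> w \<in> carrier N"
  shows "word_eval R N \<phi> f \<in> carrier N"
proof -
  interpret N: Module.module R N by fact
  show ?thesis unfolding word_eval_def
    using f \<phi> unfolding F_carrier by (intro N.finsum_closed) (auto simp: Pi_iff subset_iff)
qed

lemma word_eval_add:
  assumes N: "Module.module R N" and f: "f \<in> carrier F" and g: "g \<in> carrier F"
    and \<phi>: "\<And>w. w \<in> words \<Longrightarrow> \<phi> w \<in> carrier N"
  shows "word_eval R N \<phi> (\<lambda>w. f w \<oplus> g w) = word_eval R N \<phi> f \<oplus>\<^bsub>N\<^esub> word_eval R N \<phi> g"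
proof -
  interpret N: Module.module R N by fact
  let ?W = "{w. f w \<noteq> \<zero>} \<union> {w. g w \<noteq> \<zero>}"
  have W: "finite ?W" "?W \<subseteq> words" using f g by (auto simp: F_carrier)
  have "{w. f w \<oplus> g w \<noteq> \<zero>} \<subseteq> ?W" by auto
  then have "word_eval R N \<phi> (\<lambda>w. f w \<oplus> g w) = (\<Oplus>\<^bsub>N\<^esub> w \<in> ?W. (f w \<oplus> g w) \<odot>\<^bsub>N\<^esub> \<phi> w)"
    by (intro word_eval_superset N F_add_closed f g \<phi> W)
  also have "\<dots> = (\<Oplus>\<^bsub>N\<^esub> w \<in> ?W. f w \<odot>\<^bsub>N\<^esub> \<phi> w \<oplus>\<^bsub>N\<^esub> g w \<odot>\<^bsub>N\<^esub> \<phi> w)"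
    using W \<phi> f g by (intro N.finsum_cong') (auto simp: N.smult_l_distr F_val subset_iff)
  also have "\<dots> = (\<Oplus>\<^bsub>N\<^esub> w \<in> ?W. f w \<odot>\<^bsub>N\<^esub> \<phi> w) \<oplus>\<^bsub>N\<^esub> (\<Oplus>\<^bsub>N\<^esub> w \<in> ?W. g w \<odot>\<^bsub>N\<^esub> \<phi> w)"
    using W \<phi> f g by (intro N.finsum_addf) (auto simp: F_val subset_iff)
  also have "\<dots> = word_eval R N \<phi> f \<oplus>\<^bsub>N\<^esub> word_eval R N \<phi> g"
    using W f g \<phi> by (simp add: word_eval_superset[OF N _ _ W(1) _ W(2)])
  finally show ?thesis .
qed

lemma word_eval_monom:
  assumes N: "Module.module R N" and "r \<in> carrier R" "\<phi> w \<in> carrier N"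
  shows "word_eval R N \<phi> (monom_word R r w) = r \<odot>\<^bsub>N\<^esub> \<phi> w"
proof -
  interpret N: Module.module R N by fact
  have "{u. monom_word R r w u \<noteq> \<zero>} = (if r = \<zero> then {} else {w})"
    by (auto simp: monom_word_def)
  then show ?thesis using assms by (auto simp: word_eval_def monom_word_def)
qed

lemma word_eval_smult:
  assumes N: "Module.module R N" and r: "r \<in> carrier R" and f: "f \<in> carrier F"
    and \<phi>: "\<And>w. w \<in> words \<Longrightarrow> \<phi> w \<in> carrier N"
  shows "word_eval R N \<phi> (\<lambda>w. r \<otimes> f w) = r \<odot>\<^bsub>N\<^esub> word_eval R N \<phi> f"
proof -
  interpret N: Module.module R N by fact
  have W: "finite {w. f w \<noteq> \<zero>}" "{w. f w \<noteq> \<zero>} \<subseteq> words" using f by (auto simp: F_carrier)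
  have "{w. r \<otimes> f w \<noteq> \<zero>} \<subseteq> {w. f w \<noteq> \<zero>}" using r by auto
  then have "word_eval R N \<phi> (\<lambda>w. r \<otimes> f w) = (\<Oplus>\<^bsub>N\<^esub> w \<in> {w. f w \<noteq> \<zero>}. (r \<otimes> f w) \<odot>\<^bsub>N\<^esub> \<phi> w)"
    by (intro word_eval_superset N F_smult_closed r f \<phi> W)
  also have "\<dots> = (\<Oplus>\<^bsub>N\<^esub> w \<in> {w. f w \<noteq> \<zero>}. r \<odot>\<^bsub>N\<^esub> (f w \<odot>\<^bsub>N\<^esub> \<phi> w))"
    using W \<phi> f r by (intro N.finsum_cong') (auto simp: N.smult_assoc1 F_val subset_iff)
  also have "\<dots> = r \<odot>\<^bsub>N\<^esub> word_eval R N \<phi> f"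
    unfolding word_eval_def using W \<phi> f r
    by (subst N.finsum_smult_ldistr) (auto simp: F_val subset_iff)
  finally show ?thesis .
qed

lemma word_eval_zero: "word_eval R N \<phi> (\<lambda>w. \<zero>) = \<zero>\<^bsub>N\<^esub>" if "Module.module R N"
proof -
  interpret N: Module.module R N by fact
  show ?thesis by (simp add: word_eval_def)
qed

text \<open>Left multiplication by a monomial only prefixes words, so it can be absorbed into
  \<open>\<phi>\<close>. Together with the right-hand version this gives the stability under
  multiplication of the annihilator used in \<open>word_eval_tens_ideal\<close>.\<close>

lemma word_eval_conv_monom_left:
  assumes N: "Module.module R N" and r: "r \<in> carrier R" and f: "f \<in> carrier F" and u: "u \<in> words"
    and \<phi>: "\<And>w. w \<in> words \<Longrightarrow> \<phi> w \<in> carrier N"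
  shows "word_eval R N \<phi> (conv (monom_word R r u) f) = r \<odot>\<^bsub>N\<^esub> word_eval R N (\<lambda>w. \<phi> (u @ w)) f"
proof (rule F_induct[OF f subset_UNIV])
  let ?l = "\<lambda>f. word_eval R N \<phi> (conv (monom_word R r u) f)" and ?r =
    "\<lambda>f. r \<odot>\<^bsub>N\<^esub> word_eval R N (\<lambda>w. \<phi> (u @ w)) f"
  interpret N: Module.module R N by fact
  interpret F: ring F by (rule F_ring)
  note m = F_carrier_monom[OF r u] and v = F_vals[OF F_carrier_monom[OF r u]]
  have z: "conv (monom_word R r u) (\<lambda>w. \<zero>) = (\<lambda>w. \<zero>)"
    using F.r_null[OF m] by (simp add: F_simps)
  show "?l (\<lambda>w. \<zero>) = ?r (\<lambda>w. \<zero>)"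
    using r by (simp add: z word_eval_zero[OF N])
  fix f s w
  assume *: "f \<in> carrier F"
     "?l f = ?r f"
     "s \<in> carrier R" "w \<in> words"
  have "conv (monom_word R r u) (\<lambda>x. f x \<oplus> monom_word R s w x) =
     (\<lambda>x. conv (monom_word R r u) f x \<oplus> monom_word R (r \<otimes> s) (u @ w) x)"
    using * r v conv_monom_monom[OF r, of s u w]
    by (intro ext) (simp add: conv_add_right F_vals F_carrier_monom)
  then have "?l (\<lambda>x. f x \<oplus> monom_word R s w x) =
     ?r f \<oplus>\<^bsub>N\<^esub> (r \<otimes> s) \<odot>\<^bsub>N\<^esub> \<phi> (u @ w)"
    using * r u \<phi> by (simp add: word_eval_add[OF N] conv_closed m F_carrier_monom word_eval_monom[OF N]
      append_in_lists_conv)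
  also have "\<dots> = ?r (\<lambda>x. f x \<oplus> monom_word R s w x)"
    using * r u \<phi> by (simp add: word_eval_add[OF N] word_eval_closed[OF N] F_carrier_monom
      word_eval_monom[OF N]
      append_in_lists_conv N.smult_assoc1 N.smult_r_distr)
  finally show "?l (\<lambda>x. f x \<oplus> monom_word R s w x) =
     ?r (\<lambda>x. f x \<oplus> monom_word R s w x)" .
qed

lemma word_eval_conv_monom_right:
  assumes N: "Module.module R N" and r: "r \<in> carrier R" and f: "f \<in> carrier F" and u: "u \<in> words"
    and \<phi>: "\<And>w. w \<in> words \<Longrightarrow> \<phi> w \<in> carrier N"
  shows "word_eval R N \<phi> (conv f (monom_word R r u)) = r \<odot>\<^bsub>N\<^esub> word_eval R N (\<lambda>w. \<phi> (w @ u)) f"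
proof (rule F_induct[OF f subset_UNIV])
  let ?l = "\<lambda>f. word_eval R N \<phi> (conv f (monom_word R r u))" and ?r =
    "\<lambda>f. r \<odot>\<^bsub>N\<^esub> word_eval R N (\<lambda>w. \<phi> (w @ u)) f"
  interpret N: Module.module R N by fact
  interpret F: ring F by (rule F_ring)
  note m = F_carrier_monom[OF r u] and v = F_vals[OF F_carrier_monom[OF r u]]
  have z: "conv (\<lambda>w. \<zero>) (monom_word R r u) = (\<lambda>w. \<zero>)"
    using F.l_null[OF m] by (simp add: F_simps)
  show "?l (\<lambda>w. \<zero>) = ?r (\<lambda>w. \<zero>)"
    using r by (simp add: z word_eval_zero[OF N])
  fix f s w
  assume *: "f \<in> carrier F"
     "?l f = ?r f"
     "s \<in> carrier R" "w \<in> words"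
  have "conv (\<lambda>x. f x \<oplus> monom_word R s w x) (monom_word R r u) =
     (\<lambda>x. conv f (monom_word R r u) x \<oplus> monom_word R (r \<otimes> s) (w @ u) x)"
    using * r v conv_monom_monom[of s r w u]
    by (intro ext) (simp add: conv_add_left F_vals F_carrier_monom R.m_comm[of r s])
  then have "?l (\<lambda>x. f x \<oplus> monom_word R s w x) =
     ?r f \<oplus>\<^bsub>N\<^esub> (r \<otimes> s) \<odot>\<^bsub>N\<^esub> \<phi> (w @ u)"
    using * r u \<phi> by (simp add: word_eval_add[OF N] conv_closed m F_carrier_monom word_eval_monom[OF N]
      append_in_lists_conv)
  also have "\<dots> = ?r (\<lambda>x. f x \<oplus> monom_word R s w x)"
    using * r u \<phi> by (simp add: word_eval_add[OF N] word_eval_closed[OF N] F_carrier_monom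
      word_eval_monom[OF N]
      append_in_lists_conv N.smult_assoc1 N.smult_r_distr)
  finally show "?l (\<lambda>x. f x \<oplus> monom_word R s w x) =
     ?r (\<lambda>x. f x \<oplus> monom_word R s w x)" .
qed

lemma word_eval_minus:
  assumes N: "Module.module R N" and "f \<in> carrier F" "g \<in> carrier F" and \<phi>: "\<And>w. w \<in> words
    \<Longrightarrow> \<phi> w \<in> carrier N"
  shows "word_eval R N \<phi> (f \<ominus>\<^bsub>F\<^esub> g) = word_eval R N \<phi> f \<ominus>\<^bsub>N\<^esub> word_eval R N \<phi> g"
proof -
  interpret N: Module.module R N by fact
  have "f \<ominus>\<^bsub>F\<^esub> g = (\<lambda>w. f w \<oplus> (\<ominus> \<one>) \<otimes> g w)"
    using assms by (simp add: a_minus_def F_simps F_minus R.l_minus F_val)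
  then show ?thesis
    using assms by (simp add: word_eval_add[OF N] F_smult_closed word_eval_smult[OF N] N.smult_l_minus
      word_eval_closed a_minus_def)
qed

lemma multilinear_closed: "multilinear R V N \<phi> \<Longrightarrow> w \<in> words \<Longrightarrow> \<phi> w \<in> carrier N"
  by (simp add: multilinear_def)

text \<open>
  The functions that are annihilated by \<open>\<phi> (u @ _ @ v)\<close> for all words \<open>u\<close>, \<open>v\<close> form a two-sided
  ideal, which contains the relations when \<open>\<phi>\<close> is multilinear.
\<close>

lemma word_eval_tens_ideal:
  assumes N: "Module.module R N" and \<phi>: "multilinear R V N \<phi>" and f: "f \<in> I"
  shows "word_eval R N \<phi> f = \<zero>\<^bsub>N\<^esub>"
proof -
  interpret N: Module.module R N by fact
  interpret F: ring F by (rule F_ring)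
  let ?\<phi> = "\<lambda>u v w. \<phi> (u @ w @ v)"
  have c: "?\<phi> u v w \<in> carrier N" if "u \<in> words" "v \<in> words" "w \<in> words" for u v w
    using \<phi> that by (simp add: multilinear_closed)
  let ?J = "{f \<in> carrier F. \<forall>u\<in>words. \<forall>v\<in>words. word_eval R N (?\<phi> u v) f = \<zero>\<^bsub>N\<^esub>}"
  have add: "(\<lambda>w. f w \<oplus> g w) \<in> ?J" if "f \<in> ?J" "g \<in> ?J" for f g
    using that c by (simp add: F_add_closed word_eval_add[OF N])
  have "ideal ?J F"
  proof (rule idealI[OF F_ring])
    show "subgroup ?J (add_monoid F)"
    proof (rule F.add.subgroupI)
      show "\<ominus>\<^bsub>F\<^esub> f \<in> ?J" if f: "f \<in> ?J" for f
      proof -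
        have "\<ominus>\<^bsub>F\<^esub> f = (\<lambda>w. (\<ominus> \<one>) \<otimes> f w)" using f by (simp add: F_minus R.l_minus F_val)
        then show ?thesis using f c by (simp add: F_smult_closed word_eval_smult[OF N])
      qed
      have "(\<lambda>w. \<zero>) \<in> ?J" using F.zero_closed by (simp add: word_eval_zero[OF N] F_simps)
      then show "?J \<noteq> {}" by blast
    qed (use add in \<open>auto simp: F_simps\<close>)
  next
    fix f g assume f: "f \<in> ?J" and g: "g \<in> carrier F"
    have fF: "f \<in> carrier F" using f by simp
    show "g \<otimes>\<^bsub>F\<^esub> f \<in> ?J"
    \<comment> \<open>An arbitrary multiplier is a sum of monomials; multiplying by the word
      \<open>w\<close> on the left enlarges the context from \<open>u\<close>, \<open>v\<close> to
      \<open>u @ w\<close>, \<open>v\<close>.\<close>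
    proof (rule F_induct[OF g subset_UNIV])
      show "(\<lambda>w. \<zero>) \<otimes>\<^bsub>F\<^esub> f \<in> ?J"
        using F.l_null[OF fF] F.zero_closed by (simp add: F_simps word_eval_zero[OF N])
      fix g r w
      assume *: "g \<in> carrier F" "g \<otimes>\<^bsub>F\<^esub> f \<in> ?J" "r \<in> carrier R" "w \<in> words"
      have "monom_word R r w \<otimes>\<^bsub>F\<^esub> f \<in> ?J"
        using * f c by (simp add: F_simps conv_closed F_carrier_monom word_eval_conv_monom_left[OF N]
            flip: append_assoc)
      then have "(\<lambda>x. (g \<otimes>\<^bsub>F\<^esub> f) x \<oplus> (monom_word R r w \<otimes>\<^bsub>F\<^esub> f) x) \<in> ?J" by (intro add *)
      then show "(\<lambda>u. g u \<oplus> monom_word R r w u) \<otimes>\<^bsub>F\<^esub> f \<in> ?J"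
        using * fF F.l_distr[of g "monom_word R r w" f] by (simp add: F_simps F_carrier_monom)
    qed
    show "f \<otimes>\<^bsub>F\<^esub> g \<in> ?J"
    proof (rule F_induct[OF g subset_UNIV])
      show "f \<otimes>\<^bsub>F\<^esub> (\<lambda>w. \<zero>) \<in> ?J"
        using F.r_null[OF fF] F.zero_closed by (simp add: F_simps word_eval_zero[OF N])
      fix g r w
      assume *: "g \<in> carrier F" "f \<otimes>\<^bsub>F\<^esub> g \<in> ?J" "r \<in> carrier R" "w \<in> words"
      have "f \<otimes>\<^bsub>F\<^esub> monom_word R r w \<in> ?J"
        using * f c by (simp add: F_simps conv_closed F_carrier_monom word_eval_conv_monom_right[OF N])
      then have "(\<lambda>x. (f \<otimes>\<^bsub>F\<^esub> g) x \<oplus> (f \<otimes>\<^bsub>F\<^esub> monom_word R r w) x) \<in> ?J" by (intro add *)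
      then show "f \<otimes>\<^bsub>F\<^esub> (\<lambda>u. g u \<oplus> monom_word R r w u) \<in> ?J"
        using * fF F.r_distr[of g "monom_word R r w" f] by (simp add: F_simps F_carrier_monom)
    qed
  qed
  moreover have "tens_rels R V \<subseteq> ?J"
  proof
    fix f assume f: "f \<in> tens_rels R V"
    then have fF: "f \<in> carrier F" using rels_closed by blast
    have "word_eval R N (?\<phi> u v) f = \<zero>\<^bsub>N\<^esub>" if uv: "u \<in> words" "v \<in> words" for u v
    proof -
      note c' = c[OF uv]
      have diff: "x \<ominus>\<^bsub>N\<^esub> x = \<zero>\<^bsub>N\<^esub>" if "x \<in> carrier N" for x
        using that by (simp add: a_minus_def N.r_neg)
      have l: "[(i, x)] \<in> words" if "x \<in> grade V i" for i x using that by (auto simp: letters_def)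
      have m: "monom_word R r [(i, x)] \<in> carrier F" if "r \<in> carrier R" "x \<in> grade V i" for r i x
        using that by (intro F_carrier_monom l)
      have p: "\<phi> (u @ (i, x) # v) \<in> carrier N" if "x \<in> grade V i" for i x
        using c'[OF l[OF that]] by simp
      consider i x y where "x \<in> grade V i" "y \<in> grade V i"
          "f = monom_word R \<one> [(i, x \<oplus>\<^bsub>V\<^esub> y)] \<ominus>\<^bsub>F\<^esub>
            (\<lambda>w. monom_word R \<one> [(i, x)] w \<oplus> monom_word R \<one> [(i, y)] w)"
        | i r x where "r \<in> carrier R" "x \<in> grade V i"
          "f = monom_word R \<one> [(i, r \<odot>\<^bsub>V\<^esub> x)] \<ominus>\<^bsub>F\<^esub> monom_word R r [(i, x)]"
        using f unfolding tens_rels_def F_simps by blast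
      then show ?thesis
      proof cases
        case 1
        have "\<phi> (u @ (i, x \<oplus>\<^bsub>V\<^esub> y) # v) = \<phi> (u @ (i, x) # v) \<oplus>\<^bsub>N\<^esub> \<phi> (u @ (i, y) # v)"
          using \<phi> uv 1 by (simp add: multilinear_def grade_linear_def)
        then show ?thesis
          using 1 c' p by (simp add: word_eval_minus[OF N] m F_add_closed grade_add_closed
              word_eval_add[OF N] word_eval_monom[OF N] diff)
      next
        case 2
        have "\<phi> (u @ (i, r \<odot>\<^bsub>V\<^esub> x) # v) = r \<odot>\<^bsub>N\<^esub> \<phi> (u @ (i, x) # v)"
          using \<phi> uv 2 by (simp add: multilinear_def grade_linear_def)
        then show ?thesis
          using 2 c' p by (simp add: word_eval_minus[OF N] m grade_smult_closed
              word_eval_monom[OF N] diff)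
      qed
    qed
    then show "f \<in> ?J" using fF by simp
  qed
  ultimately have "I \<subseteq> ?J" unfolding tens_ideal_def by (rule F.genideal_minimal)
  then have "\<forall>u\<in>words. \<forall>v\<in>words. word_eval R N (?\<phi> u v) f = \<zero>\<^bsub>N\<^esub>" using f by blast
  from this[rule_format, of "[]" "[]"] show ?thesis by simp
qed

text \<open>The representative picked by \<open>SOME\<close> differs from \<open>f\<close> by an
  element of the ideal, where the evaluation vanishes. This frees all later arguments from the
  choice.\<close>

lemma tlift_tclass:
  assumes N: "Module.module R N" and \<phi>: "multilinear R V N \<phi>" and f: "f \<in> carrier F"
  shows "tlift R N \<phi> (tclass R V f) = word_eval R N \<phi> f"
proof -
  interpret N: Module.module R N by fact
  interpret F: ring F by (rule F_ring)
  interpret I: ideal I F by (rule I_ideal)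
  have "f \<in> tclass R V f" unfolding tclass_def using f by (rule I.a_rcos_self)
  then have "(SOME g. g \<in> tclass R V f) \<in> tclass R V f"
    by (rule someI[where P = "\<lambda>g. g \<in> tclass R V f"])
  then obtain i where i: "i \<in> I" "(SOME g. g \<in> tclass R V f) = (\<lambda>w. i w \<oplus> f w)"
    unfolding tclass_def a_r_coset_def' F_simps by auto
  then have "i \<in> carrier F" by simp
  then show ?thesis unfolding tlift_eq i
    using f i \<phi> by (simp add: word_eval_add[OF N] multilinear_closed word_eval_tens_ideal[OF N]
      word_eval_closed[OF N])
qed

lemma tlift_tword:
  assumes N: "Module.module R N" and \<phi>: "multilinear R V N \<phi>" and w: "w \<in> words"
  shows "tlift R N \<phi> (tword R V w) = \<phi> w"
proof -
  interpret N: Module.module R N by fact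
  show ?thesis using w \<phi> multilinear_closed[OF \<phi> w]
    by (simp add: tword_def tlift_tclass[OF N] F_carrier_monom word_eval_monom[OF N])
qed

lemma tlift_rlin:
  assumes N: "Module.module R N" and \<phi>: "multilinear R V N \<phi>"
  shows "rlin R T N (tlift R N \<phi>)"
  unfolding rlin_def
proof (intro conjI ballI)
  note c = multilinear_closed[OF \<phi>]
  fix A assume A: "A \<in> carrier T"
  then obtain f where f: "f \<in> carrier F" "A = tclass R V f" by (rule T_carrierE)
  show "tlift R N \<phi> A \<in> carrier N"
    using f c by (simp add: tlift_tclass[OF N \<phi>] word_eval_closed[OF N])
  show "tlift R N \<phi> (r \<odot>\<^bsub>T\<^esub> A) = r \<odot>\<^bsub>N\<^esub> tlift R N \<phi> A" if "r \<in> carrier R" for r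
    using f c that by (simp add: tclass_smult tlift_tclass[OF N \<phi>] F_smult_closed word_eval_smult[OF N])
  show "tlift R N \<phi> (A \<oplus>\<^bsub>T\<^esub> B) = tlift R N \<phi> A \<oplus>\<^bsub>N\<^esub> tlift R N \<phi> B" if B: "B \<in> carrier T" for B
  proof -
    obtain g where g: "g \<in> carrier F" "B = tclass R V g" using B by (rule T_carrierE)
    then show ?thesis
      using f c by (simp add: tclass_add tlift_tclass[OF N \<phi>] F_add_closed word_eval_add[OF N])
  qed
qed

text \<open>The working principle for identities between linear maps on tensors: they need to be
  checked only on pure tensors of the words in \<open>W\<close>, a bound for the support of one
  representative.\<close>

lemma rlin_eq_on_words:
  assumes N: "Module.module R N" and h: "rlin R T N h" and k: "rlin R T N k"
    and f: "f \<in> carrier F" "{w. f w \<noteq> \<zero>} \<subseteq> W"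
    and eq: "\<And>w. w \<in> words \<Longrightarrow> w \<in> W \<Longrightarrow> h (tword R V w) = k (tword R V w)"
  shows "h (tclass R V f) = k (tclass R V f)"
proof -
  interpret N: Module.module R N by fact
  have "h \<zero>\<^bsub>T\<^esub> = h (\<zero> \<odot>\<^bsub>T\<^esub> \<zero>\<^bsub>T\<^esub>)" "k \<zero>\<^bsub>T\<^esub> = k (\<zero> \<odot>\<^bsub>T\<^esub> \<zero>\<^bsub>T\<^esub>)" by simp_all
  then have 0: "h \<zero>\<^bsub>T\<^esub> = k \<zero>\<^bsub>T\<^esub>"
    using h k unfolding rlin_def by (metis N.smult_l_null R.zero_closed T.zero_closed)
  show ?thesis
  proof (rule T_induct[OF f, where P = "\<lambda>A. h A = k A"])
    fix A r w assume "A \<in> carrier T" "h A = k A" "r \<in> carrier R" "w \<in> words" "w \<in> W"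
    then show "h (A \<oplus>\<^bsub>T\<^esub> r \<odot>\<^bsub>T\<^esub> tword R V w) = k (A \<oplus>\<^bsub>T\<^esub> r \<odot>\<^bsub>T\<^esub> tword R V w)"
      using h k eq by (simp add: rlin_def)
  qed (rule 0)
qed

end

lemma rlin_closed: "rlin R V W f \<Longrightarrow> x \<in> carrier V \<Longrightarrow> f x \<in> carrier W"
  and rlin_add: "rlin R V W f \<Longrightarrow> x \<in> carrier V \<Longrightarrow> y \<in> carrier V \<Longrightarrow> f (x \<oplus>\<^bsub>V\<^esub> y) = f x \<oplus>\<^bsub>W\<^esub> f y"
  and rlin_smult: "rlin R V W f \<Longrightarrow> r \<in> carrier R \<Longrightarrow> x \<in> carrier V \<Longrightarrow> f (r \<odot>\<^bsub>V\<^esub> x) = r \<odot>\<^bsub>W\<^esub> f x"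
  by (simp_all add: rlin_def)

lemma rlin_zero:
  assumes "Module.module R V" "Module.module R W" "rlin R V W f" shows "f \<zero>\<^bsub>V\<^esub> = \<zero>\<^bsub>W\<^esub>"
proof -
  interpret V: Module.module R V by fact
  interpret W: Module.module R W by fact
  have "f \<zero>\<^bsub>V\<^esub> = f (\<zero>\<^bsub>R\<^esub> \<odot>\<^bsub>V\<^esub> \<zero>\<^bsub>V\<^esub>)" by simp
  also have "\<dots> = \<zero>\<^bsub>R\<^esub> \<odot>\<^bsub>W\<^esub> f \<zero>\<^bsub>V\<^esub>" using assms(3) by (intro rlin_smult) auto
  finally show ?thesis using rlin_closed[OF assms(3)] by simp
qed

lemma (in Module.module) a_inv_smult: "x \<in> carrier M \<Longrightarrow> \<ominus>\<^bsub>M\<^esub> x = (\<ominus> \<one>) \<odot>\<^bsub>M\<^esub> x"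
  by (simp add: smult_l_minus)

lemma rlin_a_inv:
  assumes "Module.module R V" "Module.module R W" "rlin R V W f" "x \<in> carrier V"
  shows "f (\<ominus>\<^bsub>V\<^esub> x) = \<ominus>\<^bsub>W\<^esub> f x"
proof -
  interpret V: Module.module R V by fact
  interpret W: Module.module R W by fact
  show ?thesis using assms by (simp add: V.a_inv_smult W.a_inv_smult rlin_closed rlin_smult)
qed

lemma rlin_comp: "rlin R V W f \<Longrightarrow> rlin R U V g \<Longrightarrow> rlin R U W (\<lambda>x. f (g x))"
  by (simp add: rlin_def)

lemma rlin_plus:
  assumes "Module.module R W" "rlin R V W f" "rlin R V W g"
  shows "rlin R V W (\<lambda>x. f x \<oplus>\<^bsub>W\<^esub> g x)"
proof -
  interpret W: Module.module R W by fact
  show ?thesis using assms(2,3) by (simp add: rlin_def W.a_ac W.smult_r_distr)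
qed

lemma rlin_neg:
  assumes "Module.module R W" "rlin R V W f"
  shows "rlin R V W (\<lambda>x. \<ominus>\<^bsub>W\<^esub> f x)"
proof -
  interpret W: Module.module R W by fact
  show ?thesis using assms(2) by (simp add: rlin_def W.minus_add W.a_comm W.smult_r_minus)
qed

lemma rlin_const_zero:
  assumes "Module.module R W"
  shows "rlin R V W (\<lambda>x. \<zero>\<^bsub>W\<^esub>)"
proof -
  interpret W: Module.module R W by fact
  show ?thesis by (simp add: rlin_def)
qed

lemma rlin_cong:
  assumes "Module.module R V" "rlin R V W f" "\<And>x. x \<in> carrier V \<Longrightarrow> g x = f x"
  shows "rlin R V W g"
proof -
  interpret V: Module.module R V by fact
  show ?thesis using assms(2,3) by (simp add: rlin_def)
qed

lemma rlin_finsum: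
  assumes V: "Module.module R V" and W: "Module.module R W" and f: "\<And>k. k \<in> K \<Longrightarrow> rlin R V W (f k)"
  shows "rlin R V W (\<lambda>x. \<Oplus>\<^bsub>W\<^esub> k \<in> K. f k x)"
proof -
  interpret W: Module.module R W by fact
  show ?thesis using f
  proof (induction K rule: infinite_finite_induct)
    case (insert k K)
    have "rlin R V W (\<lambda>x. f k x \<oplus>\<^bsub>W\<^esub> (\<Oplus>\<^bsub>W\<^esub> k \<in> K. f k x))"
      using insert by (intro rlin_plus W) auto
    moreover have "(\<Oplus>\<^bsub>W\<^esub> k \<in> insert k K. f k x) = f k x \<oplus>\<^bsub>W\<^esub> (\<Oplus>\<^bsub>W\<^esub> k \<in> K. f k x)" if "x \<in> carrier V" for x
      using insert.hyps that rlin_closed[OF insert.prems that] by (intro W.finsum_insert) auto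
    ultimately show ?case by (rule rlin_cong[OF V])
  qed (simp_all add: rlin_const_zero W)
qed

lemma rlin_ksgn:
  assumes "Module.module R W" "rlin R V W f"
  shows "rlin R V W (\<lambda>x. ksgn W k (f x))"
  using assms by (cases "even k") (simp_all add: ksgn_def rlin_neg)

lemma gmor_rlin: "f \<in> gmor R V W k \<Longrightarrow> rlin R V W f"
  by (simp add: gmor_def rlin_def)

lemma gmor_grade: "f \<in> gmor R V W k \<Longrightarrow> x \<in> grade V i \<Longrightarrow> f x \<in> grade W (i + k)"
  by (simp add: gmor_def)

lemma gmorI:
  "rlin R V W f \<Longrightarrow> (\<And>i x. x \<in> grade V i \<Longrightarrow> f x \<in> grade W (i + k)) \<Longrightarrow> f \<in> gmor R V W k"
  by (simp add: gmor_def rlin_def)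

text \<open>A common form for the word patterns in \<open>cup_bracket\<close> and
  \<open>comult_second\<close>: a function of two homogeneous letters, extended by \<open>z\<close>
  to words of all other lengths.\<close>

definition case2 :: "'b \<Rightarrow> (int \<Rightarrow> 'v \<Rightarrow> int \<Rightarrow> 'v \<Rightarrow> 'b) \<Rightarrow> (int \<times> 'v) list \<Rightarrow> 'b" where
  "case2 z B w = (case w of [(i, u), (j, v)] \<Rightarrow> B i u j v | _ \<Rightarrow> z)"

definition case3 :: "'b \<Rightarrow> (int \<Rightarrow> 'v \<Rightarrow> int \<Rightarrow> 'v \<Rightarrow> int \<Rightarrow> 'v \<Rightarrow> 'b) \<Rightarrow> (int \<times> 'v) list \<Rightarrow> 'b" where
  "case3 z B w = (case w of [(i, u), (j, v), (k, w)] \<Rightarrow> B i u j v k w | _ \<Rightarrow> z)"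

lemma case2_simps [simp]: "case2 z B [(i, u), (j, v)] = B i u j v" "length w \<noteq> 2 \<Longrightarrow> case2 z B w = z"
  by (auto simp: case2_def split: list.split)

lemma case3_simps [simp]: "case3 z B [(i, u), (j, v), (k, x)] = B i u j v k x" "length w \<noteq> 3
  \<Longrightarrow> case3 z B w = z"
  by (auto simp: case3_def split: list.split)

lemma length_1_cases: "length w = Suc 0 \<Longrightarrow> \<exists>i x. w = [(i, x)]"
  by (cases w) auto

lemma length_2_cases: "length w = 2 \<Longrightarrow> \<exists>i x j y. w = [(i, x), (j, y)]"
  by (cases w; cases "tl w") auto

lemma length_3_cases: "length w = 3 \<Longrightarrow> \<exists>i x j y k z. w = [(i, x), (j, y), (k, z)]"
  by (cases w; cases "tl w"; cases "tl (tl w)") auto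

section \<open>Multilinear functions on words\<close>

lemma multilinearI:
  assumes "\<And>w. w \<in> lists (letters V) \<Longrightarrow> \<phi> w \<in> carrier N"
    and "\<And>u v i. \<lbrakk>u \<in> lists (letters V); v \<in> lists (letters V)\<rbrakk> \<Longrightarrow>
      grade_linear R V N i (\<lambda>x. \<phi> (u @ (i, x) # v))"
  shows "multilinear R V N \<phi>"
  using assms by (simp add: multilinear_def)

lemma multilinearD:
  "\<lbrakk>multilinear R V N \<phi>; u \<in> lists (letters V); v \<in> lists (letters V)\<rbrakk> \<Longrightarrow>
    grade_linear R V N i (\<lambda>x. \<phi> (u @ (i, x) # v))"
  by (simp add: multilinear_def)

lemma grade_linear_add: "\<lbrakk>grade_linear R V N i h; x \<in> grade V i; y \<in> grade V i\<rbrakk> \<Longrightarrow> h (x \<oplus>\<^bsub>V\<^esub> y) = h x \<oplus>\<^bsub>N\<^esub> h y"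
  and grade_linear_smult: "\<lbrakk>grade_linear R V N i h; r \<in> carrier R; x \<in> grade V i\<rbrakk> \<Longrightarrow> h (r \<odot>\<^bsub>V\<^esub> x) = r \<odot>\<^bsub>N\<^esub> h x"
  by (simp_all add: grade_linear_def)

lemma grade_linear_rlin:
  assumes "rlin R N N' k" "grade_linear R V N i h" "\<And>x. x \<in> grade V i \<Longrightarrow> h x \<in> carrier N"
  shows "grade_linear R V N' i (\<lambda>x. k (h x))"
  using assms by (simp add: grade_linear_def rlin_def)

text \<open>The filter looks only at the degrees of the letters, which do not change when a single
  letter is varied within its grade.\<close>

lemma multilinear_filter:
  assumes "Module.module R N" "multilinear R V N \<phi>"
  shows "multilinear R V N (\<lambda>w. if P (map fst w) then \<phi> w else \<zero>\<^bsub>N\<^esub>)"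
proof -
  interpret N: Module.module R N by fact
  show ?thesis using assms(2) by (intro multilinearI) (auto simp: multilinear_def grade_linear_def)
qed

lemma multilinear_case2:
  fixes V :: "('r, 'v, 'y) gmod_scheme" and N :: "('r, 'n, 'z) gmod_scheme"
  assumes "Module.module R N"
    and c: "\<And>i u j v. u \<in> grade V i \<Longrightarrow> v \<in> grade V j \<Longrightarrow> B i u j v \<in> carrier N"
    and "\<And>i j v. v \<in> grade V j \<Longrightarrow> grade_linear R V N i (\<lambda>u. B i u j v)"
    and "\<And>i j u. u \<in> grade V i \<Longrightarrow> grade_linear R V N j (\<lambda>v. B i u j v)"
  shows "multilinear R V N (case2 \<zero>\<^bsub>N\<^esub> B)"
proof (rule multilinearI)
  interpret N: Module.module R N by fact
  fix w assume w: "w \<in> lists (letters V)"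
  show "case2 \<zero>\<^bsub>N\<^esub> B w \<in> carrier N"
    using w c by (cases "length w = 2") (auto dest!: length_2_cases simp: letters_def)
next
  interpret N: Module.module R N by fact
  fix u v :: "(int \<times> 'v) list" and i
  have "(u = [] \<and> (\<exists>j y. v = [(j, y)])) \<or> (v = [] \<and> (\<exists>j y. u = [(j, y)])) \<or> Suc (length u + length v) \<noteq> 2"
    by (cases u; cases v) (auto dest: length_1_cases)
  moreover assume "u \<in> lists (letters V)" "v \<in> lists (letters V)"
  ultimately show "grade_linear R V N i (\<lambda>x. case2 \<zero>\<^bsub>N\<^esub> B (u @ (i, x) # v))"
    using assms(3,4) by (auto simp: letters_def) (simp add: grade_linear_def)
qed

lemma multilinear_case3:
  fixes V :: "('r, 'v, 'y) gmod_scheme" and N :: "('r, 'n, 'z) gmod_scheme"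
  assumes "Module.module R N"
    and c: "\<And>i u j v k w. u \<in> grade V i \<Longrightarrow> v \<in> grade V j \<Longrightarrow> w \<in> grade V k \<Longrightarrow> B i u j v k w \<in> carrier N"
    and "\<And>i j v k w. v \<in> grade V j \<Longrightarrow> w \<in> grade V k \<Longrightarrow> grade_linear R V N i (\<lambda>u. B i u j v k w)"
    and "\<And>i u j k w. u \<in> grade V i \<Longrightarrow> w \<in> grade V k \<Longrightarrow> grade_linear R V N j (\<lambda>v. B i u j v k w)"
    and "\<And>i u j v k. u \<in> grade V i \<Longrightarrow> v \<in> grade V j \<Longrightarrow> grade_linear R V N k (\<lambda>w. B i u j v k w)"
  shows "multilinear R V N (case3 \<zero>\<^bsub>N\<^esub> B)"
proof (rule multilinearI)
  interpret N: Module.module R N by fact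
  fix w assume w: "w \<in> lists (letters V)"
  show "case3 \<zero>\<^bsub>N\<^esub> B w \<in> carrier N"
    using w c by (cases "length w = 3") (auto dest!: length_3_cases simp: letters_def)
next
  interpret N: Module.module R N by fact
  fix u v :: "(int \<times> 'v) list" and i
  have "(u = [] \<and> (\<exists>j y k z. v = [(j, y), (k, z)])) \<or> (v = [] \<and> (\<exists>j y k z. u = [(j, y), (k, z)]))
     \<or> (\<exists>j y k z. u = [(j, y)] \<and> v = [(k, z)]) \<or> Suc (length u + length v) \<noteq> 3"
    by (cases u; cases v; cases "tl u"; cases "tl v") auto
  moreover assume "u \<in> lists (letters V)" "v \<in> lists (letters V)"
  ultimately show "grade_linear R V N i (\<lambda>x. case3 \<zero>\<^bsub>N\<^esub> B (u @ (i, x) # v))"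
    using assms(3-5) by (auto simp: letters_def) (simp add: grade_linear_def)
qed

context graded_letters
begin

lemma letterI: "x \<in> grade V i \<Longrightarrow> (i, x) \<in> letters V" by (simp add: letters_def)

text \<open>The relations are imposed on words of one letter; the product of the tensor algebra,
  which is linear in each factor, carries them into the middle of a longer word.\<close>

lemma multilinear_tword: "multilinear R V T (tword R V)"
proof -
  interpret F: ring F by (rule F_ring)
  have I: "tens_rels R V \<subseteq> I" unfolding tens_ideal_def by (rule F.genideal_self[OF rels_closed])
  have m: "monom_word R r [(i, x)] \<in> carrier F" if "r \<in> carrier R" "x \<in> grade V i" for r i x
    using that by (intro F_carrier_monom) (auto simp: letters_def)
  have eq: "tclass R V f = tclass R V g" if "f \<ominus>\<^bsub>F\<^esub> g \<in> I" "f \<in> carrier F" "g \<in> carrier F" for f g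
    using that ring.quotient_eq_iff_same_a_r_cos[OF F_ring I_ideal, of f g] by (simp add: tclass_def)
  have split: "tword R V (u @ (i, x) # v) = tword R V u \<otimes>\<^bsub>T\<^esub> (tword R V [(i, x)] \<otimes>\<^bsub>T\<^esub> tword R V v)"
    if "u \<in> words" "v \<in> words" "x \<in> grade V i" for u v i x
    using that tword_append[of u "[(i, x)] @ v"] tword_append[of "[(i, x)]" v] by (simp add: letterI)
  have "tword R V [(i, x \<oplus>\<^bsub>V\<^esub> y)] = tword R V [(i, x)] \<oplus>\<^bsub>T\<^esub> tword R V [(i, y)]"
    if *: "x \<in> grade V i" "y \<in> grade V i" for i x y
  proof -
    have "tword R V [(i, x \<oplus>\<^bsub>V\<^esub> y)] = tclass R V (monom_word R \<one> [(i, x)] \<oplus>\<^bsub>F\<^esub> monom_word R \<one> [(i, y)])"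
      unfolding tword_def using *
      by (intro eq subsetD[OF I] m grade_add_closed F.add.m_closed[simplified])
         (auto simp: tens_rels_def intro: m)
    then show ?thesis using * by (simp add: tword_def tclass_add m F_simps)
  qed
  moreover have "tword R V [(i, r \<odot>\<^bsub>V\<^esub> x)] = r \<odot>\<^bsub>T\<^esub> tword R V [(i, x)]"
    if *: "r \<in> carrier R" "x \<in> grade V i" for i x r
  proof -
    have "tword R V [(i, r \<odot>\<^bsub>V\<^esub> x)] = tclass R V (monom_word R r [(i, x)])"
      unfolding tword_def using *
      by (intro eq subsetD[OF I] m grade_smult_closed) (auto simp: tens_rels_def)
    then show ?thesis using * by (simp add: tclass_monom letterI)
  qed
  ultimately show ?thesis
    by (intro multilinearI) (simp_all add: grade_linear_def split grade_add_closed grade_smult_closed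
      T.l_distr T.r_distr T_smult_assoc2 T_smult_right letterI)
qed

text \<open>The list of letter degrees determines both the total degree and the length, so one
  family of projections yields the components of either kind.\<close>

definition deg_proj :: "(int list \<Rightarrow> bool) \<Rightarrow> ('r, 'v) tensor \<Rightarrow> ('r, 'v) tensor" where
  "deg_proj P = tlift R T (\<lambda>w. if P (map fst w) then tword R V w else \<zero>\<^bsub>T\<^esub>)"

lemma deg_proj_rlin: "rlin R T T (deg_proj P)"
  unfolding deg_proj_def by (intro tlift_rlin T_module multilinear_filter multilinear_tword)

lemma deg_proj_tword: "w \<in> words \<Longrightarrow> deg_proj P (tword R V w) = (if P (map fst w) then tword R V w else \<zero>\<^bsub>T\<^esub>)"
  unfolding deg_proj_def by (subst
    tlift_tword) (auto intro!: T_module multilinear_filter multilinear_tword)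

lemma rlin_id: "rlin R X X (\<lambda>x. x)" by (simp add: rlin_def)

lemma deg_proj_id:
  assumes "f \<in> carrier F" "\<And>w. f w \<noteq> \<zero> \<Longrightarrow> P (map fst w)"
  shows "deg_proj P (tclass R V f) = tclass R V f"
  using assms by (intro rlin_eq_on_words[where W = "{w. f w \<noteq> \<zero>}", OF T_module deg_proj_rlin rlin_id])
    (auto simp: deg_proj_tword)

lemma deg_proj_zero:
  assumes "f \<in> carrier F" "\<And>w. f w \<noteq> \<zero> \<Longrightarrow> \<not> P (map fst w)"
  shows "deg_proj P (tclass R V f) = \<zero>\<^bsub>T\<^esub>"
  using assms by (intro rlin_eq_on_words[where W = "{w. f w \<noteq> \<zero>}", OF T_module deg_proj_rlin
    rlin_const_zero[OF T_module]])
    (auto simp: deg_proj_tword)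

text \<open>The representative is split into the coefficients at words satisfying \<open>P\<close>
  and the rest; the projection fixes the first part and kills the second.\<close>

lemma deg_proj_restrict:
  assumes f: "f \<in> carrier F"
  shows "(\<lambda>w. if P (map fst w) then f w else \<zero>) \<in> carrier F"
    "deg_proj P (tclass R V f) = tclass R V (\<lambda>w. if P (map fst w) then f w else \<zero>)"
proof -
  let ?g = "\<lambda>w. if P (map fst w) then f w else \<zero>" and ?h = "\<lambda>w. if P (map fst w) then \<zero> else f w"
  have "{w. ?g w \<noteq> \<zero>} \<subseteq> {w. f w \<noteq> \<zero>}" "{w. ?h w \<noteq> \<zero>} \<subseteq> {w. f w \<noteq> \<zero>}" by auto
  then have c: "?g \<in> carrier F" "?h \<in> carrier F"
    using f unfolding F_carrier by (auto intro: finite_subset)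
  have "tclass R V f = tclass R V ?g \<oplus>\<^bsub>T\<^esub> tclass R V ?h"
    using c F_val[OF f] by (simp add: tclass_add) (rule arg_cong[of _ _ "tclass R V"], auto)
  then have "deg_proj P (tclass R V f) = deg_proj P (tclass R V ?g) \<oplus>\<^bsub>T\<^esub> deg_proj P (tclass R V ?h)"
    using c by (simp add: rlin_add[OF deg_proj_rlin] T_carrierI)
  also have "deg_proj P (tclass R V ?g) = tclass R V ?g"
    by (rule deg_proj_id[OF c(1)]) (simp split: if_splits)
  also have "deg_proj P (tclass R V ?h) = \<zero>\<^bsub>T\<^esub>"
    by (rule deg_proj_zero[OF c(2)]) (simp split: if_splits)
  finally show "deg_proj P (tclass R V f) = tclass R V ?g" using c by (simp add: T_carrierI)
  show "?g \<in> carrier F" by (rule c)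
qed

end

section \<open>Graded modules\<close>

lemma graded_module_module: "graded_module R V \<Longrightarrow> Module.module R V"
  and graded_module_submodule: "graded_module R V \<Longrightarrow> submodule (grade V i) R V"
  by (simp_all add: graded_module_def)

lemma grade_carrier: "graded_module R V \<Longrightarrow> x \<in> grade V i \<Longrightarrow> x \<in> carrier V"
  by (rule subsetD[OF Module.module.submoduleE(1)[OF graded_module_module graded_module_submodule]])

lemma grade_add: "graded_module R V \<Longrightarrow> x \<in> grade V i \<Longrightarrow> y \<in> grade V i \<Longrightarrow> x \<oplus>\<^bsub>V\<^esub> y \<in> grade V i"
  by (rule Module.module.submoduleE(5)[OF graded_module_module graded_module_submodule])

lemma grade_smult: "graded_module R V \<Longrightarrow> r \<in> carrier R \<Longrightarrow> x \<in> grade V i \<Longrightarrow> r \<odot>\<^bsub>V\<^esub> x \<in> grade V i"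
  by (rule Module.module.submoduleE(4)[OF graded_module_module graded_module_submodule])

lemma grade_neg: "graded_module R V \<Longrightarrow> x \<in> grade V i \<Longrightarrow> \<ominus>\<^bsub>V\<^esub> x \<in> grade V i"
  by (rule Module.module.submoduleE(3)[OF graded_module_module graded_module_submodule])

lemma grade_zero: "graded_module R V \<Longrightarrow> \<zero>\<^bsub>V\<^esub> \<in> grade V i"
  using subgroup.one_closed[OF submodule.axioms(1)[OF graded_module_submodule]] by fastforce

lemma graded_letters_graded_module: "graded_module R V \<Longrightarrow> graded_letters R V"
  using graded_module_module[of R V]
  by (intro graded_letters.intro graded_letters_axioms.intro)
     (auto simp: Module.module_def grade_add grade_smult)

lemma gcomp_unique:
  assumes "graded_module R V" "decomposes V c x" "x \<in> carrier V"
  shows "gcomp V i x = c i"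
proof -
  have "\<exists>!c. decomposes V c x" using assms by (simp add: graded_module_def)
  then have "(THE c. decomposes V c x) = c"
    using assms(2) by (rule the1_equality[of "\<lambda>c. decomposes V c x"])
  then show ?thesis by (simp add: gcomp_def)
qed

lemma decomposes_gcomp:
  assumes "graded_module R V" "x \<in> carrier V"
  shows "decomposes V (\<lambda>i. gcomp V i x) x"
proof -
  have "\<exists>!c. decomposes V c x" using assms by (simp add: graded_module_def)
  then have "decomposes V (THE c. decomposes V c x) x" by (rule theI')
  then show ?thesis by (simp add: gcomp_def)
qed

lemma grade_ksgn: "graded_module R V \<Longrightarrow> x \<in> grade V i \<Longrightarrow> ksgn V k x \<in> grade V i"
  by (simp add: ksgn_def grade_neg)

lemma grade_finsum:
  assumes "graded_module R V" "\<And>k. k \<in> K \<Longrightarrow> f k \<in> grade V i"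
  shows "(\<Oplus>\<^bsub>V\<^esub> k \<in> K. f k) \<in> grade V i"
proof -
  interpret V: Module.module R V by (rule graded_module_module[OF assms(1)])
  show ?thesis using assms(2)
  proof (induction K rule: infinite_finite_induct)
    case (insert k K)
    then have "f k \<in> carrier V" "\<And>k. k \<in> K \<Longrightarrow> f k \<in> carrier V"
      by (auto intro: grade_carrier[OF assms(1)])
    then show ?case using insert by (simp add: Pi_iff grade_add[OF assms(1)])
  qed (simp_all add: grade_zero[OF assms(1)])
qed

lemma graded_induct [consumes 2, case_names zero add homogeneous]:
  assumes V: "graded_module R V" and x: "x \<in> carrier V"
    and 0: "P \<zero>\<^bsub>V\<^esub>" and add: "\<And>x y. \<lbrakk>x \<in> carrier V; y \<in> carrier V; P x; P y\<rbrakk> \<Longrightarrow> P (x \<oplus>\<^bsub>V\<^esub> y)"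
    and hom: "\<And>i x. x \<in> grade V i \<Longrightarrow> P x"
  shows "P x"
proof -
  interpret V: Module.module R V by (rule graded_module_module[OF V])
  have "P (\<Oplus>\<^bsub>V\<^esub> i \<in> K. c i)" if "\<And>i. c i \<in> grade V i" for K and c :: "int \<Rightarrow> _"
    using that
  proof (induction K rule: infinite_finite_induct)
    case (insert k K)
    then have "c i \<in> carrier V" for i by (auto intro: grade_carrier[OF V])
    then show ?case using insert by (simp add: Pi_iff add hom[of _ k])
  qed (simp_all add: 0)
  moreover have "decomposes V (\<lambda>i. gcomp V i x) x" using V x by (rule decomposes_gcomp)
  ultimately show ?thesis unfolding decomposes_def by metis
qed

lemma rlin_eq_on_grades:
  assumes V: "graded_module R V" and W: "Module.module R W" and f: "rlin R V W f" and g: "rlin R V W g"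
    and eq: "\<And>i x. x \<in> grade V i \<Longrightarrow> f x = g x" and x: "x \<in> carrier V"
  shows "f x = g x"
  using V x
proof (induction x rule: graded_induct)
  case zero
  then show ?case by (simp add: rlin_zero[OF graded_module_module[OF V] W f]
    rlin_zero[OF graded_module_module[OF V] W g])
qed (auto simp: rlin_add[OF f] rlin_add[OF g] eq)

section \<open>The grading of the tensor algebra\<close>

context graded_letters
begin

lemma grade_T: "grade T k = {tclass R V f | f. f \<in> carrier F \<and> (\<forall>w. f w \<noteq> \<zero> \<longrightarrow> wdeg w = k)}"
  by (simp add: tens_def Let_def)

text \<open>The predicate \<open>Q\<close> is left arbitrary because two instances are needed: a
  fixed degree for the grading, and degrees of one sign for the loop Lie algebra.\<close>

lemma word_support_submodule:
  "submodule {tclass R V f | f. f \<in> carrier F \<and> (\<forall>w. f w \<noteq> \<zero> \<longrightarrow> Q w)} R T" (is "submodule ?S R T")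
proof (rule TM.submoduleI)
  show "?S \<subseteq> carrier T" by (auto simp: T_simps)
  have "(\<lambda>w. \<zero>) \<in> carrier F" using ring.ring_simprules(2)[OF F_ring] by (simp add: F_simps)
  then show "\<zero>\<^bsub>T\<^esub> \<in> ?S" using tclass_zero by force
  have I: "a \<in> ?S" if "f \<in> carrier F" "\<And>w. f w \<noteq> \<zero> \<Longrightarrow> Q w" "a = tclass R V f" for a f
    using that by blast
  show sm: "r \<odot>\<^bsub>T\<^esub> a \<in> ?S" if r: "r \<in> carrier R" and a: "a \<in> ?S" for r a
  proof -
    from a obtain f where f: "f \<in> carrier F" "\<forall>w. f w \<noteq> \<zero> \<longrightarrow> Q w" "a = tclass R V f" by blast
    have "Q w" if "r \<otimes> f w \<noteq> \<zero>" for w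
    proof -
      have "f w \<noteq> \<zero>" using that r by auto
      then show ?thesis using f(2) by simp
    qed
    then show ?thesis using f r by (intro I[OF F_smult_closed[OF r f(1)]]) (simp_all add: tclass_smult)
  qed
  show "\<ominus>\<^bsub>T\<^esub> a \<in> ?S" if "a \<in> ?S" for a
  proof -
    have "a \<in> carrier T" using that by (auto simp: T_simps)
    then show ?thesis using sm[of "\<ominus> \<one>" a] that by (simp add: TM.a_inv_smult)
  qed
  show "a \<oplus>\<^bsub>T\<^esub> b \<in> ?S" if ab: "a \<in> ?S" "b \<in> ?S" for a b
  proof -
    obtain f where f: "f \<in> carrier F" "\<forall>w. f w \<noteq> \<zero> \<longrightarrow> Q w" "a = tclass R V f" using ab(1) by blast
    obtain g where g: "g \<in> carrier F" "\<forall>w. g w \<noteq> \<zero> \<longrightarrow> Q w" "b = tclass R V g" using ab(2) by blast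
    have "Q w" if "f w \<oplus> g w \<noteq> \<zero>" for w
    proof -
      have "f w \<noteq> \<zero> \<or> g w \<noteq> \<zero>" using that by auto
      then show ?thesis using f(2) g(2) by auto
    qed
    then show ?thesis using f g by (intro I[OF F_add_closed[OF f(1) g(1)]]) (simp_all add: tclass_add)
  qed
qed

abbreviation "deg_part k \<equiv> deg_proj (\<lambda>ds. sum_list ds = k)"

lemma grade_TI: "f \<in> carrier F \<Longrightarrow> (\<And>w. f w \<noteq> \<zero> \<Longrightarrow> wdeg w = k) \<Longrightarrow> tclass R V f \<in> grade T k"
  unfolding grade_T by blast

lemma grade_TE:
  assumes "A \<in> grade T k"
  obtains f where "f \<in> carrier F" "\<And>w. f w \<noteq> \<zero> \<Longrightarrow> wdeg w = k" "A = tclass R V f"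
  using assms unfolding grade_T by blast

lemma deg_part_grade:
  assumes "A \<in> carrier T" shows "deg_part k A \<in> grade T k"
proof -
  obtain f where f: "f \<in> carrier F" "A = tclass R V f" using assms by (rule T_carrierE)
  show ?thesis unfolding f(2) deg_proj_restrict(2)[OF f(1)]
    using deg_proj_restrict(1)[OF f(1)] by (intro grade_TI) (simp_all add: wdeg_def split: if_splits)
qed

lemma deg_part_id: "A \<in> grade T k \<Longrightarrow> deg_part k A = A"
  by (elim grade_TE) (simp add: deg_proj_id flip: wdeg_def)

lemma deg_part_other: "A \<in> grade T j \<Longrightarrow> j \<noteq> k \<Longrightarrow> deg_part k A = \<zero>\<^bsub>T\<^esub>"
  by (elim grade_TE) (simp add: deg_proj_zero flip: wdeg_def)

lemma grade_T_carrier: "A \<in> grade T j \<Longrightarrow> A \<in> carrier T"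
  unfolding grade_T by (auto simp: T_simps)

text \<open>All nonzero components have the degree of some word of a fixed representative. Summed
  over this finite set of degrees, the projections form a linear map which leaves every such word
  unchanged, since exactly one of them keeps it.\<close>

lemma decomposes_deg_part:
  assumes A: "A \<in> carrier T" shows "decomposes T (\<lambda>k. deg_part k A) A"
proof -
  obtain f where f: "f \<in> carrier F" "A = tclass R V f" using A by (rule T_carrierE)
  let ?W = "{w. f w \<noteq> \<zero>}" and ?K = "{k. deg_part k A \<noteq> \<zero>\<^bsub>T\<^esub>}"
  have W: "finite ?W" "?W \<subseteq> words" using f(1) by (simp_all add: F_carrier)
  have sub: "?K \<subseteq> wdeg ` ?W"
  proof
    fix k assume "k \<in> ?K"
    then have "deg_part k A \<noteq> \<zero>\<^bsub>T\<^esub>" by simp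
    then obtain w where "f w \<noteq> \<zero>" "sum_list (map fst w) = k"
      using deg_proj_zero[OF f(1), of "\<lambda>ds. sum_list ds = k"] unfolding f(2) by metis
    then show "k \<in> wdeg ` ?W" by (auto simp: wdeg_def)
  qed
  have c: "deg_part k A \<in> carrier T" for k using A deg_part_grade grade_T_carrier by blast
  have "(\<Oplus>\<^bsub>T\<^esub> k \<in> ?K. deg_part k A) = (\<Oplus>\<^bsub>T\<^esub> k \<in> wdeg ` ?W. deg_part k A)"
  proof (rule T.finsum_mono_neutral_left)
    show "deg_part i A = \<zero>\<^bsub>T\<^esub>" if "i \<in> wdeg ` ?W - ?K" for i using that by blast
  qed (use W sub c in simp_all)
  also have "\<dots> = A"
    unfolding f(2)
  proof (rule rlin_eq_on_words[where W = ?W, OF T_module _ rlin_id f(1)])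
    show "rlin R T T (\<lambda>A. \<Oplus>\<^bsub>T\<^esub> k \<in> wdeg ` ?W. deg_part k A)"
      by (intro rlin_finsum T_module deg_proj_rlin)
    fix w assume w: "w \<in> words" "w \<in> ?W"
    have "(\<Oplus>\<^bsub>T\<^esub> k \<in> wdeg ` ?W. deg_part k (tword R V w)) = (\<Oplus>\<^bsub>T\<^esub> k \<in> wdeg ` ?W. if wdeg w
      = k then tword R V w else \<zero>\<^bsub>T\<^esub>)"
      using w by (intro T.finsum_cong') (simp_all add: deg_proj_tword wdeg_def)
    also have "\<dots> = tword R V w"
      using w W T.add.finprod_singleton[of "wdeg w" "wdeg ` ?W" "\<lambda>k. tword R V w"] by simp
    finally show "(\<Oplus>\<^bsub>T\<^esub> k \<in> wdeg ` ?W. deg_part k (tword R V w)) = tword R V w" .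
  qed simp
  finally show ?thesis
    unfolding decomposes_def using A deg_part_grade finite_subset[OF sub finite_imageI[OF W(1)]] by simp
qed

text \<open>Applying the projection to degree \<open>k\<close> to the given decomposition leaves
  only the summand \<open>c k\<close>.\<close>

lemma decomposes_T_unique:
  assumes "decomposes T c A" shows "c k = deg_part k A"
proof -
  let ?K = "{i. c i \<noteq> \<zero>\<^bsub>T\<^esub>}"
  have c: "c i \<in> grade T i" "c i \<in> carrier T" for i
    using assms by (auto simp: decomposes_def intro: grade_T_carrier)
  have fin: "finite ?K" and A: "A = (\<Oplus>\<^bsub>T\<^esub> i \<in> ?K. c i)" using assms by (auto simp: decomposes_def)
  have "deg_part k (\<Oplus>\<^bsub>T\<^esub> i \<in> K. c i) = (\<Oplus>\<^bsub>T\<^esub> i \<in> K. deg_part k (c i))" if "finite K" for K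
    using that
  proof induction
    case empty
    then show ?case by (simp add: rlin_zero[OF T_module T_module deg_proj_rlin])
  next
    case (insert i K)
    then show ?case using c by (simp add: Pi_iff rlin_add[OF deg_proj_rlin] rlin_closed[OF deg_proj_rlin])
  qed
  then have "deg_part k A = (\<Oplus>\<^bsub>T\<^esub> i \<in> ?K. deg_part k (c i))" using fin A by simp
  also have "\<dots> = (\<Oplus>\<^bsub>T\<^esub> i \<in> ?K. if k = i then c i else \<zero>\<^bsub>T\<^esub>)"
  proof (intro T.finsum_cong' refl)
    show "deg_part k (c i) = (if k = i then c i else \<zero>\<^bsub>T\<^esub>)" for i
      using c(1)[of i] by (cases "k = i") (simp_all add: deg_part_id deg_part_other)
  qed (use c in auto)
  also have "\<dots> = c k"
  proof (cases "k \<in> ?K")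
    case True
    then show ?thesis using fin c T.add.finprod_singleton[of k ?K c] by simp
  next
    case False
    then have "(\<Oplus>\<^bsub>T\<^esub> i \<in> ?K. if k = i then c i else \<zero>\<^bsub>T\<^esub>) = \<zero>\<^bsub>T\<^esub>"
      by (intro T.add.finprod_one_eqI) auto
    then show ?thesis using False by simp
  qed
  finally show ?thesis by simp
qed

lemma T_graded: "graded_module R T"
  unfolding graded_module_def
proof (intro conjI allI ballI T_module)
  show "submodule (grade T i) R T" for i unfolding grade_T by (rule word_support_submodule)
  fix A assume "A \<in> carrier T"
  then show "\<exists>!c. decomposes T c A"
    using decomposes_deg_part decomposes_T_unique by (intro ex1I[of _ "\<lambda>k. deg_part k A"]) auto
qed

lemma gcomp_T: "A \<in> carrier T \<Longrightarrow> gcomp T k A = deg_part k A"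
  by (intro gcomp_unique[OF T_graded] decomposes_deg_part)

lemma tlength_closed: "A \<in> tlength R V n \<Longrightarrow> A \<in> carrier T"
  unfolding tlength_def by (auto simp: T_simps)

text \<open>Degree and length are witnessed by possibly different representatives. Cutting the one
  of pure degree down to words of length \<open>n\<close> does not change the tensor, because the
  other representative shows that the length projection fixes it.\<close>

lemma tpow_grade_rep:
  assumes "A \<in> grade (tpow R V n) k"
  obtains f where "f \<in> carrier F" "A = tclass R V f" "{w. f w \<noteq> \<zero>} \<subseteq> {w. wdeg w = k \<and> length w = n}"
proof -
  have A: "A \<in> grade T k" "A \<in> tlength R V n" using assms by (auto simp: tpow_def)
  obtain f where f: "f \<in> carrier F" "A = tclass R V f" "\<And>w. f w \<noteq> \<zero> \<Longrightarrow> wdeg w = k"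
    using A(1) unfolding grade_T by blast
  obtain g where g: "g \<in> carrier F" "A = tclass R V g" "\<And>w. g w \<noteq> \<zero> \<Longrightarrow> length w = n"
    using A(2) unfolding tlength_def by blast
  have "A = deg_proj (\<lambda>ds. length ds = n) A" using g by (simp add: deg_proj_id)
  also have "\<dots> = tclass R V (\<lambda>w. if length (map fst w) = n then f w else \<zero>)"
    unfolding f(2) by (rule deg_proj_restrict(2)[OF f(1)])
  finally show ?thesis using f(3) deg_proj_restrict(1)[OF f(1), of "\<lambda>ds. length ds = n"]
    by (intro that) (auto split: if_splits)
qed

lemma tpow_grade_induct [consumes 1, case_names zero add]:
  assumes A: "A \<in> grade (tpow R V n) k" and "P \<zero>\<^bsub>T\<^esub>"
    and "\<And>A r w. \<lbrakk>A \<in> carrier T; P A; r \<in> carrier R; w \<in> words; wdeg w = k; length w = n\<rbrakk> \<Longrightarrow> P (A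
      \<oplus>\<^bsub>T\<^esub> r \<odot>\<^bsub>T\<^esub> tword R V w)"
  shows "P A"
proof -
  obtain f where f: "f \<in> carrier F" "A = tclass R V f" "{w. f w \<noteq> \<zero>} \<subseteq> {w. wdeg w = k \<and> length w = n}"
    using A by (rule tpow_grade_rep)
  show ?thesis unfolding f(2) by (rule T_induct[where P = P, OF f(1,3)]) (use assms(2,3) in simp_all)
qed

lemma rlin_eq_on_tpow_grade:
  assumes N: "Module.module R N" and h: "rlin R T N h" and k: "rlin R T N k"
    and A: "A \<in> grade (tpow R V n) d"
    and eq: "\<And>w. w \<in> words \<Longrightarrow> wdeg w = d \<Longrightarrow> length w = n \<Longrightarrow> h (tword R V w) = k (tword R V w)"
  shows "h A = k A"
proof -
  obtain f where f: "f \<in> carrier F" "A = tclass R V f" "{w. f w \<noteq> \<zero>} \<subseteq> {w. wdeg w = d \<and> length w = n}"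
    using A by (rule tpow_grade_rep)
  show ?thesis unfolding f(2) by (rule rlin_eq_on_words[OF N h k f(1,3)]) (use eq in simp)
qed

end

section \<open>Derivations and interchanges\<close>

locale gmodule = Module.module R V
  for R :: "'r ring" (structure) and V :: "('r, 'v, 'z) gmod_scheme"
begin

lemma ksgn_closed [simp]: "x \<in> carrier V \<Longrightarrow> ksgn V k x \<in> carrier V"
  by (simp add: ksgn_def)

lemma ksgn_zero [simp]: "ksgn V k \<zero>\<^bsub>V\<^esub> = \<zero>\<^bsub>V\<^esub>"
  by (simp add: ksgn_def)

lemma ksgn_add: "x \<in> carrier V \<Longrightarrow> y \<in> carrier V \<Longrightarrow> ksgn V k (x \<oplus>\<^bsub>V\<^esub> y) = ksgn V k x \<oplus>\<^bsub>V\<^esub> ksgn V k y"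
  by (simp add: ksgn_def minus_add a_comm)

lemma ksgn_smult: "r \<in> carrier R \<Longrightarrow> x \<in> carrier V \<Longrightarrow> ksgn V k (r \<odot>\<^bsub>V\<^esub> x) = r \<odot>\<^bsub>V\<^esub> ksgn V k x"
  by (simp add: ksgn_def smult_r_minus)

end

sublocale graded_letters \<subseteq> TG: gmodule R "tens R V"
  by (rule gmodule.intro[OF T_module])

lemma tmult_rlin:
  assumes "graded_letters R V" "A \<in> carrier (tens R V)"
  shows "rlin R (tens R V) (tens R V) (\<lambda>X. A \<otimes>\<^bsub>tens R V\<^esub> X)"
    "rlin R (tens R V) (tens R V) (\<lambda>X. X \<otimes>\<^bsub>tens R V\<^esub> A)"
proof -
  interpret graded_letters R V by fact
  show "rlin R T T (\<lambda>X. A \<otimes>\<^bsub>T\<^esub> X)" "rlin R T T (\<lambda>X. X \<otimes>\<^bsub>T\<^esub> A)"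
    using assms(2) by (simp_all add: rlin_def T.r_distr T.l_distr T_smult_right T_smult_assoc2)
qed

locale graded_mod =
  fixes R :: "'r ring" (structure) and V :: "('r, 'v, 'z) gmod_scheme"
  assumes graded: "graded_module R V"

sublocale graded_mod \<subseteq> graded_letters R V
  by (rule graded_letters_graded_module[OF graded])

sublocale graded_mod \<subseteq> VM: gmodule R V
  by (rule gmodule.intro[OF graded_module_module[OF graded]])

context graded_mod
begin

lemma words_update: "w \<in> words \<Longrightarrow> a \<in> letters V \<Longrightarrow> w[i := a] \<in> words"
  using set_update_subset_insert[of w i a] by (auto simp: in_lists_conv_set)

lemma words_nth: "w \<in> words \<Longrightarrow> i < length w \<Longrightarrow> w ! i \<in> letters V"
  by (simp add: in_lists_conv_set)

definition dterm :: "int \<Rightarrow> ('v \<Rightarrow> 'v) \<Rightarrow> (int \<times> 'v) list \<Rightarrow> nat \<Rightarrow> ('r, 'v) tensor" where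
  "dterm k f w i = ksgn T (k * wdeg (take i w)) (tword R V (w[i := (fst (w ! i) + k, f (snd (w ! i)))]))"

lemma dterm_closed:
  assumes "f \<in> gmor R V V k" "w \<in> words" "i < length w" shows "dterm k f w i \<in> carrier T"
proof -
  have "w ! i \<in> letters V" using assms by (simp add: words_nth)
  then have "(fst (w ! i) + k, f (snd (w ! i))) \<in> letters V"
    using gmor_grade[OF assms(1)] by (auto simp: letters_def)
  then show ?thesis using assms by (simp add: dterm_def words_update)
qed

text \<open>The position \<open>i\<close> where \<open>f\<close> is applied lies before, at or after
  the marked letter. In every case the term is a signed pure tensor in which the marked letter is
  either unchanged or replaced by its image under \<open>f\<close>, hence linear in that
  letter.\<close>

lemma dterm_form:
  assumes f: "f \<in> gmor R V V k" and w: "u \<in> words" "v \<in> words" and i: "i < Suc (length u + length v)"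
  obtains u' v' e g c where "u' \<in> words" "v' \<in> words" "(g = (\<lambda>x. x) \<and> e = d) \<or> (g = f \<and> e = d + k)"
    "\<And>x. x \<in> grade V d \<Longrightarrow> dterm k f (u @ (d, x) # v) i = ksgn T c (tword R V (u' @ (e, g x) # v'))"
proof -
  have l: "(fst a + k, f (snd a)) \<in> letters V" if "a \<in> letters V" for a
    using that gmor_grade[OF f] by (auto simp: letters_def)
  have "i = Suc (length u + (i - Suc (length u)))" "i - Suc (length u) < length v" if "length u < i"
    using that i by simp_all
  then consider "i < length u" | "i = length u" | j where "i = Suc (length u + j)" "j < length v"
    using linorder_less_linear by blast
  then show thesis
  proof cases
    case 1
    then show thesis using w l[OF words_nth[OF w(1) 1]]
      by (intro that[of "u[i := (fst (u ! i) + k, f (snd (u ! i)))]" v "\<lambda>x. x" d "k * wdeg (take i u)"])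
        (simp_all add: dterm_def nth_append list_update_append words_update)
  next
    case 2
    then show thesis using w
      by (intro that[of u v f "d + k" "k * wdeg (take i u)"])
        (simp_all add: dterm_def nth_append list_update_append)
  next
    case 3
    then show thesis using w l[OF words_nth[OF w(2) 3(2)]]
      by (intro that[of u "v[j := (fst (v ! j) + k, f (snd (v ! j)))]" "\<lambda>x. x" d
        "k * (wdeg u + d + wdeg (take j v))"])
        (simp_all add: dterm_def nth_append list_update_append words_update wdeg_def add.assoc)
  qed
qed

lemma dterm_linear:
  assumes f: "f \<in> gmor R V V k" and w: "u \<in> words" "v \<in> words" and i: "i < Suc (length u + length v)"
  shows "grade_linear R V T d (\<lambda>x. dterm k f (u @ (d, x) # v) i)"
proof -
  obtain u' v' e g c where *: "u' \<in> words" "v' \<in> words" "(g = (\<lambda>x. x) \<and> e = d) \<or> (g = f \<and> e = d + k)"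
    "\<And>x. x \<in> grade V d \<Longrightarrow> dterm k f (u @ (d, x) # v) i = ksgn T c (tword R V (u' @ (e, g x) # v'))"
    by (rule dterm_form[OF f w i, of d]) blast
  have g: "g x \<in> grade V e" if "x \<in> grade V d" for x
    using *(3) that gmor_grade[OF f that] by (elim disjE conjE) simp_all
  have "g (x \<oplus>\<^bsub>V\<^esub> y) = g x \<oplus>\<^bsub>V\<^esub> g y" "r \<in> carrier R \<Longrightarrow> g (r \<odot>\<^bsub>V\<^esub> x) = r \<odot>\<^bsub>V\<^esub> g x"
    if "x \<in> grade V d" "y \<in> grade V d" for x y r
    using *(3) that rlin_add[OF gmor_rlin[OF f]] rlin_smult[OF gmor_rlin[OF f]] grade_carrier[OF graded]
    by (elim disjE conjE; simp)+
  then show ?thesis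
    using * g by (simp add: grade_linear_def grade_add_closed
      grade_smult_closed letterI TG.ksgn_add TG.ksgn_smult
        grade_linear_add[OF multilinearD[OF multilinear_tword]]
          grade_linear_smult[OF multilinearD[OF multilinear_tword]])
qed

lemma tder_eq: "tder R V k f = tlift R T (\<lambda>w. \<Oplus>\<^bsub>T\<^esub> i \<in> {..<length w}. dterm k f w i)"
  by (simp add: tder_def dterm_def)

lemma multilinear_tder:
  assumes f: "f \<in> gmor R V V k"
  shows "multilinear R V T (\<lambda>w. \<Oplus>\<^bsub>T\<^esub> i \<in> {..<length w}. dterm k f w i)"
proof (rule multilinearI)
  fix w assume "w \<in> words"
  then show "(\<Oplus>\<^bsub>T\<^esub> i \<in> {..<length w}. dterm k f w i) \<in> carrier T"
    by (intro T.finsum_closed) (auto simp: dterm_closed[OF f])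
next
  fix u v d assume *: "u \<in> words" "v \<in> words"
  have c: "dterm k f (u @ (d, x) # v) i \<in> carrier T" if "x \<in> grade V d" "i < Suc (length u + length v)"
    for x i
    using * that by (intro dterm_closed[OF f]) (simp_all add: letterI)
  let ?D = "\<lambda>n x. \<Oplus>\<^bsub>T\<^esub> i \<in> {..<n}. dterm k f (u @ (d, x) # v) i"
  have "grade_linear R V T d (?D n)" if "n \<le> Suc (length u + length v)" for n
    using that
  proof (induction n)
    case 0
    then show ?case by (simp add: grade_linear_def)
  next
    case (Suc n)
    have l: "grade_linear R V T d (\<lambda>x. dterm k f (u @ (d, x) # v) n)"
      using Suc.prems by (intro dterm_linear[OF f *]) simp
    have cD: "?D n x \<in> carrier T" if "x \<in> grade V d" for x
      using Suc.prems c[OF that] by (intro T.finsum_closed) auto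
    have "?D (Suc n) x = dterm k f (u @ (d, x) # v) n \<oplus>\<^bsub>T\<^esub> ?D n x" if "x \<in> grade V d" for x
      using Suc.prems c[OF that] by (simp add: lessThan_Suc Pi_iff)
    then show ?case
      using l Suc cD c by (simp add: grade_linear_def T.a_ac TM.smult_r_distr grade_add_closed
        grade_smult_closed)
  qed
  then show "grade_linear R V T d (\<lambda>x. \<Oplus>\<^bsub>T\<^esub> i \<in> {..<length (u @ (d, x) # v)}. dterm k f (u @ (d, x) # v) i)"
    by simp
qed

lemma tder_rlin: "f \<in> gmor R V V k \<Longrightarrow> rlin R T T (tder R V k f)"
  unfolding tder_eq by (intro tlift_rlin T_module multilinear_tder)

lemma tder_pair:
  assumes f: "f \<in> gmor R V V k" and "u \<in> grade V i" "v \<in> grade V j"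
  shows "tder R V k f (tword R V [(i, u), (j, v)]) =
    tword R V [(i + k, f u), (j, v)] \<oplus>\<^bsub>T\<^esub> ksgn T (k * i) (tword R V [(i, u), (j + k, f v)])"
proof -
  have s: "{..<Suc (Suc 0)} = {0, 1}" by auto
  have c: "dterm k f [(i, u), (j, v)] n \<in> carrier T" if "n < 2" for n
    using assms that by (intro dterm_closed) (simp_all add: letterI)
  have "tder R V k f (tword R V [(i, u), (j, v)]) = dterm k f [(i, u), (j, v)] 0
    \<oplus>\<^bsub>T\<^esub> dterm k f [(i, u), (j, v)] 1"
    unfolding tder_eq using assms c[of 0] c[of 1]
    by (simp add: tlift_tword[OF T_module multilinear_tder] letterI s)
  then show ?thesis by (simp add: dterm_def wdeg_def) (simp add: ksgn_def)
qed

text \<open>Only the interchange of the first two factors is treated: it is the one in the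
  definition of cocommutativity and in the Jacobi argument. The cases say whether the varied letter
  is first, second, or untouched by the interchange.\<close>

lemma multilinear_tswap:
  "multilinear R V T (\<lambda>w. if Suc 0 < length w
     then ksgn T (fst (w ! 0) * fst (w ! Suc 0)) (tword R V (w[0 := w ! Suc 0, Suc 0 := w ! 0])) else
       tword R V w)"
  (is "multilinear R V T ?\<phi>")
proof -
  have \<phi>: "?\<phi> (p # q # r) = ksgn T (fst p * fst q) (tword R V (q # p # r))" "?\<phi> [p] = tword R V [p]"
    "?\<phi> [] = tword R V []"
    for p q r by simp_all
  show ?thesis
  proof (rule multilinearI)
    fix w assume "w \<in> words"
    then show "?\<phi> w \<in> carrier T"
      by (cases w; cases "tl w") (simp_all add: \<phi>)
  next
    fix u v i assume *: "u \<in> words" "v \<in> words"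
    note m = multilinearD[OF multilinear_tword]
    note k = grade_linear_rlin[OF rlin_ksgn[OF T_module rlin_id] m]
    consider "u = []" "v = []" | q r where "u = []" "v = q # r" | p where "u = [p]" | p q r where "u
      = p # q # r"
      by (cases u; cases "tl u"; cases v) auto
    then show "grade_linear R V T i (\<lambda>x. ?\<phi> (u @ (i, x) # v))"
    proof cases
      case 1 then show ?thesis using m[of "[]" "[]"] by simp
    next
      case 2 then show ?thesis using k[of "[q]" r] * by (simp add: letterI)
    next
      case 3 then show ?thesis using k[of "[]" "p # v"] * by (simp add: letterI)
    next
      case 4 then show ?thesis using k[of "q # p # r" "v"] * by (simp add: letterI)
    qed
  qed
qed

lemma tswap_rlin: "rlin R T T (tswap R V 0)"
  unfolding tswap_def by (intro tlift_rlin T_module multilinear_tswap)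

lemma tswap_tword:
  "(i, u) \<in> letters V \<Longrightarrow> (j, v) \<in> letters V \<Longrightarrow> w \<in> words \<Longrightarrow>
   tswap R V 0 (tword R V ((i, u) # (j, v) # w)) = ksgn T (i * j) (tword R V ((j, v) # (i, u) # w))"
  unfolding tswap_def by (subst tlift_tword[OF T_module multilinear_tswap]) simp_all

end

section \<open>The diagonal of a coalgebra\<close>

locale graded_coalg =
  fixes R :: "'r ring" (structure) and C :: "('r, 'c, 'z) coalg_scheme"
  assumes coalg: "coaug_graded_coalgebra R C"

sublocale graded_coalg \<subseteq> graded_mod R C
  using coalg by unfold_locales (simp add: coaug_graded_coalgebra_def)

context graded_coalg
begin

lemma tpow_simps: "add (tpow R C n) = add T" "smult (tpow R C n) = smult T" "carrier (tpow R C n)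
  = tlength R C n"
  by (simp_all add: tpow_def)

lemma comult_gmor: "comult C \<in> gmor R C (tpow R C 2) 0"
  using coalg by (simp add: coaug_graded_coalgebra_def)

lemma comult_rlin: "rlin R C T (comult C)"
  using gmor_rlin[OF comult_gmor] unfolding rlin_def tpow_simps by (blast intro: tlength_closed)

lemma comult_closed: "x \<in> carrier C \<Longrightarrow> comult C x \<in> carrier T"
  by (rule rlin_closed[OF comult_rlin])

lemma comult_grade: "x \<in> grade C i \<Longrightarrow> comult C x \<in> grade (tpow R C 2) i"
  using gmor_grade[OF comult_gmor] by fastforce

lemma coassoc: "x \<in> carrier C \<Longrightarrow> comult_first R C (comult C x) = comult_second R C (comult C x)"
  using coalg by (simp add: coaug_graded_coalgebra_def)

text \<open>The diagonal of a homogeneous element is represented by words of two letters of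
  complementary degree. The condition \<open>i + j = d\<close> is kept, since all vanishing
  arguments by degree depend on it.\<close>

lemma comult_ext:
  assumes N: "Module.module R N" and h: "rlin R T N h" and k: "rlin R T N k" and x: "x \<in> grade C d"
    and eq: "\<And>i j u v. \<lbrakk>u \<in> grade C i; v \<in> grade C j; i + j = d\<rbrakk> \<Longrightarrow>
      h (tword R C [(i, u), (j, v)]) = k (tword R C [(i, u), (j, v)])"
  shows "h (comult C x) = k (comult C x)"
proof (rule rlin_eq_on_tpow_grade[OF N h k comult_grade[OF x]])
  fix w assume w: "w \<in> words" "wdeg w = d" "length w = 2"
  then obtain i u j v where "w = [(i, u), (j, v)]" using length_2_cases by blast
  then show "h (tword R C w) = k (tword R C w)" using w eq by (simp add: letters_def wdeg_def)
qed

lemma comult_eqI: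
  assumes N: "Module.module R N" and h: "rlin R T N h" and k: "rlin R T N k" and x: "x \<in> carrier C"
    and eq: "\<And>i j u v. \<lbrakk>u \<in> grade C i; v \<in> grade C j\<rbrakk> \<Longrightarrow>
      h (tword R C [(i, u), (j, v)]) = k (tword R C [(i, u), (j, v)])"
  shows "h (comult C x) = k (comult C x)"
  by (rule rlin_eq_on_grades[OF graded N rlin_comp[OF h comult_rlin] rlin_comp[OF k comult_rlin] _ x])
     (rule comult_ext[OF N h k], assumption, rule eq)

lemma comult_letter: "(i, x) \<in> letters C \<Longrightarrow> x \<in> carrier C"
  using grade_carrier[OF graded] by (auto simp: letters_def)

lemma multilinear_comult_first:
  "multilinear R C T (\<lambda>w. case w of [] \<Rightarrow> \<zero>\<^bsub>T\<^esub> | p # u \<Rightarrow> comult C (snd p) \<otimes>\<^bsub>T\<^esub> tword R C u)"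
  (is "multilinear R C T ?\<phi>")
proof (rule multilinearI)
  fix w assume "w \<in> words"
  then show "?\<phi> w \<in> carrier T"
    by (cases w) (auto simp: comult_letter comult_closed)
next
  fix u v i assume *: "u \<in> words" "v \<in> words"
  show "grade_linear R C T i (\<lambda>x. ?\<phi> (u @ (i, x) # v))"
  proof (cases u)
    case Nil
    then show ?thesis
      using * by (simp add: grade_linear_def rlin_add[OF comult_rlin] rlin_smult[OF comult_rlin]
          grade_carrier[OF graded] comult_closed T.l_distr T_smult_assoc2)
  next
    case (Cons p q)
    then show ?thesis
      using * grade_linear_rlin[OF tmult_rlin(1)[OF graded_letters_axioms] multilinearD[OF
        multilinear_tword]]
        comult_letter[of "fst p" "snd p"]
      by (simp add: comult_closed letterI)
  qed
qed

lemma comult_first_rlin: "rlin R T T (comult_first R C)"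
  unfolding comult_first_def by (intro tlift_rlin T_module multilinear_comult_first)

lemma comult_first_tword:
  "(i, x) \<in> letters C \<Longrightarrow> w \<in> words \<Longrightarrow> comult_first R C (tword R C ((i, x) # w)) = comult C x \<otimes>\<^bsub>T\<^esub> tword R C w"
  unfolding comult_first_def by (subst tlift_tword[OF T_module multilinear_comult_first]) simp_all

lemma comult_second_eq:
  "comult_second R C = tlift R T (case2 \<zero>\<^bsub>T\<^esub> (\<lambda>i u j v. tword R C [(i, u)] \<otimes>\<^bsub>T\<^esub> comult C v))"
proof -
  have "(\<lambda>w. case w of [p, q] \<Rightarrow> tword R C [p] \<otimes>\<^bsub>T\<^esub> comult C (snd q) | _ \<Rightarrow> \<zero>\<^bsub>T\<^esub>) =
     case2 \<zero>\<^bsub>T\<^esub> (\<lambda>i u j v. tword R C [(i, u)] \<otimes>\<^bsub>T\<^esub> comult C v)"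
    by (rule ext) (simp add: case2_def split: list.split)
  then show ?thesis by (simp add: comult_second_def)
qed

lemma multilinear_comult_second:
  "multilinear R C T (case2 \<zero>\<^bsub>T\<^esub> (\<lambda>i u j v. tword R C [(i, u)] \<otimes>\<^bsub>T\<^esub> comult C v))"
  using multilinearD[OF multilinear_tword, of "[]" "[]"]
  by (intro multilinear_case2 T_module)
     (simp_all add: grade_linear_def letterI comult_closed grade_carrier[OF graded]
       rlin_add[OF comult_rlin]
       T.r_distr T.l_distr rlin_smult[OF comult_rlin] T_smult_right T_smult_assoc2)

lemma comult_second_rlin: "rlin R T T (comult_second R C)"
  unfolding comult_second_eq by (intro tlift_rlin T_module multilinear_comult_second)

lemma comult_second_tword:
  "(i, u) \<in> letters C \<Longrightarrow> (j, v) \<in> letters C \<Longrightarrow>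
    comult_second R C (tword R C [(i, u), (j, v)]) = tword R C [(i, u)] \<otimes>\<^bsub>T\<^esub> comult C v"
  unfolding comult_second_eq by (subst tlift_tword[OF T_module multilinear_comult_second]) simp_all

end

section \<open>The cup bracket\<close>

locale lie_alg =
  fixes R :: "'r ring" (structure) and L :: "('r, 'a, 'y) glie_scheme" and dL :: "'a \<Rightarrow> 'a"
  assumes lie: "dg_lie_algebra R L dL"
begin

abbreviation "br \<equiv> lbracket L"

lemma L_graded: "graded_module R L"
  using lie by (simp add: dg_lie_algebra_def chain_complex_def)

end

sublocale lie_alg \<subseteq> LM: gmodule R L
  by (rule gmodule.intro[OF graded_module_module[OF L_graded]])

context lie_alg
begin

lemma dL_gmor: "dL \<in> gmor R L L (-1)"
  using lie by (simp add: dg_lie_algebra_def chain_complex_def)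

lemma br_closed [simp]: "x \<in> carrier L \<Longrightarrow> y \<in> carrier L \<Longrightarrow> br x y \<in> carrier L"
  using lie by (simp add: dg_lie_algebra_def)

lemma br_add:
  "\<lbrakk>x \<in> carrier L; y \<in> carrier L; z \<in> carrier L\<rbrakk> \<Longrightarrow> br (x \<oplus>\<^bsub>L\<^esub> y) z = br x z \<oplus>\<^bsub>L\<^esub> br y z"
  "\<lbrakk>x \<in> carrier L; y \<in> carrier L; z \<in> carrier L\<rbrakk> \<Longrightarrow> br z (x \<oplus>\<^bsub>L\<^esub> y) = br z x \<oplus>\<^bsub>L\<^esub> br z y"
  using lie by (simp_all add: dg_lie_algebra_def)

lemma br_smult:
  "\<lbrakk>r \<in> carrier R; x \<in> carrier L; y \<in> carrier L\<rbrakk> \<Longrightarrow> br (r \<odot>\<^bsub>L\<^esub> x) y = r \<odot>\<^bsub>L\<^esub> br x y"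
  "\<lbrakk>r \<in> carrier R; x \<in> carrier L; y \<in> carrier L\<rbrakk> \<Longrightarrow> br x (r \<odot>\<^bsub>L\<^esub> y) = r \<odot>\<^bsub>L\<^esub> br x y"
  using lie by (simp_all add: dg_lie_algebra_def)

lemma br_rlin: "x \<in> carrier L \<Longrightarrow> rlin R L L (br x)" "x \<in> carrier L \<Longrightarrow> rlin R L L (\<lambda>y. br y x)"
  by (simp_all add: rlin_def br_add br_smult)

lemma br_zero [simp]: "x \<in> carrier L \<Longrightarrow> br \<zero>\<^bsub>L\<^esub> x = \<zero>\<^bsub>L\<^esub>" "x \<in> carrier L \<Longrightarrow> br x \<zero>\<^bsub>L\<^esub> = \<zero>\<^bsub>L\<^esub>"
  using rlin_zero[OF LM.module_axioms LM.module_axioms br_rlin(1)]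
    rlin_zero[OF LM.module_axioms LM.module_axioms br_rlin(2)] by simp_all

lemma br_neg: "x \<in> carrier L \<Longrightarrow> y \<in> carrier L \<Longrightarrow> br (\<ominus>\<^bsub>L\<^esub> x) y = \<ominus>\<^bsub>L\<^esub> br x y"
  "x \<in> carrier L \<Longrightarrow> y \<in> carrier L \<Longrightarrow> br x (\<ominus>\<^bsub>L\<^esub> y) = \<ominus>\<^bsub>L\<^esub> br x y"
  using rlin_a_inv[OF LM.module_axioms LM.module_axioms br_rlin(1)]
    rlin_a_inv[OF LM.module_axioms LM.module_axioms br_rlin(2)] by simp_all

lemmas br_homogeneous = lie[unfolded dg_lie_algebra_def, THEN conjunct2, THEN conjunct2, THEN conjunct2,
  THEN conjunct2, THEN spec, THEN spec, THEN bspec, THEN bspec]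

lemma br_grade: "x \<in> grade L i \<Longrightarrow> y \<in> grade L j \<Longrightarrow> br x y \<in> grade L (i + j)"
  by (rule br_homogeneous[THEN conjunct1])

lemma br_anti: "x \<in> grade L i \<Longrightarrow> y \<in> grade L j \<Longrightarrow> br x y = \<ominus>\<^bsub>L\<^esub> ksgn L (i * j) (br y x)"
  by (rule br_homogeneous[THEN conjunct2, THEN conjunct1])

lemma br_diff: "x \<in> grade L i \<Longrightarrow> y \<in> grade L j \<Longrightarrow>
   dL (br x y) = br (dL x) y \<oplus>\<^bsub>L\<^esub> ksgn L i (br x (dL y))"
  by (rule br_homogeneous[THEN conjunct2, THEN conjunct2, THEN conjunct1])

lemma br_jacobi: "x \<in> grade L i \<Longrightarrow> y \<in> grade L j \<Longrightarrow> z \<in> carrier L \<Longrightarrow>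
   br x (br y z) = br (br x y) z \<oplus>\<^bsub>L\<^esub> ksgn L (i * j) (br y (br x z))"
  by (rule br_homogeneous[THEN conjunct2, THEN conjunct2, THEN conjunct2, THEN bspec])

lemma L_carrier: "x \<in> grade L i \<Longrightarrow> x \<in> carrier L"
  by (rule grade_carrier[OF L_graded])

end

locale cup_setting = C: graded_coalg R C + lie_alg R L dL
  for R :: "'r ring" (structure) and C :: "('r, 'c, 'z) coalg_scheme"
    and L :: "('r, 'a, 'y) glie_scheme" and dL
begin

abbreviation "T \<equiv> tens R C"

definition cup_form :: "int \<Rightarrow> ('c \<Rightarrow> 'a) \<Rightarrow> ('c \<Rightarrow> 'a) \<Rightarrow> (int \<times> 'c) list \<Rightarrow> 'a" where
  "cup_form q a b = case2 \<zero>\<^bsub>L\<^esub> (\<lambda>i u j v. ksgn L (q * i) (br (a u) (b v)))"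

abbreviation "cup_lin q a b \<equiv> tlift R L (cup_form q a b)"

lemma cup_eq: "cup_bracket R C L q a b x = cup_lin q a b (comult C x)"
  unfolding cup_bracket_def cup_form_def case2_def ..

lemma C_carrier: "x \<in> grade C i \<Longrightarrow> x \<in> carrier C"
  by (rule grade_carrier[OF C.graded])

lemma multilinear_cup_form:
  assumes "rlin R C L a" "rlin R C L b"
  shows "multilinear R C L (cup_form q a b)"
  unfolding cup_form_def
  by (rule multilinear_case2[OF LM.module_axioms])
     (simp_all add: grade_linear_def C_carrier rlin_closed[OF assms(1)] rlin_closed[OF assms(2)]
       rlin_add[OF assms(1)] rlin_add[OF assms(2)]
        rlin_smult[OF assms(1)] rlin_smult[OF assms(2)] br_add br_smult LM.ksgn_add LM.ksgn_smult)

lemma cup_form_rlin: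
  assumes "rlin R C L a" "rlin R C L b"
  shows "rlin R T L (cup_lin q a b)"
  by (rule C.tlift_rlin[OF LM.module_axioms multilinear_cup_form[OF assms]])

lemma cup_form_pair:
  assumes "rlin R C L a" "rlin R C L b" "u \<in> grade C i" "v \<in> grade C j"
  shows "cup_lin q a b (tword R C [(i, u), (j, v)]) = ksgn L (q * i) (br (a u) (b v))"
  using assms by (simp add: C.tlift_tword[OF LM.module_axioms multilinear_cup_form] C.letterI)
    (simp add: cup_form_def)

lemma cup_rlin:
  assumes "rlin R C L a" "rlin R C L b"
  shows "rlin R C L (cup_bracket R C L q a b)"
  unfolding cup_eq[abs_def] by (rule rlin_comp[OF cup_form_rlin[OF assms] C.comult_rlin])

text \<open>The number \<open>q'\<close> enters the cup bracket only through a sign, so it need not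
  be the degree of \<open>b\<close> here.\<close>

lemma cup_grade:
  assumes a: "a \<in> gmor R C L p" and b: "b \<in> gmor R C L q" and x: "x \<in> grade C i"
  shows "cup_bracket R C L q' a b x \<in> grade L (i + p + q)"
proof -
  note ab = gmor_rlin[OF a] gmor_rlin[OF b]
  note l = cup_form_rlin[OF ab]
  show ?thesis unfolding cup_eq using C.comult_grade[OF x]
  proof (induction rule: C.tpow_grade_induct)
    case zero
    then show ?case by (simp add: rlin_zero[OF C.T_module LM.module_axioms l] grade_zero[OF L_graded])
  next
    case (add A r w)
    then obtain k u j v where w: "w = [(k, u), (j, v)]" using length_2_cases by blast
    have uv: "u \<in> grade C k" "v \<in> grade C j" "k + j = i" using add w by
      (simp_all add: letters_def wdeg_def)
    have "br (a u) (b v) \<in> grade L ((k + p) + (j + q))"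
      using uv by (intro br_grade gmor_grade[OF a] gmor_grade[OF b])
    moreover have "(k + p) + (j + q) = i + p + q" using uv by simp
    ultimately have "br (a u) (b v) \<in> grade L (i + p + q)" by simp
    then have "cup_lin q' a b (tword R C w) \<in> grade L (i + p + q)"
      unfolding w cup_form_pair[OF ab uv(1,2)] by (rule grade_ksgn[OF L_graded])
    then show ?case using add
      by (simp add: rlin_add[OF l] rlin_smult[OF l] grade_add[OF L_graded] grade_smult[OF L_graded])
  qed
qed

lemma cup_gmor:
  assumes "a \<in> gmor R C L p" "b \<in> gmor R C L q"
  shows "cup_bracket R C L q' a b \<in> gmor R C L (p + q)"
  using cup_grade[OF assms] by (intro gmorI cup_rlin gmor_rlin[OF assms(1)] gmor_rlin[OF assms(2)])
    (simp add: add.assoc)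

lemma cup_cong:
  assumes "rlin R C L a" "rlin R C L b" "rlin R C L a'" "rlin R C L b'" and x: "x \<in> carrier C"
    and eq: "\<And>u v. \<lbrakk>u \<in> carrier C; v \<in> carrier C\<rbrakk> \<Longrightarrow> br (a u) (b v) = br (a' u) (b' v)"
  shows "cup_bracket R C L q a b x = cup_bracket R C L q a' b' x"
  unfolding cup_eq
  by (rule C.comult_eqI[OF LM.module_axioms cup_form_rlin[OF assms(1,2)] cup_form_rlin[OF assms(3,4)] x])
     (use assms in \<open>simp add: cup_form_pair C_carrier\<close>)

text \<open>Cocommutativity allows the two tensor factors to be interchanged before evaluation; the
  antisymmetry of the Lie bracket then restores their order.\<close>

lemma cup_anti:
  assumes cocomm: "cocommutative R C"
    and a: "a \<in> gmor R C L p" and b: "b \<in> gmor R C L q" and x: "x \<in> carrier C"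
  shows "cup_bracket R C L q a b x = \<ominus>\<^bsub>L\<^esub> ksgn L (p * q) (cup_bracket R C L p b a x)"
proof -
  note ab = gmor_rlin[OF a] gmor_rlin[OF b]
  let ?l = "\<lambda>A. cup_lin q a b (tswap R C 0 A)" and ?r = "\<lambda>A. \<ominus>\<^bsub>L\<^esub> ksgn L (p * q) (cup_lin p b a A)"
  have "cup_bracket R C L q a b x = ?l (comult C x)"
    using cocomm x by (simp add: cup_eq cocommutative_def)
  also have "\<dots> = ?r (comult C x)"
  proof (rule C.comult_eqI[OF LM.module_axioms _ _ x])
    show "rlin R T L ?l"
      by (intro rlin_comp[OF cup_form_rlin[OF ab] C.tswap_rlin])
    show "rlin R T L ?r"
      by (intro rlin_neg LM.module_axioms rlin_ksgn cup_form_rlin[OF ab(2,1)])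
    fix k j u v assume uv: "u \<in> grade C k" "v \<in> grade C j"
    let ?w = "tword R C [(k, u), (j, v)]"
    have auv: "a v \<in> grade L (j + p)" "b u \<in> grade L (k + q)"
      using uv gmor_grade[OF a] gmor_grade[OF b] by blast+
    have "?l ?w = ksgn L (k * j) (cup_lin q a b (tword R C [(j, v), (k, u)]))"
      using uv C.tswap_tword[of k u j v "[]"]
      by (simp add: C.letterI ksgn_def rlin_a_inv[OF C.T_module LM.module_axioms cup_form_rlin[OF ab]])
    also have "\<dots> = ksgn L (k * j) (ksgn L (q * j) (\<ominus>\<^bsub>L\<^esub> ksgn L ((j + p) * (k + q)) (br (b u) (a v))))"
      using uv by (simp add: cup_form_pair[OF ab] br_anti[OF auv])
    \<comment> \<open>Modulo 2, \<open>k * j + q * j + (j + p) * (k + q)\<close> equals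
      \<open>p * q + p * k\<close>: the terms \<open>j * k\<close> and \<open>j * q\<close> occur
      twice.\<close>
    also have "\<dots> = \<ominus>\<^bsub>L\<^esub> ksgn L (p * q) (ksgn L (p * k) (br (b u) (a v)))"
      using L_carrier[OF auv(1)] L_carrier[OF auv(2)] by (auto simp: ksgn_def)
    also have "ksgn L (p * k) (br (b u) (a v)) = cup_lin p b a ?w"
      using uv by (simp add: cup_form_pair[OF ab(2,1)])
    finally show "?l ?w = ?r ?w" .
  qed
  finally show ?thesis by (simp add: cup_eq)
qed

lemma hom_diff_gmor:
  assumes dC: "dC \<in> gmor R C C (-1)" and a: "a \<in> gmor R C L p"
  shows "hom_diff L dL dC p a \<in> gmor R C L (p - 1)"
proof (rule gmorI)
  show "rlin R C L (hom_diff L dL dC p a)"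
    unfolding hom_diff_def[abs_def] a_minus_def
    by (intro rlin_plus rlin_neg rlin_ksgn LM.module_axioms
      rlin_comp[OF gmor_rlin[OF dL_gmor] gmor_rlin[OF a]]
       rlin_comp[OF gmor_rlin[OF a] gmor_rlin[OF dC]])
  fix i x assume x: "x \<in> grade C i"
  have "dL (a x) \<in> grade L (i + p + - 1)" "a (dC x) \<in> grade L (i + - 1 + p)"
    by (intro gmor_grade[OF dL_gmor] gmor_grade[OF a] gmor_grade[OF dC] x)+
  then show "hom_diff L dL dC p a x \<in> grade L (i + (p - 1))"
    unfolding hom_diff_def a_minus_def
    by (intro grade_add[OF L_graded] grade_neg[OF L_graded] grade_ksgn[OF L_graded])
      (simp_all add: algebra_simps)
qed

text \<open>The Leibniz rule for the morphism [a, a]. Its degree -2 is even, so its differential has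
  a plain minus sign on the left; on the right, \<open>-2\<close> is the degree of
  \<open>Da\<close>. The coderivation property moves \<open>dC\<close> onto the tensor factors,
  where the Leibniz rule of the Lie bracket takes over.\<close>

lemma cup_diff:
  assumes dC: "coderivation R C (-1) dC"
    and a: "a \<in> gmor R C L (-1)" and x: "x \<in> carrier C"
  defines "Da \<equiv> hom_diff L dL dC (-1) a"
  shows "dL (cup_bracket R C L (-1) a a x) \<ominus>\<^bsub>L\<^esub> cup_bracket R C L (-1) a a (dC x)
    = cup_bracket R C L (-1) Da a x \<ominus>\<^bsub>L\<^esub> cup_bracket R C L (-2) a Da x"
proof -
  have d: "dC \<in> gmor R C C (-1)" using dC by (simp add: coderivation_def)
  note al = gmor_rlin[OF a] and dl = gmor_rlin[OF d] and dLl = gmor_rlin[OF dL_gmor]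
  have Da: "Da \<in> gmor R C L (-1 - 1)" unfolding Da_def by (rule hom_diff_gmor[OF d a])
  note Dal = gmor_rlin[OF Da]
  note f = cup_form_rlin[OF al al, of "-1"]
  let ?l = "\<lambda>A. dL (cup_lin (-1) a a A) \<oplus>\<^bsub>L\<^esub> \<ominus>\<^bsub>L\<^esub> cup_lin (-1) a a (tder R C (-1) dC A)"
  let ?r = "\<lambda>A. cup_lin (-1) Da a A \<oplus>\<^bsub>L\<^esub> \<ominus>\<^bsub>L\<^esub> cup_lin (-2) a Da A"
  have "cup_bracket R C L (-1) a a (dC x) = cup_lin (-1) a a (tder R C (-1) dC (comult C x))"
    using dC x by (simp add: cup_eq coderivation_def)
  then have "dL (cup_bracket R C L (-1) a a x) \<ominus>\<^bsub>L\<^esub> cup_bracket R C L (-1) a a (dC x) = ?l (comult C x)"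
    by (simp add: cup_eq a_minus_def)
  also have "\<dots> = ?r (comult C x)"
  proof (rule C.comult_eqI[OF LM.module_axioms _ _ x])
    show "rlin R T L ?l"
      by (intro rlin_plus rlin_neg LM.module_axioms rlin_comp[OF dLl f] rlin_comp[OF f C.tder_rlin[OF d]])
    show "rlin R T L ?r"
      by (intro rlin_plus rlin_neg LM.module_axioms cup_form_rlin Dal al)
    fix k j u v assume uv: "u \<in> grade C k" "v \<in> grade C j"
    have duv: "dC u \<in> grade C (k + - 1)" "dC v \<in> grade C (j + - 1)"
      using gmor_grade[OF d uv(1)] gmor_grade[OF d uv(2)] by simp_all
    have auv: "a u \<in> grade L (k + - 1)" "a v \<in> grade L (j + - 1)"
      using gmor_grade[OF a uv(1)] gmor_grade[OF a uv(2)] by simp_all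
    note c = L_carrier[OF auv(1)] L_carrier[OF auv(2)] rlin_closed[OF dLl L_carrier[OF auv(1)]]
       rlin_closed[OF dLl L_carrier[OF auv(2)]]
       rlin_closed[OF al C_carrier[OF duv(1)]] rlin_closed[OF al C_carrier[OF duv(2)]]
    let ?w = "tword R C [(k, u), (j, v)]"
    have 1: "dL (cup_lin (-1) a a ?w) = ksgn L k (br (dL (a u)) (a v)
      \<oplus>\<^bsub>L\<^esub> ksgn L (k - 1) (br (a u) (dL (a v))))"
      using uv c rlin_a_inv[OF LM.module_axioms LM.module_axioms dLl]
      by (simp add: cup_form_pair[OF al al] ksgn_def br_diff[OF auv])
    have k: "cup_lin (-1) a a (ksgn T n A) = ksgn L n (cup_lin (-1) a a A)" if "A \<in> carrier T" for n A
      using rlin_a_inv[OF C.T_module LM.module_axioms f that] by (simp add: ksgn_def)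
    have 2: "cup_lin (-1) a a (tder R C (-1) dC ?w) = ksgn L (k - 1) (br (a (dC u)) (a v))
      \<oplus>\<^bsub>L\<^esub> br (a u) (a (dC v))"
      using uv duv c by (simp add: C.tder_pair[OF d] C.letterI rlin_add[OF f] k cup_form_pair[OF al al])
        (simp add: ksgn_def)
    have Da_eq: "Da y = dL (a y) \<oplus>\<^bsub>L\<^esub> a (dC y)" if "y \<in> carrier C" for y
      using rlin_closed[OF al rlin_closed[OF dl that]] by
        (simp add: Da_def hom_diff_def a_minus_def ksgn_def)
    have 3: "cup_lin (-1) Da a ?w = ksgn L k (br (dL (a u)) (a v) \<oplus>\<^bsub>L\<^esub> br (a (dC u)) (a v))"
      unfolding cup_form_pair[OF Dal al uv] Da_eq[OF C_carrier[OF uv(1)]]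
      using c by (simp add: br_add) (simp add: ksgn_def)
    have 4: "cup_lin (-2) a Da ?w = br (a u) (dL (a v)) \<oplus>\<^bsub>L\<^esub> br (a u) (a (dC v))"
      unfolding cup_form_pair[OF al Dal uv] Da_eq[OF C_carrier[OF uv(2)]]
      using c by (simp add: br_add) (simp add: ksgn_def)
    show "?l ?w = ?r ?w"
      unfolding 1 2 3 4 using c
      by (cases "even k") (simp_all add: ksgn_def LM.minus_add LM.a_ac)
  qed
  finally show ?thesis by (simp add: cup_eq a_minus_def)
qed

text \<open>The sign is that of evaluating three copies of the odd morphism \<open>a\<close> on a
  triple of letters: the second copy passes \<open>u\<close>, the third passes \<open>u\<close> and
  \<open>v\<close>, and \<open>2 * i + j\<close> has the parity of \<open>j\<close>.\<close>

lemma multilinear_triple_bracket: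
  assumes a: "rlin R C L a"
  shows "multilinear R C L (case3 \<zero>\<^bsub>L\<^esub> (\<lambda>i u j v l w. ksgn L j (br (a u) (br (a v) (a w)))))"
    and "multilinear R C L (case3 \<zero>\<^bsub>L\<^esub> (\<lambda>i u j v l w. ksgn L j (br (br (a u) (a v)) (a w))))"
  by (rule multilinear_case3[OF LM.module_axioms],
      simp_all add: grade_linear_def C_carrier rlin_closed[OF a] rlin_add[OF a]
        rlin_smult[OF a] br_add br_smult LM.ksgn_add LM.ksgn_smult)+

text \<open>The test on pairs is used twice: first for the outer diagonal, then for the diagonal of
  the first factor with the last letter held fixed.\<close>

lemma comult_first_ext:
  assumes N: "Module.module R N" and h: "rlin R T N h" and k: "rlin R T N k" and x: "x \<in> carrier C"
    and eq: "\<And>i j l u v w. \<lbrakk>u \<in> grade C i; v \<in> grade C j; w \<in> grade C l\<rbrakk> \<Longrightarrow>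
      h (tword R C [(i, u), (j, v), (l, w)]) = k (tword R C [(i, u), (j, v), (l, w)])"
  shows "h (comult_first R C (comult C x)) = k (comult_first R C (comult C x))"
proof -
  note f = rlin_comp[OF h C.comult_first_rlin] rlin_comp[OF k C.comult_first_rlin]
  show ?thesis
  proof (rule C.comult_eqI[OF N f x])
    fix n l y w assume y: "y \<in> grade C n" and w: "w \<in> grade C l"
    have wl: "tword R C [(l, w)] \<in> carrier T" using w by (simp add: C.letterI)
    note m = tmult_rlin(2)[OF C.graded_letters_axioms wl]
    have "h (comult C y \<otimes>\<^bsub>T\<^esub> tword R C [(l, w)]) = k (comult C y \<otimes>\<^bsub>T\<^esub> tword R C [(l, w)])"
    proof (rule C.comult_ext[OF N rlin_comp[OF h m] rlin_comp[OF k m] y])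
      fix i j u v assume uv: "u \<in> grade C i" "v \<in> grade C j"
      show "h (tword R C [(i, u), (j, v)] \<otimes>\<^bsub>T\<^esub> tword R C [(l, w)])
        = k (tword R C [(i, u), (j, v)] \<otimes>\<^bsub>T\<^esub> tword R C [(l, w)])"
        using uv w eq[OF uv w] C.tword_append[of "[(i, u), (j, v)]" "[(l, w)]"] by (simp add: C.letterI)
    qed
    then show "h (comult_first R C (tword R C [(n, y), (l, w)]))
      = k (comult_first R C (tword R C [(n, y), (l, w)]))"
      using y w by (simp add: C.comult_first_tword C.letterI)
  qed
qed

text \<open>An interchange of the first two factors commutes with multiplication by a last letter,
  and cocommutativity says that it fixes the inner diagonal.\<close>

lemma tswap_comult_first:
  assumes cocomm: "cocommutative R C" and x: "x \<in> carrier C"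
  shows "tswap R C 0 (comult_first R C (comult C x)) = comult_first R C (comult C x)"
proof -
  note f = rlin_comp[OF C.tswap_rlin C.comult_first_rlin]
  show ?thesis
  proof (rule C.comult_eqI[OF C.T_module f C.comult_first_rlin x])
    fix n l y w assume y: "y \<in> grade C n" and w: "w \<in> grade C l"
    have wl: "tword R C [(l, w)] \<in> carrier T" using w by (simp add: C.letterI)
    note m = tmult_rlin(2)[OF C.graded_letters_axioms wl]
    have "tswap R C 0 (comult C y \<otimes>\<^bsub>T\<^esub> tword R C [(l, w)]) = tswap R C 0 (comult C y) \<otimes>\<^bsub>T\<^esub> tword R C [(l, w)]"
    proof (rule C.comult_ext[OF C.T_module rlin_comp[OF C.tswap_rlin m] rlin_comp[OF m C.tswap_rlin] y])
      fix i j u v assume uv: "u \<in> grade C i" "v \<in> grade C j"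
      note l = C.letterI[OF uv(1)] C.letterI[OF uv(2)] C.letterI[OF w]
      show "tswap R C 0 (tword R C [(i, u), (j, v)] \<otimes>\<^bsub>T\<^esub> tword R C [(l, w)])
        = tswap R C 0 (tword R C [(i, u), (j, v)]) \<otimes>\<^bsub>T\<^esub> tword R C [(l, w)]"
        using l C.tword_append[of "[(i, u), (j, v)]" "[(l, w)]"] C.tword_append[of "[(j, v), (i, u)]"
          "[(l, w)]"]
           C.tswap_tword[OF l(1,2), of "[]"] C.tswap_tword[OF l(1,2), of "[(l, w)]"]
        by (auto simp: ksgn_def C.T.l_minus)
    qed
    also have "tswap R C 0 (comult C y) = comult C y"
      using cocomm C_carrier[OF y] by (simp add: cocommutative_def)
    finally show "tswap R C 0 (comult_first R C (tword R C [(n, y), (l, w)]))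
      = comult_first R C (tword R C [(n, y), (l, w)])"
      using y w by (simp add: C.comult_first_tword C.letterI)
  qed
qed

text \<open>
  Coassociativity and cocommutativity reduce the graded Jacobi identity for \<open>[a, [a, a]]\<close> to
  \<open>3 [a, [a, a]] = 0\<close>.
\<close>

lemma cup_jacobi:
  assumes cocomm: "cocommutative R C" and three: "\<And>y. y \<in> carrier L \<Longrightarrow> y \<oplus>\<^bsub>L\<^esub> (y \<oplus>\<^bsub>L\<^esub> y) = \<zero>\<^bsub>L\<^esub> \<Longrightarrow> y = \<zero>\<^bsub>L\<^esub>"
    and a: "a \<in> gmor R C L (-1)" and x: "x \<in> carrier C"
  shows "cup_bracket R C L (-1) (cup_bracket R C L (-1) a a) a x = \<zero>\<^bsub>L\<^esub>"
proof -
  let ?W = "cup_bracket R C L (-1) a a"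
  \<comment> \<open>\<open>?F\<close> and \<open>?G\<close> are the linear forms on triples for the
    two nestings of the bracket; [a, [a, a]] and [[a, a], a] are their values on the two iterated
    diagonals.\<close>
  let ?F = "tlift R L (case3 \<zero>\<^bsub>L\<^esub> (\<lambda>i u j v l w. ksgn L j (br (a u) (br (a v) (a w)))))"
  let ?G = "tlift R L (case3 \<zero>\<^bsub>L\<^esub> (\<lambda>i u j v l w. ksgn L j (br (br (a u) (a v)) (a w))))"
  have W: "?W \<in> gmor R C L (-1 + -1)" by (rule cup_gmor[OF a a])
  note al = gmor_rlin[OF a] and Wl = gmor_rlin[OF W]
  note Fm = multilinear_triple_bracket(1)[OF al] and Gm = multilinear_triple_bracket(2)[OF al]
  note Fl = C.tlift_rlin[OF LM.module_axioms Fm] and Gl = C.tlift_rlin[OF LM.module_axioms Gm]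
  have F: "?F (tword R C [(i, u), (j, v), (l, w)]) = ksgn L j (br (a u) (br (a v) (a w)))"
    and G: "?G (tword R C [(i, u), (j, v), (l, w)]) = ksgn L j (br (br (a u) (a v)) (a w))"
    if "u \<in> grade C i" "v \<in> grade C j" "w \<in> grade C l" for i u j v l w
    using that by (simp_all add: C.tlift_tword[OF LM.module_axioms Fm] C.tlift_tword[OF
      LM.module_axioms Gm] C.letterI)
  have ac: "a u \<in> carrier L" if "u \<in> grade C i" for u i using rlin_closed[OF al C_carrier[OF that]] .
  note f = rlin_comp[OF Fl C.comult_second_rlin]
  have A: "cup_bracket R C L (-2) a ?W x = ?F (comult_second R C (comult C x))"
    unfolding cup_eq[of "-2"]
  proof (rule C.comult_eqI[OF LM.module_axioms cup_form_rlin[OF al Wl] f x])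
    fix i n u y assume u: "u \<in> grade C i" and y: "y \<in> grade C n"
    have ul: "tword R C [(i, u)] \<in> carrier T" using u by (simp add: C.letterI)
    note m = tmult_rlin(1)[OF C.graded_letters_axioms ul]
    have "br (a u) (cup_lin (-1) a a (comult C y)) = ?F (tword R C [(i, u)] \<otimes>\<^bsub>T\<^esub> comult C y)"
    proof (rule C.comult_ext[OF LM.module_axioms
      rlin_comp[OF br_rlin(1)[OF ac[OF u]] cup_form_rlin[OF al al]] rlin_comp[OF Fl m] y])
      fix j l v w assume vw: "v \<in> grade C j" "w \<in> grade C l"
      note l = C.letterI[OF u] C.letterI[OF vw(1)] C.letterI[OF vw(2)]
      show "br (a u) (cup_lin (-1) a a (tword R C [(j, v), (l, w)]))
        = ?F (tword R C [(i, u)] \<otimes>\<^bsub>T\<^esub> tword R C [(j, v), (l, w)])"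
        using l C.tword_append[of "[(i, u)]"
          "[(j, v), (l, w)]"] F[OF u vw] ac[OF u] ac[OF vw(1)] ac[OF vw(2)]
        by (simp add: cup_form_pair[OF al al vw]) (simp add: ksgn_def br_neg)
    qed
    then show "cup_lin (-2) a ?W (tword R C [(i, u), (n, y)])
      = ?F (comult_second R C (tword R C [(i, u), (n, y)]))"
      using u y by (simp add: cup_form_pair[OF al Wl] C.comult_second_tword C.letterI cup_eq)
        (simp add: ksgn_def)
  qed
  note f = rlin_comp[OF Gl C.comult_first_rlin]
  have B: "cup_bracket R C L (-1) ?W a x = ?G (comult_first R C (comult C x))"
    unfolding cup_eq[of "-1" ?W]
  proof (rule C.comult_eqI[OF LM.module_axioms cup_form_rlin[OF Wl al] f x])
    fix n l y w assume y: "y \<in> grade C n" and w: "w \<in> grade C l"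
    have wl: "tword R C [(l, w)] \<in> carrier T" using w by (simp add: C.letterI)
    note m = tmult_rlin(2)[OF C.graded_letters_axioms wl]
    note b = rlin_ksgn[OF LM.module_axioms rlin_comp[OF br_rlin(2)[OF ac[OF w]] cup_form_rlin[OF al al]]]
    have "ksgn L n (br (cup_lin (-1) a a (comult C y)) (a w)) = ?G (comult C y \<otimes>\<^bsub>T\<^esub> tword R C [(l, w)])"
    proof (rule C.comult_ext[OF LM.module_axioms b rlin_comp[OF Gl m] y])
      fix i j u v assume uv: "u \<in> grade C i" "v \<in> grade C j" "i + j = n"
      note l = C.letterI[OF uv(1)] C.letterI[OF uv(2)] C.letterI[OF w]
      show "ksgn L n (br (cup_lin (-1) a a (tword R C [(i, u), (j, v)])) (a w))
        = ?G (tword R C [(i, u), (j, v)] \<otimes>\<^bsub>T\<^esub> tword R C [(l, w)])"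
        using l C.tword_append[of "[(i, u), (j, v)]"
          "[(l, w)]"] G[OF uv(1,2) w] ac[OF uv(1)] ac[OF uv(2)] ac[OF w] uv(3)
        by (simp add: cup_form_pair[OF al al uv(1,2)]) (auto simp: ksgn_def br_neg)
    qed
    then show "cup_lin (-1) ?W a (tword R C [(n, y), (l, w)])
      = ?G (comult_first R C (tword R C [(n, y), (l, w)]))"
      using w y by (simp add: cup_form_pair[OF Wl al] C.comult_first_tword C.letterI cup_eq)
        (simp add: ksgn_def)
  qed
  let ?Z = "comult_first R C (comult C x)"
  have Z: "?Z \<in> carrier T" using x by (intro rlin_closed[OF C.comult_first_rlin] C.comult_closed)
  \<comment> \<open>This is the Jacobi identity of the Lie algebra on a triple. Combined with the
    sign of parity \<open>j\<close> in \<open>?F\<close>, the Jacobi sign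
    \<open>(i - 1) * (j - 1)\<close> has the parity of \<open>i * j + i + 1\<close>, the opposite of
    the sign \<open>i * j + i\<close> produced by the interchange.\<close>
  have "?F ?Z = ?G ?Z \<oplus>\<^bsub>L\<^esub> \<ominus>\<^bsub>L\<^esub> ?F (tswap R C 0 ?Z)"
  proof (rule comult_first_ext[OF LM.module_axioms Fl _ x])
    show "rlin R T L (\<lambda>X. ?G X \<oplus>\<^bsub>L\<^esub> \<ominus>\<^bsub>L\<^esub> ?F (tswap R C 0 X))"
      by (intro rlin_plus rlin_neg LM.module_axioms Gl rlin_comp[OF Fl C.tswap_rlin])
    fix i j l u v w assume uvw: "u \<in> grade C i" "v \<in> grade C j" "w \<in> grade C l"
    note l = C.letterI[OF uvw(1)] C.letterI[OF uvw(2)] C.letterI[OF uvw(3)]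
    have auv: "a u \<in> grade L (i - 1)" "a v \<in> grade L (j - 1)"
      using gmor_grade[OF a uvw(1)] gmor_grade[OF a uvw(2)] by simp_all
    note c = ac[OF uvw(1)] ac[OF uvw(2)] ac[OF uvw(3)]
    have Fk: "?F (ksgn T n X) = ksgn L n (?F X)" if "X \<in> carrier T" for n X
      using rlin_a_inv[OF C.T_module LM.module_axioms Fl that] by (cases "even n")
        (simp_all only: ksgn_def if_True if_False)
    have "?F (tswap R C 0 (tword R C [(i, u), (j, v), (l, w)]))
      = ksgn L (i * j) (ksgn L i (br (a v) (br (a u) (a w))))"
      using l F[OF uvw(2,1,3)] C.tswap_tword[OF l(1,2), of "[(l, w)]"] by (simp add: Fk)
    then show "?F (tword R C [(i, u), (j, v), (l, w)]) =
        ?G (tword R C [(i, u), (j, v), (l, w)])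
          \<oplus>\<^bsub>L\<^esub> \<ominus>\<^bsub>L\<^esub> ?F (tswap R C 0 (tword R C [(i, u), (j, v), (l, w)]))"
      using br_jacobi[OF auv c(3)] c
      by (simp add: F[OF uvw] G[OF uvw]) (auto simp: ksgn_def LM.minus_add LM.a_comm)
  qed
  also have "tswap R C 0 ?Z = ?Z" by (rule tswap_comult_first[OF cocomm x])
  finally have 1: "?F ?Z = ?G ?Z \<oplus>\<^bsub>L\<^esub> \<ominus>\<^bsub>L\<^esub> ?F ?Z" .
  \<comment> \<open>By coassociativity both forms are evaluated on the same tensor, so the
    antisymmetry of the cup bracket for degrees -2 and -1 gives a second relation between
    them.\<close>
  have "?G ?Z = \<ominus>\<^bsub>L\<^esub> ?F ?Z"
    using cup_anti[OF cocomm W a x] A B C.coassoc[OF x] by (simp add: ksgn_def)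
  moreover have c: "?F ?Z \<in> carrier L" by (rule rlin_closed[OF Fl Z])
  ultimately have "?F ?Z = \<ominus>\<^bsub>L\<^esub> (?F ?Z \<oplus>\<^bsub>L\<^esub> ?F ?Z)"
    using 1 by (simp add: LM.minus_add)
  then have "?F ?Z \<oplus>\<^bsub>L\<^esub> (?F ?Z \<oplus>\<^bsub>L\<^esub> ?F ?Z) = \<ominus>\<^bsub>L\<^esub> (?F ?Z \<oplus>\<^bsub>L\<^esub> ?F ?Z) \<oplus>\<^bsub>L\<^esub> (?F ?Z \<oplus>\<^bsub>L\<^esub> ?F ?Z)"
    by (rule arg_cong[where f = "\<lambda>y. y \<oplus>\<^bsub>L\<^esub> (?F ?Z \<oplus>\<^bsub>L\<^esub> ?F ?Z)"])
  also have "\<dots> = \<zero>\<^bsub>L\<^esub>" using c by (simp add: LM.l_neg)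
  finally have "?F ?Z \<oplus>\<^bsub>L\<^esub> (?F ?Z \<oplus>\<^bsub>L\<^esub> ?F ?Z) = \<zero>\<^bsub>L\<^esub>" .
  then have "?F ?Z = \<zero>\<^bsub>L\<^esub>" using c by (rule three[rotated])
  then show ?thesis using \<open>?G ?Z = \<ominus>\<^bsub>L\<^esub> ?F ?Z\<close> B by simp
qed

end

section \<open>Division by two and three\<close>

lemma rat_ring_hom:
  assumes "cring R" "\<phi> \<in> ring_hom rat_ring R"
  shows "\<phi> 1 = \<one>\<^bsub>R\<^esub>" "\<phi> q \<in> carrier R" "\<phi> (p + q) = \<phi> p \<oplus>\<^bsub>R\<^esub> \<phi> q" "\<phi> (p * q) = \<phi> p \<otimes>\<^bsub>R\<^esub> \<phi> q"
  using assms(2) by (auto simp: ring_hom_def rat_ring_def)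

lemma contains_rat_two:
  assumes R: "cring R" "contains_rat R"
  shows "\<one>\<^bsub>R\<^esub> \<oplus>\<^bsub>R\<^esub> \<one>\<^bsub>R\<^esub> \<in> Units R"
proof -
  interpret cring R by fact
  obtain \<phi> where "\<phi> \<in> ring_hom rat_ring R" using R by (auto simp: contains_rat_def)
  note h = rat_ring_hom[OF R(1) this]
  have "\<one>\<^bsub>R\<^esub> \<oplus>\<^bsub>R\<^esub> \<one>\<^bsub>R\<^esub> = \<phi> (1 + 1)" by (simp only: h)
  moreover have "\<phi> (1 + 1) \<otimes>\<^bsub>R\<^esub> \<phi> (1 / 2) = \<one>\<^bsub>R\<^esub>" by (simp add: h(4)[symmetric] h(1))
  ultimately have "(\<one>\<^bsub>R\<^esub> \<oplus>\<^bsub>R\<^esub> \<one>\<^bsub>R\<^esub>) \<otimes>\<^bsub>R\<^esub> \<phi> (1 / 2) = \<one>\<^bsub>R\<^esub>" by simp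
  then show ?thesis unfolding Units_def using h(2) m_comm[of "\<phi> (1 / 2)" "\<one>\<^bsub>R\<^esub> \<oplus>\<^bsub>R\<^esub> \<one>\<^bsub>R\<^esub>"]
    by (intro CollectI conjI bexI[of _ "\<phi> (1 / 2)"]) auto
qed

text \<open>The factor 3 is cancelled by the image of 1/3. Such a cancellation is essential for the
  bracket of an odd element with its own square, which the Jacobi identity alone does not kill in
  characteristic 3.\<close>

lemma contains_rat_three:
  assumes R: "contains_rat R" and V: "Module.module R V" and x: "x \<in> carrier V"
    and 3: "x \<oplus>\<^bsub>V\<^esub> (x \<oplus>\<^bsub>V\<^esub> x) = \<zero>\<^bsub>V\<^esub>"
  shows "x = \<zero>\<^bsub>V\<^esub>"
proof -
  interpret Module.module R V by fact
  obtain \<phi> where "\<phi> \<in> ring_hom rat_ring R" using R by (auto simp: contains_rat_def)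
  note h = rat_ring_hom[OF R.is_cring this]
  have "x = (\<phi> (1 / 3) \<otimes>\<^bsub>R\<^esub> \<phi> (1 + (1 + 1))) \<odot>\<^bsub>V\<^esub> x"
    using x by (simp add: h(4)[symmetric] h(1))
  also have "\<phi> (1 + (1 + 1)) = \<one>\<^bsub>R\<^esub> \<oplus>\<^bsub>R\<^esub> (\<one>\<^bsub>R\<^esub> \<oplus>\<^bsub>R\<^esub> \<one>\<^bsub>R\<^esub>)" by (simp only: h)
  also have "(\<phi> (1 / 3) \<otimes>\<^bsub>R\<^esub> (\<one>\<^bsub>R\<^esub> \<oplus>\<^bsub>R\<^esub> (\<one>\<^bsub>R\<^esub> \<oplus>\<^bsub>R\<^esub> \<one>\<^bsub>R\<^esub>))) \<odot>\<^bsub>V\<^esub> x = \<phi> (1 / 3) \<odot>\<^bsub>V\<^esub> (x \<oplus>\<^bsub>V\<^esub> (x \<oplus>\<^bsub>V\<^esub> x))"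
    using x h(2) by (simp add: smult_assoc1 smult_l_distr del: R.add.m_assoc)
  finally show ?thesis using 3 h(2) by simp
qed

lemma half_rlin:
  assumes "Module.module R V" "\<one>\<^bsub>R\<^esub> \<oplus>\<^bsub>R\<^esub> \<one>\<^bsub>R\<^esub> \<in> Units R"
  shows "rlin R V V (half R V)"
proof -
  interpret Module.module R V by fact
  show ?thesis using assms(2) by (simp add:
    rlin_def half_def smult_r_distr smult_assoc1[symmetric] R.m_comm)
qed

lemma half_double:
  assumes "Module.module R V" "\<one>\<^bsub>R\<^esub> \<oplus>\<^bsub>R\<^esub> \<one>\<^bsub>R\<^esub> \<in> Units R" "x \<in> carrier V"
  shows "half R V (x \<oplus>\<^bsub>V\<^esub> x) = x"
proof -
  interpret Module.module R V by fact
  have "half R V (x \<oplus>\<^bsub>V\<^esub> x) = half R V ((\<one>\<^bsub>R\<^esub> \<oplus>\<^bsub>R\<^esub> \<one>\<^bsub>R\<^esub>) \<odot>\<^bsub>V\<^esub> x)"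
    using assms(3) by (simp add: smult_l_distr)
  then show ?thesis using assms(2,3) by (simp add: half_def smult_assoc1[symmetric] R.Units_l_inv)
qed

section \<open>Double sums\<close>

lemma (in abelian_monoid) finsum_product:
  assumes "finite I" "finite J" "\<And>i j. i \<in> I \<Longrightarrow> j \<in> J \<Longrightarrow> c i j \<in> carrier G"
  shows "(\<Oplus>i\<in>I. \<Oplus>j\<in>J. c i j) = (\<Oplus>p\<in>I \<times> J. c (fst p) (snd p))"
  using assms(1,3)
proof (induction I rule: finite_induct)
  case (insert i I)
  have e: "insert i I \<times> J = Pair i ` J \<union> I \<times> J" by auto
  have "(\<Oplus>p\<in>insert i I \<times> J. c (fst p) (snd p)) = (\<Oplus>p\<in>Pair i ` J. c (fst p) (snd p))
    \<oplus> (\<Oplus>p\<in>I \<times> J. c (fst p) (snd p))"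
    unfolding e using insert assms(2) by (intro finsum_Un_disjoint) auto
  also have "(\<Oplus>p\<in>Pair i ` J. c (fst p) (snd p)) = (\<Oplus>j\<in>J. c i j)"
    using insert.prems by (subst finsum_reindex) (auto simp: inj_on_def)
  finally show ?case using insert by (simp add: Pi_iff)
qed simp

lemma (in abelian_monoid) finsum_antidiagonals:
  fixes c :: "nat \<Rightarrow> nat \<Rightarrow> 'a"
  assumes "\<And>i j. c i j \<in> carrier G"
  shows "(\<Oplus>n\<in>{2..<B}. \<Oplus>i\<in>{1..<n}. c i (n - i))
    = (\<Oplus>p\<in>{(i, j). 1 \<le> i \<and> 1 \<le> j \<and> i + j < B}. c (fst p) (snd p))"
proof (induction B)
  case 0
  have "{(i, j). 1 \<le> i \<and> 1 \<le> j \<and> i + j < (0::nat)} = {}" by auto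
  then show ?case by simp
next
  case (Suc B)
  let ?P = "\<lambda>B. {(i, j). 1 \<le> i \<and> 1 \<le> j \<and> i + j < (B::nat)}" and ?A = "(\<lambda>i. (i, B - i)) ` {1..<B}"
  \<comment> \<open>Passing from \<open>B\<close> to \<open>Suc B\<close> adds exactly the line
    \<open>i + j = B\<close>. For \<open>B\<close> below 2 this line is empty, and so is every range
    involved.\<close>
  have e: "?P (Suc B) = ?A \<union> ?P B" by (auto simp: image_iff)
  have fin: "finite (?P B)" by (rule finite_subset[of _ "{..B} \<times> {..B}"]) auto
  have "(\<Oplus>p\<in>?P (Suc B). c (fst p) (snd p)) = (\<Oplus>p\<in>?A. c (fst p) (snd p)) \<oplus> (\<Oplus>p\<in>?P B. c (fst p) (snd p))"
    unfolding e using fin assms by (intro finsum_Un_disjoint) auto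
  also have "(\<Oplus>p\<in>?A. c (fst p) (snd p)) = (\<Oplus>i\<in>{1..<B}. c i (B - i))"
    using assms by (subst finsum_reindex) (auto simp: inj_on_def)
  finally have 1: "(\<Oplus>p\<in>?P (Suc B). c (fst p) (snd p)) = (\<Oplus>i\<in>{1..<B}. c i (B - i))
    \<oplus> (\<Oplus>n\<in>{2..<B}. \<Oplus>i\<in>{1..<n}. c i (n - i))"
    using Suc.IH by simp
  show ?case
  proof (cases "2 \<le> B")
    case True
    then have "{2..<Suc B} = insert B {2..<B}" by auto
    then show ?thesis unfolding 1 using assms by simp
  next
    case False
    then have "{1..<B} = {}" "{2..<Suc B} = {}" "{2..<B} = {}" by auto
    then show ?thesis unfolding 1 by simp
  qed
qed

section \<open>Naturality of the cup bracket\<close>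

lemma (in graded_mod) multilinear_tmap:
  assumes W: "graded_module R W" and f: "f \<in> gmor R V W 0"
  shows "multilinear R V (tens R W) (\<lambda>w. tword R W (map (\<lambda>(i, x). (i, f x)) w))"
proof -
  interpret W: graded_mod R W by (rule graded_mod.intro[OF W])
  have g: "f x \<in> grade W i" if "x \<in> grade V i" for i x using gmor_grade[OF f that] by simp
  have l: "map (\<lambda>(i, x). (i, f x)) w \<in> lists (letters W)" if "w \<in> lists (letters V)" for w
    using that g by (induction w) (auto simp: letters_def)
  note c = grade_carrier[OF graded]
  show ?thesis
    using l g c by (intro multilinearI)
      (simp_all add: rlin_add[OF gmor_rlin[OF f]] rlin_smult[OF gmor_rlin[OF f]]
        grade_linear_def grade_linear_add[OF multilinearD[OF W.multilinear_tword]]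
        grade_linear_smult[OF multilinearD[OF W.multilinear_tword]])
qed

text \<open>A map compatible with the diagonals acts on a pair of letters by acting on each letter;
  being of degree 0 it preserves their degrees and hence the Koszul sign.\<close>

lemma cup_natural:
  assumes "cup_setting R C L dL" "cup_setting R E L dL"
    and f: "f \<in> gmor R C E 0" and comult: "\<And>x. x \<in> carrier C \<Longrightarrow> comult E (f x) = tmap R E f (comult C x)"
    and a: "rlin R E L a" and b: "rlin R E L b" and x: "x \<in> carrier C"
  shows "cup_bracket R E L q a b (f x) = cup_bracket R C L q (\<lambda>x. a (f x)) (\<lambda>x. b (f x)) x"
proof -
  interpret C: cup_setting R C L dL by fact
  interpret E: cup_setting R E L dL by fact
  note af = rlin_comp[OF a gmor_rlin[OF f]] and bf = rlin_comp[OF b gmor_rlin[OF f]]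
  note m = C.C.multilinear_tmap[OF E.C.graded f]
  let ?l = "\<lambda>A. E.cup_lin q a b (tmap R E f A)" and ?r = "C.cup_lin q (\<lambda>x. a (f x)) (\<lambda>x. b (f x))"
  have tl: "rlin R (tens R C) (tens R E) (tmap R E f)"
    unfolding tmap_def by (rule C.C.tlift_rlin[OF E.C.T_module m])
  note r = rlin_comp[OF E.cup_form_rlin[OF a b] tl]
  have "?l (comult C x) = ?r (comult C x)"
  proof (rule C.C.comult_eqI[OF C.LM.module_axioms r C.cup_form_rlin[OF af bf] x])
    fix i j u v assume uv: "u \<in> grade C i" "v \<in> grade C j"
    let ?w = "tword R C [(i, u), (j, v)]"
    have fuv: "f u \<in> grade E i" "f v \<in> grade E j" using gmor_grade[OF f uv(1)] gmor_grade[OF f uv(2)]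
      by simp_all
    have "tmap R E f ?w = tword R E [(i, f u), (j, f v)]"
      unfolding tmap_def using uv by (subst C.C.tlift_tword[OF E.C.T_module m])
        (simp_all add: C.C.letterI)
    then show "?l ?w = ?r ?w"
      using uv fuv by (simp add: E.cup_form_pair[OF a b] C.cup_form_pair[OF af bf])
  qed
  then show ?thesis using x by (simp add: E.cup_eq C.cup_eq comult)
qed

section \<open>Linearity and vanishing of the cup bracket\<close>

context cup_setting
begin

text \<open>Serves to split D theta as its defect plus one half of [theta, theta] inside the bracket
  with theta.\<close>

lemma cup_linear_left:
  assumes "rlin R C L a" "rlin R C L b" "rlin R C L c" "rlin R C L e" and r: "r \<in> carrier R"
    and eq: "\<And>y. y \<in> carrier C \<Longrightarrow> a y = b y \<oplus>\<^bsub>L\<^esub> r \<odot>\<^bsub>L\<^esub> c y" and x: "x \<in> carrier C"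
  shows "cup_bracket R C L q a e x = cup_bracket R C L q b e x \<oplus>\<^bsub>L\<^esub> r \<odot>\<^bsub>L\<^esub> cup_bracket R C L q c e x"
  unfolding cup_eq
proof (rule C.comult_eqI[OF LM.module_axioms _ _ x])
  have s: "rlin R L L (\<lambda>y. r \<odot>\<^bsub>L\<^esub> y)"
    using r by (simp add: rlin_def LM.smult_r_distr LM.smult_assoc1[symmetric] C.R.m_comm)
  show "rlin R T L (cup_lin q a e)" by (intro cup_form_rlin assms)
  show "rlin R T L (\<lambda>A. cup_lin q b e A \<oplus>\<^bsub>L\<^esub> r \<odot>\<^bsub>L\<^esub> cup_lin q c e A)"
    by (intro rlin_plus rlin_comp[OF s] cup_form_rlin assms LM.module_axioms)
  fix i j u v assume uv: "u \<in> grade C i" "v \<in> grade C j"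
  have "b u \<in> carrier L" "c u \<in> carrier L" "e v \<in> carrier L" using assms(2-4) uv by (auto intro:
    rlin_closed C_carrier)
  then show "cup_lin q a e (tword R C [(i, u), (j, v)]) = cup_lin q b e (tword R C [(i, u), (j, v)])
      \<oplus>\<^bsub>L\<^esub> r \<odot>\<^bsub>L\<^esub> cup_lin q c e (tword R C [(i, u), (j, v)])"
    using uv r by (simp add: cup_form_pair[OF assms(1,4)] cup_form_pair[OF assms(2,4)] cup_form_pair[OF
      assms(3,4)]
       eq[OF C_carrier] br_add br_smult LM.ksgn_add LM.ksgn_smult)
qed

text \<open>Only pairs of complementary degree occur in the diagonal, so it suffices that for each
  of them one of the two values vanishes for reasons of degree.\<close>

lemma cup_zero:
  assumes a: "rlin R C L a" "rlin R C L b" and x: "x \<in> grade C d"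
    and eq: "\<And>i j u v. \<lbrakk>u \<in> grade C i; v \<in> grade C j; i + j = d\<rbrakk> \<Longrightarrow> br (a u) (b v) = \<zero>\<^bsub>L\<^esub>"
  shows "cup_bracket R C L q a b x = \<zero>\<^bsub>L\<^esub>"
  unfolding cup_eq
  by (rule C.comult_ext[OF LM.module_axioms cup_form_rlin[OF a] rlin_const_zero[OF LM.module_axioms] x])
     (simp add: cup_form_pair[OF a] eq)

end

section \<open>The recursive construction\<close>

lemma theta_0: "theta R C L t1 H 0 = (\<lambda>x. \<zero>\<^bsub>L\<^esub>)"
  and theta_1: "theta R C L t1 H (Suc 0) = t1"
  and theta_ge_2: "2 \<le> n \<Longrightarrow> theta R C L t1 H n = (\<lambda>x. half R L (\<Oplus>\<^bsub>L\<^esub> i \<in> {1..<n}.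
             cup_bracket R C L (-1) (theta R C L t1 H i) (theta R C L t1 H (n - i)) (H x)))"
  by (subst theta.simps, simp)+

text \<open>The sign \<open>s\<close> is the common sign of the degrees in which \<open>L\<close>
  may be nonzero; with it, positive and negative degrees need no separate treatment. The start
  \<open>t1\<close> stands for the universal twisting cochain after the projection.\<close>

locale lie_recursion = E: cup_setting R E L dL
  for R :: "'r ring" (structure) and E :: "('r, 'e, 'z) coalg_scheme"
    and L :: "('r, 'a, 'y) glie_scheme" and dL +
  fixes t1 :: "'e \<Rightarrow> 'a" and H :: "'e \<Rightarrow> 'e" and s :: int
  assumes two: "\<one> \<oplus> \<one> \<in> Units R"
    and t1: "t1 \<in> gmor R E L (-1)" and H: "H \<in> gmor R E E 1"
    and s: "s = 1 \<or> s = -1"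
    and conc: "\<And>i. s * i \<le> 0 \<Longrightarrow> grade L i = {\<zero>\<^bsub>L\<^esub>}"
begin

abbreviation "cupL \<equiv> cup_bracket R E L"
abbreviation "th \<equiv> theta R E L t1 H"
abbreviation "Th \<equiv> theta_sum R E L t1 H"

lemmas modL = E.LM.module_axioms
lemmas halfl = half_rlin[OF modL two]

lemma half_grade: "x \<in> grade L i \<Longrightarrow> half R L x \<in> grade L i"
  using two by (simp add: half_def grade_smult[OF E.L_graded])

text \<open>A bracket of two terms has degree -2, and \<open>H\<close> raises it back to -1.\<close>

lemma th_gmor: "th n \<in> gmor R E L (-1)"
proof (induction n rule: less_induct)
  case (less n)
  consider "n = 0" | "n = 1" | "2 \<le> n" by linarith
  then show ?case
  proof cases
    case 1
    then show ?thesis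
      by (intro gmorI) (simp_all add: theta_0 rlin_const_zero[OF modL] grade_zero[OF E.L_graded])
  next
    case 2
    then show ?thesis using t1 by (simp add: theta_1)
  next
    case 3
    have c: "cupL (-1) (th i) (th (n - i)) \<in> gmor R E L (-1 + -1)" if "i \<in> {1..<n}" for i
      using that by (intro E.cup_gmor less.IH) auto
    show ?thesis unfolding theta_ge_2[OF 3]
    proof (rule gmorI)
      show "rlin R E L (\<lambda>x. half R L (\<Oplus>\<^bsub>L\<^esub> i \<in> {1..<n}. cupL (-1) (th i) (th (n - i)) (H x)))"
        by (intro rlin_comp[OF halfl] rlin_finsum[OF E.C.VM.module_axioms modL]
          rlin_comp[OF gmor_rlin[OF c] gmor_rlin[OF H]])
      fix k x assume "x \<in> grade E k"
      then have "H x \<in> grade E (k + 1)" by (rule gmor_grade[OF H])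
      then have "cupL (-1) (th i) (th (n - i)) (H x) \<in> grade L (k + -1)" if "i \<in> {1..<n}" for i
        using gmor_grade[OF c[OF that], of "H x" "k + 1"] by simp
      then show "half R L (\<Oplus>\<^bsub>L\<^esub> i \<in> {1..<n}. cupL (-1) (th i) (th (n - i)) (H x)) \<in> grade L (k + -1)"
        by (intro half_grade grade_finsum[OF E.L_graded])
    qed
  qed
qed

lemmas thl = gmor_rlin[OF th_gmor]

lemma th_closed [simp]: "x \<in> carrier E \<Longrightarrow> th n x \<in> carrier L"
  by (rule rlin_closed[OF thl])

text \<open>Every bracket raises the lower bound on \<open>s\<close> times the degree of its value by one.\<close>

lemma th_vanish: "x \<in> grade E k \<Longrightarrow> s * (k - 1) < int n \<Longrightarrow> th n x = \<zero>\<^bsub>L\<^esub>"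
proof (induction n arbitrary: x k rule: less_induct)
  case (less n)
  consider "n = 0" | "n = 1" | "2 \<le> n" by linarith
  then show ?case
  proof cases
    case 1
    then show ?thesis by (simp add: theta_0)
  next
    case 2
    have "th n x \<in> grade L (k - 1)" using gmor_grade[OF th_gmor less.prems(1)] by simp
    then show ?thesis using less.prems(2) 2 conc[of "k - 1"] by auto
  next
    case 3
    have "cupL (-1) (th i) (th (n - i)) (H x) = \<zero>\<^bsub>L\<^esub>" if i: "i \<in> {1..<n}" for i
    proof (rule E.cup_zero[OF thl thl gmor_grade[OF H less.prems(1)]])
      fix p q u v assume uv: "u \<in> grade E p" "v \<in> grade E q" "p + q = k + 1"
      \<comment> \<open>As \<open>H\<close> raises the degree by one, \<open>s * (k - 1)\<close> is
        exactly the sum of the corresponding numbers for \<open>u\<close> and \<open>v\<close>. If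
        it is below \<open>n = i + (n - i)\<close>, then one of them is below its own index, and
        induction applies to that factor.\<close>
      have k: "k = p + q - 1" using uv(3) by simp
      have "s * (k - 1) = s * (p - 1) + s * (q - 1)" unfolding k by (simp add: algebra_simps)
      then have "s * (p - 1) + s * (q - 1) < int n" using less.prems(2) by simp
      moreover have "int n = int i + int (n - i)" using i by simp
      ultimately consider "s * (p - 1) < int i" | "s * (q - 1) < int (n - i)" by linarith
      then show "E.br (th i u) (th (n - i) v) = \<zero>\<^bsub>L\<^esub>"
      proof cases
        case 1
        then have "th i u = \<zero>\<^bsub>L\<^esub>" using i uv by (intro less.IH) auto
        then show ?thesis using E.C_carrier[OF uv(2)] by simp
      next
        case 2
        then have "th (n - i) v = \<zero>\<^bsub>L\<^esub>" using i uv by (intro less.IH) auto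
        then show ?thesis using E.C_carrier[OF uv(1)] by simp
      qed
    qed
    then have "(\<Oplus>\<^bsub>L\<^esub> i \<in> {1..<n}. cupL (-1) (th i) (th (n - i)) (H x)) = \<zero>\<^bsub>L\<^esub>"
      by (intro E.LM.add.finprod_one_eqI)
    then show ?thesis unfolding theta_ge_2[OF 3] by (simp add: rlin_zero[OF modL modL halfl])
  qed
qed

lemma th_bounded:
  assumes "x \<in> carrier E" shows "\<exists>B. \<forall>n\<ge>B. th n x = \<zero>\<^bsub>L\<^esub>"
  using E.C.graded assms
proof (induction x rule: graded_induct)
  case zero
  then show ?case by (simp add: rlin_zero[OF E.C.VM.module_axioms modL thl])
next
  case (add x y)
  then obtain B B' where "\<forall>n\<ge>B. th n x = \<zero>\<^bsub>L\<^esub>" "\<forall>n\<ge>B'. th n y = \<zero>\<^bsub>L\<^esub>" by blast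
  then show ?case using add(1,2) by (intro exI[of _ "max B B'"]) (simp add: rlin_add[OF thl])
next
  case (homogeneous k x)
  then show ?case using th_vanish[OF homogeneous]
    by (intro exI[of _ "nat (s * (k - 1)) + 1"]) auto
qed

lemma th_finite:
  assumes "x \<in> carrier E" shows "finite {n. th n x \<noteq> \<zero>\<^bsub>L\<^esub>}"
proof -
  obtain B where "\<forall>n\<ge>B. th n x = \<zero>\<^bsub>L\<^esub>" using th_bounded[OF assms] by blast
  then have "{n. th n x \<noteq> \<zero>\<^bsub>L\<^esub>} \<subseteq> {..<B}" by (auto simp: not_le[symmetric])
  then show ?thesis by (rule finite_subset) simp
qed

lemma Th_eq:
  assumes x: "x \<in> carrier E" and B: "\<And>n. B \<le> n \<Longrightarrow> th n x = \<zero>\<^bsub>L\<^esub>"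
  shows "Th x = (\<Oplus>\<^bsub>L\<^esub> n \<in> {1..<B}. th n x)"
  unfolding theta_sum_def
proof (rule E.LM.finsum_mono_neutral_left)
  have "n \<noteq> 0 \<and> \<not> B \<le> n" if "th n x \<noteq> \<zero>\<^bsub>L\<^esub>" for n using that B by (auto simp: theta_0 intro: ccontr)
  then show "{n. th n x \<noteq> \<zero>\<^bsub>L\<^esub>} \<subseteq> {1..<B}" by (auto simp: not_le Suc_le_eq)
qed (use x in auto)

lemma Th_gmor: "Th \<in> gmor R E L (-1)"
proof (rule gmorI)
  show "rlin R E L Th"
    unfolding rlin_def
  proof (intro conjI ballI)
    fix x assume x: "x \<in> carrier E"
    show "Th x \<in> carrier L" unfolding theta_sum_def using x by (intro E.LM.finsum_closed) auto
    obtain B where B: "\<And>n. B \<le> n \<Longrightarrow> th n x = \<zero>\<^bsub>L\<^esub>" using th_bounded[OF x] by blast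
    show "Th (r \<odot>\<^bsub>E\<^esub> x) = r \<odot>\<^bsub>L\<^esub> Th x" if r: "r \<in> carrier R" for r
    proof -
      have "Th (r \<odot>\<^bsub>E\<^esub> x) = (\<Oplus>\<^bsub>L\<^esub> n \<in> {1..<B}. th n (r \<odot>\<^bsub>E\<^esub> x))"
        using x r B by (intro Th_eq) (auto simp: rlin_smult[OF thl])
      also have "\<dots> = (\<Oplus>\<^bsub>L\<^esub> n \<in> {1..<B}. r \<odot>\<^bsub>L\<^esub> th n x)"
        using x r by (simp add: rlin_smult[OF thl])
      also have "\<dots> = r \<odot>\<^bsub>L\<^esub> (\<Oplus>\<^bsub>L\<^esub> n \<in> {1..<B}. th n x)"
        using x r by (intro E.LM.finsum_smult_ldistr[symmetric]) auto
      finally show ?thesis using Th_eq[OF x B] by simp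
    qed
    fix y assume y: "y \<in> carrier E"
    obtain B' where B': "\<And>n. B' \<le> n \<Longrightarrow> th n y = \<zero>\<^bsub>L\<^esub>" using th_bounded[OF y] by blast
    let ?N = "max B B'"
    have "Th (x \<oplus>\<^bsub>E\<^esub> y) = (\<Oplus>\<^bsub>L\<^esub> n \<in> {1..<?N}. th n (x \<oplus>\<^bsub>E\<^esub> y))"
      using x y B B' by (intro Th_eq) (auto simp: rlin_add[OF thl])
    also have "\<dots> = (\<Oplus>\<^bsub>L\<^esub> n \<in> {1..<?N}. th n x \<oplus>\<^bsub>L\<^esub> th n y)"
      using x y by (simp add: rlin_add[OF thl])
    also have "\<dots> = (\<Oplus>\<^bsub>L\<^esub> n \<in> {1..<?N}. th n x) \<oplus>\<^bsub>L\<^esub> (\<Oplus>\<^bsub>L\<^esub> n \<in> {1..<?N}. th n y)"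
      using x y by (intro E.LM.finsum_addf) auto
    also have "\<dots> = Th x \<oplus>\<^bsub>L\<^esub> Th y"
      using x y B B' by (simp add: Th_eq[of x ?N] Th_eq[of y ?N])
    finally show "Th (x \<oplus>\<^bsub>E\<^esub> y) = Th x \<oplus>\<^bsub>L\<^esub> Th y" .
  qed
  show "Th x \<in> grade L (k + -1)" if "x \<in> grade E k" for k x
    unfolding theta_sum_def using that by (intro grade_finsum[OF E.L_graded] gmor_grade[OF th_gmor])
qed

lemmas Thl = gmor_rlin[OF Th_gmor]

lemma br_finsum:
  assumes "finite I" "\<And>i. i \<in> I \<Longrightarrow> f i \<in> carrier L" "y \<in> carrier L"
  shows "E.br (\<Oplus>\<^bsub>L\<^esub> i \<in> I. f i) y = (\<Oplus>\<^bsub>L\<^esub> i \<in> I. E.br (f i) y)"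
    "E.br y (\<Oplus>\<^bsub>L\<^esub> i \<in> I. f i) = (\<Oplus>\<^bsub>L\<^esub> i \<in> I. E.br y (f i))"
  using assms
  by (induction I rule: finite_induct) (simp_all add: Pi_iff E.br_add)

text \<open>Unlike the bounds from \<open>th_bounded\<close>, which depend on the elements,
  \<open>B\<close> depends only on the total degree \<open>p + q\<close>. A single truncation is
  therefore valid on all pure tensors occurring in a diagonal, as \<open>cup_Th\<close>
  requires.\<close>

lemma br_Th:
  assumes uv: "u \<in> grade E p" "v \<in> grade E q" and B: "s * (p + q - 2) < int B"
  shows "E.br (Th u) (Th v) = (\<Oplus>\<^bsub>L\<^esub> n \<in> {2..<B}. \<Oplus>\<^bsub>L\<^esub> i \<in> {1..<n}. E.br (th i u) (th (n - i) v))"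
proof -
  have c: "u \<in> carrier E" "v \<in> carrier E" using uv by (auto intro: E.C_carrier)
  obtain B1 where B1: "\<And>n. B1 \<le> n \<Longrightarrow> th n u = \<zero>\<^bsub>L\<^esub>" using th_bounded[OF c(1)] by blast
  obtain B2 where B2: "\<And>n. B2 \<le> n \<Longrightarrow> th n v = \<zero>\<^bsub>L\<^esub>" using th_bounded[OF c(2)] by blast
  \<comment> \<open>Large enough for both sums to be complete, and for the square of index pairs to
    contain the triangle \<open>?P\<close>.\<close>
  define N where "N = max B (max B1 B2)"
  let ?I = "{1..<N}" and ?P = "{(i, j). 1 \<le> i \<and> 1 \<le> j \<and> i + j < B}"
  have Thu: "Th u = (\<Oplus>\<^bsub>L\<^esub> i \<in> ?I. th i u)" and Thv: "Th v = (\<Oplus>\<^bsub>L\<^esub> i \<in> ?I. th i v)"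
    using B1 B2 by (intro Th_eq c, simp add: N_def)+
  have "E.br (Th u) (Th v) = (\<Oplus>\<^bsub>L\<^esub> i \<in> ?I. \<Oplus>\<^bsub>L\<^esub> j \<in> ?I. E.br (th i u) (th j v))"
    unfolding Thu Thv using c by (subst br_finsum(1)) (simp_all add: br_finsum(2) E.LM.finsum_closed)
  also have "\<dots> = (\<Oplus>\<^bsub>L\<^esub> p \<in> ?I \<times> ?I. E.br (th (fst p) u) (th (snd p) v))"
    using c by (intro E.LM.finsum_product) auto
  also have "\<dots> = (\<Oplus>\<^bsub>L\<^esub> p \<in> ?P. E.br (th (fst p) u) (th (snd p) v))"
  proof (rule E.LM.finsum_mono_neutral_left[symmetric])
    show "?P \<subseteq> ?I \<times> ?I" by (auto simp: N_def)
    fix r assume r': "r \<in> ?I \<times> ?I - ?P"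
    obtain i j where ij: "r = (i, j)" by (cases r)
    then have r: "r = (i, j)" "B \<le> i + j" using r' by (auto simp: not_less)
    have "s * (p + q - 2) = s * (p - 1) + s * (q - 1)" by (simp add: algebra_simps)
    \<comment> \<open>Outside the triangle \<open>i + j\<close> is at least \<open>B\<close>, which
      exceeds the sum of the two left-hand sides, so they cannot both reach their indices.\<close>
    then have "s * (p - 1) < int i \<or> s * (q - 1) < int j" using B r(2) by linarith
    then show "E.br (th (fst r) u) (th (snd r) v) = \<zero>\<^bsub>L\<^esub>"
      using th_vanish[OF uv(1)] th_vanish[OF uv(2)] c r(1) by auto
  qed (use c in auto)
  also have "\<dots> = (\<Oplus>\<^bsub>L\<^esub> n \<in> {2..<B}. \<Oplus>\<^bsub>L\<^esub> i \<in> {1..<n}. E.br (th i u) (th (n - i) v))"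
    using c by (intro E.LM.finsum_antidiagonals[symmetric]) auto
  finally show ?thesis .
qed

lemma ksgn_finsum:
  assumes "finite I" "\<And>i. i \<in> I \<Longrightarrow> f i \<in> carrier L"
  shows "ksgn L k (\<Oplus>\<^bsub>L\<^esub> i \<in> I. f i) = (\<Oplus>\<^bsub>L\<^esub> i \<in> I. ksgn L k (f i))"
  using assms by (induction I rule: finite_induct) (simp_all add: Pi_iff E.LM.ksgn_add)

lemma half_finsum:
  assumes "finite I" "\<And>i. i \<in> I \<Longrightarrow> f i \<in> carrier L"
  shows "half R L (\<Oplus>\<^bsub>L\<^esub> i \<in> I. f i) = (\<Oplus>\<^bsub>L\<^esub> i \<in> I. half R L (f i))"
  using assms
  by (induction I rule: finite_induct)
     (simp_all add: Pi_iff rlin_add[OF halfl] rlin_closed[OF halfl] rlin_zero[OF modL modL halfl])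

lemma cup_Th:
  assumes y: "y \<in> grade E k" and B: "s * (k - 2) < int B"
  shows "cupL (-1) Th Th y = (\<Oplus>\<^bsub>L\<^esub> n \<in> {2..<B}. \<Oplus>\<^bsub>L\<^esub> i \<in> {1..<n}. cupL (-1) (th i) (th (n - i)) y)"
  unfolding E.cup_eq
proof (rule E.C.comult_ext[OF modL E.cup_form_rlin[OF Thl Thl] _ y])
  show "rlin R (tens R E) L (\<lambda>A. \<Oplus>\<^bsub>L\<^esub> n \<in> {2..<B}. \<Oplus>\<^bsub>L\<^esub> i \<in> {1..<n}. E.cup_lin (-1) (th i) (th (n - i)) A)"
    by (intro rlin_finsum[OF E.C.T_module modL] E.cup_form_rlin thl)
  fix p q u v assume uv: "u \<in> grade E p" "v \<in> grade E q" "p + q = k"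
  have c: "u \<in> carrier E" "v \<in> carrier E" using uv by (auto intro: E.C_carrier)
  have "E.cup_lin (-1) Th Th (tword R E [(p, u), (q, v)]) = ksgn L (-1 * p) (E.br (Th u) (Th v))"
    using uv by (simp add: E.cup_form_pair[OF Thl Thl])
  also have "E.br (Th u) (Th v) = (\<Oplus>\<^bsub>L\<^esub> n \<in> {2..<B}. \<Oplus>\<^bsub>L\<^esub> i \<in> {1..<n}. E.br (th i u) (th (n - i) v))"
    using uv B by (intro br_Th) auto
  also have "ksgn L (-1 * p) \<dots>
    = (\<Oplus>\<^bsub>L\<^esub> n \<in> {2..<B}. \<Oplus>\<^bsub>L\<^esub> i \<in> {1..<n}. ksgn L (-1 * p) (E.br (th i u) (th (n - i) v)))"
    using c by (simp add: ksgn_finsum E.LM.finsum_closed)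
  also have "\<dots> = (\<Oplus>\<^bsub>L\<^esub> n \<in> {2..<B}. \<Oplus>\<^bsub>L\<^esub> i \<in> {1..<n}. E.cup_lin (-1) (th i) (th (n - i)) (tword R E [(p,
    u), (q, v)]))"
    using uv by (simp add: E.cup_form_pair[OF thl thl])
  finally show "E.cup_lin (-1) Th Th (tword R E [(p, u), (q, v)]) =
    (\<Oplus>\<^bsub>L\<^esub> n \<in> {2..<B}. \<Oplus>\<^bsub>L\<^esub> i \<in> {1..<n}. E.cup_lin (-1) (th i) (th (n - i)) (tword R E [(p, u), (q, v)]))" .
qed

lemma Th_fixed_point:
  assumes x: "x \<in> carrier E"
  shows "Th x = t1 x \<oplus>\<^bsub>L\<^esub> half R L (cupL (-1) Th Th (H x))"
proof (rule rlin_eq_on_grades[OF E.C.graded modL Thl _ _ x])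
  show "rlin R E L (\<lambda>x. t1 x \<oplus>\<^bsub>L\<^esub> half R L (cupL (-1) Th Th (H x)))"
    by (intro rlin_plus modL gmor_rlin[OF t1] rlin_comp[OF halfl]
      rlin_comp[OF E.cup_rlin[OF Thl Thl] gmor_rlin[OF H]])
  fix k x assume x: "x \<in> grade E k"
  note xc = E.C_carrier[OF x] and Hx = gmor_grade[OF H x]
  note Hc = E.C_carrier[OF Hx]
  \<comment> \<open>The same bound serves the terms at \<open>x\<close> and the bracket at
    \<open>H x\<close>, because \<open>H x\<close> has degree \<open>k + 1\<close> and
    \<open>cup_Th\<close> asks for \<open>s * (k + 1 - 2) < int B\<close>. The summand 2 also
    ensures that the index 1 lies in the range.\<close>
  define B where "B = nat (s * (k - 1)) + 2"
  have B: "s * (k - 1) < int B" "2 \<le> B" by (auto simp: B_def)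
  have cc: "cupL (-1) (th i) (th j) (H x) \<in> carrier L" for i j
    by (rule rlin_closed[OF E.cup_rlin[OF thl thl] Hc])
  have "Th x = (\<Oplus>\<^bsub>L\<^esub> n \<in> {1..<B}. th n x)"
    using th_vanish[OF x] B by (intro Th_eq xc) auto
  also have "{1..<B} = insert 1 {2..<B}" using B(2) by auto
  also have "(\<Oplus>\<^bsub>L\<^esub> n \<in> insert 1 {2..<B}. th n x) = t1 x \<oplus>\<^bsub>L\<^esub> (\<Oplus>\<^bsub>L\<^esub> n \<in> {2..<B}. th n x)"
    using xc rlin_closed[OF gmor_rlin[OF t1] xc] by (subst E.LM.finsum_insert) (auto simp: theta_1)
  also have "(\<Oplus>\<^bsub>L\<^esub> n \<in> {2..<B}. th n x)
    = (\<Oplus>\<^bsub>L\<^esub> n \<in> {2..<B}. half R L (\<Oplus>\<^bsub>L\<^esub> i \<in> {1..<n}. cupL (-1) (th i) (th (n - i)) (H x)))"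
    using cc by (intro E.LM.finsum_cong') (auto simp: theta_ge_2 intro!:
      rlin_closed[OF halfl] E.LM.finsum_closed)
  also have "\<dots> = half R L (\<Oplus>\<^bsub>L\<^esub> n \<in> {2..<B}. \<Oplus>\<^bsub>L\<^esub> i \<in> {1..<n}. cupL (-1) (th i) (th (n - i)) (H x))"
    using cc by (intro half_finsum[symmetric]) (auto intro!: E.LM.finsum_closed)
  also have "(\<Oplus>\<^bsub>L\<^esub> n \<in> {2..<B}. \<Oplus>\<^bsub>L\<^esub> i \<in> {1..<n}. cupL (-1) (th i) (th (n - i)) (H x))
    = cupL (-1) Th Th (H x)"
    using B by (intro cup_Th[OF Hx, symmetric]) simp
  finally show "Th x = t1 x \<oplus>\<^bsub>L\<^esub> half R L (cupL (-1) Th Th (H x))" .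
qed

end

context graded_coalg
begin

lemma coaug_one: "coaug C \<one> \<in> carrier C"
proof -
  have "coaug C \<one> \<in> grade C 0" using coalg unfolding coaug_graded_coalgebra_def by (elim conjE)
  then show ?thesis by (rule grade_carrier[OF graded])
qed

lemma coaug_eq: "r \<in> carrier R \<Longrightarrow> coaug C r = r \<odot>\<^bsub>C\<^esub> coaug C \<one>"
proof -
  have "\<forall>r\<in>carrier R. coaug C r = r \<odot>\<^bsub>C\<^esub> coaug C \<one>"
    using coalg unfolding coaug_graded_coalgebra_def by (elim conjE)
  then show "r \<in> carrier R \<Longrightarrow> coaug C r = r \<odot>\<^bsub>C\<^esub> coaug C \<one>" by (rule bspec)
qed

lemma coaug_closed: "r \<in> carrier R \<Longrightarrow> coaug C r \<in> carrier C"
  using VM.smult_closed[OF _ coaug_one, of r] coaug_eq[of r] by argo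

end

text \<open>The symmetric coalgebras are replaced by arbitrary ones: \<open>C\<close> and
  \<open>E\<close> stand for the source and target of the adjoint \<open>tb\<close>. Connectedness
  enters through the concentration \<open>conc\<close> of the Lie algebra.\<close>

locale twisted_contraction =
  fixes R :: "'r ring" (structure)
    and C :: "('r, 'c, 'x) coalg_scheme" and dC
    and E :: "('r, 'e, 'z) coalg_scheme" and dE
    and L :: "('r, 'a, 'y) glie_scheme" and dL
    and tb :: "'c \<Rightarrow> 'e" and Prj :: "'e \<Rightarrow> 'c" and H :: "'e \<Rightarrow> 'e" and t :: "'c \<Rightarrow> 'a" and s :: int
  assumes rat: "contains_rat R"
    and hom: "dg_cocomm_coalgebra_hom R C dC E dE tb"
    and contr: "contraction R C dC E dE tb Prj H"
    and tw: "lie_twisting_cochain R C dC L dL t"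
    and sgn: "s = 1 \<or> s = -1"
    and conc: "\<And>i. s * i \<le> 0 \<Longrightarrow> grade L i = {\<zero>\<^bsub>L\<^esub>}"
begin

lemma coalg_C: "coaug_graded_coalgebra R C" and coalg_E: "coaug_graded_coalgebra R E"
  and cocomm_E: "cocommutative R E" and coder_E: "coderivation R E (-1) dE"
  and tb_hom: "tb \<in> gmor R C E 0" "\<And>x. x \<in> carrier C \<Longrightarrow> comult E (tb x) = tmap R E tb (comult C x)"
    "\<And>r. r \<in> carrier R \<Longrightarrow> tb (coaug C r) = coaug E r"
  and E_coalg: "coaug_dg_cocomm_coalgebra R E dE"
  using hom by (simp_all add: dg_cocomm_coalgebra_hom_def coaug_dg_cocomm_coalgebra_def
    coaug_dg_coalgebra_def chain_map_def)

lemma lie_L: "dg_lie_algebra R L dL" and t_gmor: "t \<in> gmor R C L (-1)"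
  and t_coaug: "\<And>r. r \<in> carrier R \<Longrightarrow> t (coaug C r) = \<zero>\<^bsub>L\<^esub>"
  and t_tw: "\<And>x. x \<in> carrier C \<Longrightarrow> hom_diff L dL dC (-1) t x = half R L (cup_bracket R C L (-1) t t x)"
  using tw by (simp_all add: lie_twisting_cochain_def)

lemma H_gmor: "H \<in> gmor R E E 1" and Prj_gmor: "Prj \<in> gmor R E C 0"
  and Prj_dE: "\<And>x. x \<in> carrier E \<Longrightarrow> Prj (dE x) = dC (Prj x)"
  and Prj_tb: "\<And>x. x \<in> carrier C \<Longrightarrow> Prj (tb x) = x"
  and H_tb: "\<And>x. x \<in> carrier C \<Longrightarrow> H (tb x) = \<zero>\<^bsub>E\<^esub>"
  and H_diff: "\<And>x. x \<in> carrier E \<Longrightarrow> hom_diff E dE dE 1 H x = x \<ominus>\<^bsub>E\<^esub> tb (Prj x)"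
  and dC_gmor: "dC \<in> gmor R C C (-1)" and dE_gmor: "dE \<in> gmor R E E (-1)"
  using contr by (simp_all add: contraction_def chain_map_def chain_complex_def)

lemma two: "\<one> \<oplus> \<one> \<in> Units R"
proof -
  interpret graded_coalg R C by (rule graded_coalg.intro[OF coalg_C])
  show ?thesis by (rule contains_rat_two[OF R.is_cring rat])
qed

lemma tPrj_gmor: "t \<circ> Prj \<in> gmor R E L (-1)"
  using t_gmor Prj_gmor by (auto simp: gmor_def)

end

sublocale twisted_contraction \<subseteq> C: cup_setting R C L dL
  by (intro cup_setting.intro graded_coalg.intro lie_alg.intro coalg_C lie_L)

sublocale twisted_contraction \<subseteq> lie_recursion R E L dL "t \<circ> Prj" H s
  by (intro lie_recursion.intro lie_recursion_axioms.intro cup_setting.intro graded_coalg.intro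
    lie_alg.intro
      coalg_E lie_L two tPrj_gmor H_gmor sgn conc)

section \<open>The twisting equation for the sum of the recursion\<close>

context twisted_contraction
begin

lemma Th_tb:
  assumes x: "x \<in> carrier C" shows "Th (tb x) = t x"
proof -
  have z: "cupL (-1) Th Th \<zero>\<^bsub>E\<^esub> = \<zero>\<^bsub>L\<^esub>"
    by (rule rlin_zero[OF E.C.VM.module_axioms modL E.cup_rlin[OF Thl Thl]])
  have "tb x \<in> carrier E" by (rule rlin_closed[OF gmor_rlin[OF tb_hom(1)] x])
  then show ?thesis
    using x rlin_closed[OF gmor_rlin[OF t_gmor] x]
    by (simp add: Th_fixed_point Prj_tb H_tb z rlin_zero[OF modL modL halfl])
qed

abbreviation "DTh \<equiv> hom_diff L dL dE (-1) Th"
abbreviation "W \<equiv> cupL (-1) Th Th"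

lemma DTh_gmor: "DTh \<in> gmor R E L (-1 - 1)"
  by (rule E.hom_diff_gmor[OF dE_gmor Th_gmor])

lemma W_gmor: "W \<in> gmor R E L (-1 + -1)"
  by (rule E.cup_gmor[OF Th_gmor Th_gmor])

lemma W_tb:
  assumes x: "x \<in> carrier C" shows "W (tb x) = cup_bracket R C L (-1) t t x"
proof -
  note l = rlin_comp[OF Thl gmor_rlin[OF tb_hom(1)]]
  have "W (tb x) = cup_bracket R C L (-1) (\<lambda>x. Th (tb x)) (\<lambda>x. Th (tb x)) x"
    by (rule cup_natural[OF C.cup_setting_axioms E.cup_setting_axioms tb_hom(1,2) Thl Thl x])
  also have "\<dots> = cup_bracket R C L (-1) t t x"
    using x by (intro C.cup_cong[OF l l gmor_rlin[OF t_gmor] gmor_rlin[OF t_gmor]]) (simp_all add: Th_tb)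
  finally show ?thesis .
qed

lemma DTh_apply: "x \<in> carrier E \<Longrightarrow> DTh x = dL (Th x) \<oplus>\<^bsub>L\<^esub> Th (dE x)"
  using rlin_closed[OF Thl rlin_closed[OF gmor_rlin[OF dE_gmor]], of x]
  by (simp add: hom_diff_def ksgn_def a_minus_def)

text \<open>The Leibniz rule yields two terms [D theta, theta] and -[theta, D theta]. Antisymmetry
  for degrees -1 and -2 makes them equal, and the factor 1/2 of the recursion absorbs the
  doubling.\<close>

lemma dL_W:
  assumes z: "z \<in> carrier E"
  shows "half R L (dL (W z)) = half R L (W (dE z)) \<oplus>\<^bsub>L\<^esub> cupL (-1) DTh Th z"
proof -
  note dLl = gmor_rlin[OF C.dL_gmor] and Wl = gmor_rlin[OF W_gmor]
  have dz: "dE z \<in> carrier E" by (rule rlin_closed[OF gmor_rlin[OF dE_gmor] z])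
  have c: "dL (W z) \<in> carrier L" "W (dE z) \<in> carrier L" "cupL (-1) DTh Th z \<in> carrier L"
    by (intro rlin_closed[OF dLl] rlin_closed[OF Wl]
      rlin_closed[OF E.cup_rlin] Thl gmor_rlin[OF DTh_gmor] z dz)+
  have "cupL (-2) Th DTh z = \<ominus>\<^bsub>L\<^esub> cupL (-1) DTh Th z"
    using E.cup_anti[OF cocomm_E Th_gmor DTh_gmor z] by (simp add: ksgn_def)
  then have "dL (W z) \<ominus>\<^bsub>L\<^esub> W (dE z) = cupL (-1) DTh Th z \<oplus>\<^bsub>L\<^esub> cupL (-1) DTh Th z"
    using E.cup_diff[OF coder_E Th_gmor z] c by (simp add: a_minus_def)
  moreover have "dL (W z) = W (dE z) \<oplus>\<^bsub>L\<^esub> (dL (W z) \<ominus>\<^bsub>L\<^esub> W (dE z))"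
    using c(1,2) by (simp add: a_minus_def C.LM.a_lcomm[of "W (dE z)"] C.LM.r_neg)
  ultimately have "dL (W z) = W (dE z) \<oplus>\<^bsub>L\<^esub> (cupL (-1) DTh Th z \<oplus>\<^bsub>L\<^esub> cupL (-1) DTh Th z)"
    by simp
  then have "half R L (dL (W z)) =
      half R L (W (dE z) \<oplus>\<^bsub>L\<^esub> (cupL (-1) DTh Th z \<oplus>\<^bsub>L\<^esub> cupL (-1) DTh Th z))"
    by (rule arg_cong)
  also have "\<dots> = half R L (W (dE z)) \<oplus>\<^bsub>L\<^esub> half R L (cupL (-1) DTh Th z \<oplus>\<^bsub>L\<^esub> cupL (-1) DTh Th z)"
    by (intro rlin_add[OF halfl] c C.LM.a_closed)
  also have "half R L (cupL (-1) DTh Th z \<oplus>\<^bsub>L\<^esub> cupL (-1) DTh Th z) = cupL (-1) DTh Th z"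
    by (rule half_double[OF modL two c(3)])
  finally show ?thesis .
qed

text \<open>The fixed point equation is inserted into both parts of D theta = d theta + theta d. The
  terms with \<open>W\<close> at \<open>dE (H x)\<close> and \<open>H (dE x)\<close> come one from
  each part, as do the two terms that form D t.\<close>

lemma DTh_eq:
  assumes x: "x \<in> carrier E"
  shows "DTh x = half R L (W x) \<oplus>\<^bsub>L\<^esub> cupL (-1) DTh Th (H x)"
proof -
  note dLl = gmor_rlin[OF C.dL_gmor] and Wl = gmor_rlin[OF W_gmor] and dEl = gmor_rlin[OF dE_gmor]
    and Hl = gmor_rlin[OF H_gmor] and tl = gmor_rlin[OF t_gmor] and Pl = gmor_rlin[OF Prj_gmor]
    and dCl = gmor_rlin[OF dC_gmor] and tbl = gmor_rlin[OF tb_hom(1)]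
  have c: "dE x \<in> carrier E" "H x \<in> carrier E" "H (dE x) \<in> carrier E" "dE (H x) \<in> carrier E"
    "Prj x \<in> carrier C"
    "tb (Prj x) \<in> carrier E" "dC (Prj x) \<in> carrier C"
    using x by (auto intro: rlin_closed[OF dEl] rlin_closed[OF Hl] rlin_closed[OF Pl]
      rlin_closed[OF tbl] rlin_closed[OF dCl])
  have Wc: "W y \<in> carrier L" "half R L (W y) \<in> carrier L" if "y \<in> carrier E" for y
    using that by (auto intro: rlin_closed[OF Wl] rlin_closed[OF halfl])
  have tc: "t y \<in> carrier L" "dL (t y) \<in> carrier L" if "y \<in> carrier C" for y
    using that by (auto intro: rlin_closed[OF tl] rlin_closed[OF dLl])
  have dc: "cupL (-1) DTh Th (H x) \<in> carrier L"
    by (intro rlin_closed[OF E.cup_rlin] Thl gmor_rlin[OF DTh_gmor] c)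
  have half_dL: "dL (half R L y) = half R L (dL y)" if "y \<in> carrier L" for y
    using that two by (simp add: half_def rlin_smult[OF dLl])
  have 1: "dL (Th x) = dL (t (Prj x)) \<oplus>\<^bsub>L\<^esub> (half R L (W (dE (H x))) \<oplus>\<^bsub>L\<^esub> cupL (-1) DTh Th (H x))"
    using c Wc tc x by (simp add: Th_fixed_point rlin_add[OF dLl] half_dL dL_W)
  have 2: "Th (dE x) = t (dC (Prj x)) \<oplus>\<^bsub>L\<^esub> half R L (W (H (dE x)))"
    using c x by (simp add: Th_fixed_point Prj_dE)
  \<comment> \<open>The twisting equation for \<open>t\<close>, read in terms of theta: by
    naturality its right-hand side is [theta, theta] after \<open>tb\<close>.\<close>
  have 3: "dL (t (Prj x)) \<oplus>\<^bsub>L\<^esub> t (dC (Prj x)) = half R L (W (tb (Prj x)))"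
    using t_tw[OF c(5)] c tc by (simp add: hom_diff_def ksgn_def a_minus_def W_tb)
  have "dE (H x) \<oplus>\<^bsub>E\<^esub> H (dE x) = x \<ominus>\<^bsub>E\<^esub> tb (Prj x)"
    using H_diff[OF x] c by (simp add: hom_diff_def ksgn_def a_minus_def)
  \<comment> \<open>The homotopy identity is solved for \<open>x\<close>, so that \<open>W x\<close>
    splits into precisely the three values of \<open>W\<close> already obtained.\<close>
  then have "x = dE (H x) \<oplus>\<^bsub>E\<^esub> H (dE x) \<oplus>\<^bsub>E\<^esub> tb (Prj x)"
    using x c by (simp add: a_minus_def E.C.VM.a_assoc E.C.VM.l_neg)
  then have "W x = W (dE (H x) \<oplus>\<^bsub>E\<^esub> H (dE x) \<oplus>\<^bsub>E\<^esub> tb (Prj x))" by simp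
  also have "\<dots> = W (dE (H x)) \<oplus>\<^bsub>L\<^esub> W (H (dE x)) \<oplus>\<^bsub>L\<^esub> W (tb (Prj x))"
    using c by (simp add: rlin_add[OF Wl])
  finally have 4: "half R L (W x) = half R L (W (dE (H x))) \<oplus>\<^bsub>L\<^esub> half R L (W (H (dE x)))
    \<oplus>\<^bsub>L\<^esub> half R L (W (tb (Prj x)))"
    using c Wc by (simp add: rlin_add[OF halfl])
  have "DTh x = (dL (t (Prj x)) \<oplus>\<^bsub>L\<^esub> t (dC (Prj x))) \<oplus>\<^bsub>L\<^esub>
     (half R L (W (dE (H x))) \<oplus>\<^bsub>L\<^esub> half R L (W (H (dE x))) \<oplus>\<^bsub>L\<^esub> cupL (-1) DTh Th (H x))"
    unfolding DTh_apply[OF x] 1 2 using c Wc tc dc by (simp add: C.LM.a_ac)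
  also have "\<dots> = half R L (W x) \<oplus>\<^bsub>L\<^esub> cupL (-1) DTh Th (H x)"
    unfolding 3 4 using c Wc dc by (simp add: C.LM.a_ac)
  finally show ?thesis .
qed

definition "Psi x = DTh x \<ominus>\<^bsub>L\<^esub> half R L (W x)"

lemma Psi_gmor: "Psi \<in> gmor R E L (-2)"
proof (rule gmorI)
  show "rlin R E L Psi"
    unfolding Psi_def[abs_def] a_minus_def
    by (rule rlin_plus[OF modL gmor_rlin[OF DTh_gmor] rlin_neg[OF modL
      rlin_comp[OF halfl gmor_rlin[OF W_gmor]]]])
  fix i x assume x: "x \<in> grade E i"
  show "Psi x \<in> grade L (i + -2)"
    unfolding Psi_def a_minus_def
    using gmor_grade[OF DTh_gmor x] half_grade[OF gmor_grade[OF W_gmor x]]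
    by (intro grade_add[OF C.L_graded] grade_neg[OF C.L_graded]) simp_all
qed

lemma Psi_recursive:
  assumes x: "x \<in> carrier E" shows "Psi x = cupL (-1) Psi Th (H x)"
proof -
  note Wl = gmor_rlin[OF W_gmor] and Dl = gmor_rlin[OF DTh_gmor] and Pl = gmor_rlin[OF Psi_gmor]
  have Hx: "H x \<in> carrier E" by (rule rlin_closed[OF gmor_rlin[OF H_gmor] x])
  have c: "half R L (W y) \<in> carrier L" "DTh y \<in> carrier L" if "y \<in> carrier E" for y
    using that by (auto intro: rlin_closed[OF Dl] rlin_closed[OF Wl] rlin_closed[OF halfl])
  \<comment> \<open>The multiple of \<open>W\<close> that is split off here contributes only the
    bracket of [theta, theta] with theta, which the Jacobi identity removes.\<close>
  have "DTh y = Psi y \<oplus>\<^bsub>L\<^esub> inv (\<one> \<oplus> \<one>) \<odot>\<^bsub>L\<^esub> W y" if "y \<in> carrier E" for y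
    using c[OF that] by (simp add: Psi_def a_minus_def C.LM.a_assoc C.LM.l_neg half_def[symmetric])
  then have "cupL (-1) DTh Th (H x) = cupL (-1) Psi Th (H x) \<oplus>\<^bsub>L\<^esub> inv (\<one> \<oplus> \<one>) \<odot>\<^bsub>L\<^esub> cupL (-1) W Th (H x)"
    using two by (intro E.cup_linear_left Dl Pl Wl Thl Hx) simp_all
  also have "cupL (-1) W Th (H x) = \<zero>\<^bsub>L\<^esub>"
    by (rule E.cup_jacobi[OF cocomm_E contains_rat_three[OF rat modL] Th_gmor Hx])
  also have "cupL (-1) Psi Th (H x) \<oplus>\<^bsub>L\<^esub> inv (\<one> \<oplus> \<one>) \<odot>\<^bsub>L\<^esub> \<zero>\<^bsub>L\<^esub> = cupL (-1) Psi Th (H x)"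
    using two rlin_closed[OF E.cup_rlin[OF Pl Thl] Hx] by simp
  finally have 1: "cupL (-1) DTh Th (H x) = cupL (-1) Psi Th (H x)" .
  have cc: "cupL (-1) Psi Th (H x) \<in> carrier L" by (rule rlin_closed[OF E.cup_rlin[OF Pl Thl] Hx])
  have "Psi x = (half R L (W x) \<oplus>\<^bsub>L\<^esub> cupL (-1) Psi Th (H x)) \<ominus>\<^bsub>L\<^esub> half R L (W x)"
    using DTh_eq[OF x] by (simp only: Psi_def[of x] 1)
  also have "\<dots> = cupL (-1) Psi Th (H x) \<oplus>\<^bsub>L\<^esub> (half R L (W x) \<ominus>\<^bsub>L\<^esub> half R L (W x))"
    unfolding a_minus_def using c(1)[OF x] cc by (simp add: C.LM.a_ac)
  also have "\<dots> = cupL (-1) Psi Th (H x)"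
    unfolding a_minus_def using c(1)[OF x] cc by (simp add: C.LM.r_neg)
  finally show ?thesis .
qed

text \<open>\<open>Psi\<close> has degree -2, so \<open>s * (k - 2)\<close> measures the degree of
  its value in the direction where \<open>L\<close> lives. The recursion lowers this measure because
  a nonzero value of theta takes up at least one unit of it.\<close>

lemma Psi_zero_grade: "x \<in> grade E k \<Longrightarrow> Psi x = \<zero>\<^bsub>L\<^esub>"
proof (induction "nat (s * (k - 2))" arbitrary: x k rule: less_induct)
  case less
  note Pl = gmor_rlin[OF Psi_gmor]
  show ?case
  proof (cases "s * (k - 2) \<le> 0")
    case True
    then show ?thesis using gmor_grade[OF Psi_gmor less.prems] conc[of "k - 2"] by simp
  next
    case False
    have "cupL (-1) Psi Th (H x) = \<zero>\<^bsub>L\<^esub>"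
    proof (rule E.cup_zero[OF Pl Thl gmor_grade[OF H_gmor less.prems]])
      fix p q u v assume uv: "u \<in> grade E p" "v \<in> grade E q" "p + q = k + 1"
      have c: "Psi u \<in> carrier L" "Th v \<in> carrier L"
        using uv by (auto intro: rlin_closed[OF Pl] rlin_closed[OF Thl] E.C_carrier)
      show "C.br (Psi u) (Th v) = \<zero>\<^bsub>L\<^esub>"
      proof (cases "s * (q - 1) \<le> 0")
        case True
        then have "Th v = \<zero>\<^bsub>L\<^esub>" using gmor_grade[OF Th_gmor uv(2)] conc[of "q - 1"] by simp
        then show ?thesis using c by simp
      next
        case q: False
        have k: "k = p + q - 1" using uv by simp
        \<comment> \<open>Here \<open>s * (q - 1)\<close> and \<open>s * (k - 2)\<close> are both
          positive; the latter makes the decrease strict also after truncation by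
          \<open>nat\<close>.\<close>
        have "s * (k - 2) = s * (p - 2) + s * (q - 1)" unfolding k by (simp add: algebra_simps)
        then have "nat (s * (p - 2)) < nat (s * (k - 2))" using q False by linarith
        then have "Psi u = \<zero>\<^bsub>L\<^esub>" by (rule less.hyps[OF _ uv(1)])
        then show ?thesis using c by simp
      qed
    qed
    then show ?thesis using Psi_recursive[OF E.C_carrier[OF less.prems]] by simp
  qed
qed

lemma Psi_zero:
  assumes x: "x \<in> carrier E" shows "Psi x = \<zero>\<^bsub>L\<^esub>"
  using E.C.graded x
proof (induction x rule: graded_induct)
  case zero
  show ?case by (rule rlin_zero[OF E.C.VM.module_axioms modL gmor_rlin[OF Psi_gmor]])
next
  case (add x y)
  then show ?case by (simp add: rlin_add[OF gmor_rlin[OF Psi_gmor]])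
next
  case (homogeneous k x)
  then show ?case by (rule Psi_zero_grade)
qed

lemma Th_twisting: "lie_twisting_cochain R E dE L dL Th"
  unfolding lie_twisting_cochain_def
proof (intro conjI ballI)
  show "coaug_dg_cocomm_coalgebra R E dE" "dg_lie_algebra R L dL" "Th \<in> gmor R E L (-1)"
    by (rule E_coalg lie_L Th_gmor)+
next
  fix r assume r: "r \<in> carrier R"
  \<comment> \<open>The coaugmentation of \<open>E\<close> factors through \<open>tb\<close>, where
    theta is already known to equal \<open>t\<close>.\<close>
  have "coaug C r \<in> carrier C" using r by (rule C.C.coaug_closed)
  then show "Th (coaug E r) = \<zero>\<^bsub>L\<^esub>"
    using r Th_tb[of "coaug C r"] by (simp add: tb_hom(3) t_coaug)
next
  fix x assume x: "x \<in> carrier E"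
  have c: "half R L (W x) \<in> carrier L" "DTh x \<in> carrier L"
    using x by (auto intro: rlin_closed[OF gmor_rlin[OF DTh_gmor]] rlin_closed[OF gmor_rlin[OF W_gmor]]
      rlin_closed[OF halfl])
  have "DTh x \<oplus>\<^bsub>L\<^esub> \<ominus>\<^bsub>L\<^esub> half R L (W x) = \<zero>\<^bsub>L\<^esub>"
    using Psi_zero[OF x] by (simp add: Psi_def a_minus_def)
  then have "\<ominus>\<^bsub>L\<^esub> (\<ominus>\<^bsub>L\<^esub> half R L (W x)) = DTh x"
    using c by (intro C.LM.minus_equality) simp_all
  then show "DTh x = half R L (W x)" using c by simp
qed

end

section \<open>Degrees in the loop Lie algebra\<close>

lemma (in graded_letters) grade_T_mult:
  assumes "A \<in> grade T i" "B \<in> grade T j" shows "A \<otimes>\<^bsub>T\<^esub> B \<in> grade T (i + j)"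
proof -
  obtain f where f: "f \<in> carrier F" "\<And>w. f w \<noteq> \<zero> \<Longrightarrow> wdeg w = i" "A = tclass R V f" by (rule
    grade_TE[OF assms(1)]) blast
  obtain g where g: "g \<in> carrier F" "\<And>w. g w \<noteq> \<zero> \<Longrightarrow> wdeg w = j" "B = tclass R V g" by (rule
    grade_TE[OF assms(2)]) blast
  have "wdeg w = i + j" if w: "conv f g w \<noteq> \<zero>" for w
  proof -
    obtain u v where "w = u @ v" "f u \<noteq> \<zero>" "g v \<noteq> \<zero>"
      by (rule conv_support[OF F_vals[OF f(1)] F_vals[OF g(1)] w])
    then show ?thesis using f(2) g(2) by (simp add: wdeg_def)
  qed
  then show ?thesis using f g by (simp add: tclass_mult grade_TI conv_closed)
qed

section \<open>The letters of the loop Lie algebra: cosets of the coaugmentation\<close>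

context graded_coalg
begin

abbreviation "N \<equiv> coaug C ` carrier R"

lemma N_submodule: "submodule N R C"
proof (rule VM.submoduleI)
  have eq: "N = (\<lambda>r. r \<odot>\<^bsub>C\<^esub> coaug C \<one>) ` carrier R" using coaug_eq by (rule image_cong[OF refl])
  show "N \<subseteq> carrier C" using coaug_closed by blast
  show "\<zero>\<^bsub>C\<^esub> \<in> N" unfolding eq by (rule image_eqI[of _ _ \<zero>]) (simp_all add: coaug_one)
  show "\<ominus>\<^bsub>C\<^esub> a \<in> N" if a: "a \<in> N" for a
  proof -
    obtain r where r: "r \<in> carrier R" "a = r \<odot>\<^bsub>C\<^esub> coaug C \<one>" using a unfolding eq by blast
    then show ?thesis unfolding eq
      by (intro image_eqI[of _ _ "\<ominus> r"]) (simp_all add: coaug_one VM.smult_l_minus)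
  qed
  show "a \<oplus>\<^bsub>C\<^esub> b \<in> N" if ab: "a \<in> N" "b \<in> N" for a b
  proof -
    obtain r where r: "r \<in> carrier R" "a = r \<odot>\<^bsub>C\<^esub> coaug C \<one>" using ab(1) unfolding eq by blast
    obtain q where q: "q \<in> carrier R" "b = q \<odot>\<^bsub>C\<^esub> coaug C \<one>" using ab(2) unfolding eq by blast
    show ?thesis using r q unfolding eq
      by (intro image_eqI[of _ _ "r \<oplus> q"]) (simp_all add: coaug_one VM.smult_l_distr)
  qed
  show "k \<odot>\<^bsub>C\<^esub> a \<in> N" if k: "k \<in> carrier R" "a \<in> N" for k a
  proof -
    obtain r where r: "r \<in> carrier R" "a = r \<odot>\<^bsub>C\<^esub> coaug C \<one>" using k(2) unfolding eq by blast
    show ?thesis using r k(1) unfolding eq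
      by (intro image_eqI[of _ _ "k \<otimes> r"]) (simp_all add: coaug_one VM.smult_assoc1)
  qed
qed

lemma N_subgroup: "abelian_subgroup N C"
  by (intro abelian_subgroupI3 additive_subgroup.intro submodule.axioms(1)[OF N_submodule]) (rule
    VM.abelian_group_axioms)

lemma J_proj_add:
  "x \<in> carrier C \<Longrightarrow> y \<in> carrier C \<Longrightarrow> J_proj R C x \<oplus>\<^bsub>J_mod R C\<^esub> J_proj R C y = J_proj R C (x \<oplus>\<^bsub>C\<^esub> y)"
  using abelian_subgroup.a_rcos_sum[OF N_subgroup] by (simp add: J_mod_def J_proj_def)

text \<open>Multiplying a coset elementwise by \<open>r\<close> may give less than a coset, since
  \<open>r\<close> times \<open>N\<close> can be smaller than \<open>N\<close>; the scalar
  multiplication of \<open>J_mod\<close> adds \<open>N\<close> once more, and the two copies of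
  \<open>N\<close> merge.\<close>

lemma J_proj_smult:
  assumes r: "r \<in> carrier R" and x: "x \<in> carrier C"
  shows "r \<odot>\<^bsub>J_mod R C\<^esub> J_proj R C x = J_proj R C (r \<odot>\<^bsub>C\<^esub> x)"
proof -
  note Nc = subsetD[OF VM.submoduleE(1)[OF N_submodule]]
  have "(\<Union>n\<in>N. \<Union>y\<in>(\<lambda>y. r \<odot>\<^bsub>C\<^esub> y) ` (\<Union>m\<in>N. {m \<oplus>\<^bsub>C\<^esub> x}). {n \<oplus>\<^bsub>C\<^esub> y}) = (\<Union>n\<in>N. {n \<oplus>\<^bsub>C\<^esub> r \<odot>\<^bsub>C\<^esub> x})" (is "?A = ?B")
  proof
    show "?A \<subseteq> ?B"
    proof
      fix z assume "z \<in> ?A"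
      then obtain n m where nm: "n \<in> N" "m \<in> N" "z = n \<oplus>\<^bsub>C\<^esub> r \<odot>\<^bsub>C\<^esub> (m \<oplus>\<^bsub>C\<^esub> x)" by blast
      then have "z = (n \<oplus>\<^bsub>C\<^esub> r \<odot>\<^bsub>C\<^esub> m) \<oplus>\<^bsub>C\<^esub> r \<odot>\<^bsub>C\<^esub> x"
        using Nc[OF nm(1)] Nc[OF nm(2)] r x by (simp add: VM.smult_r_distr VM.a_assoc)
      moreover have "n \<oplus>\<^bsub>C\<^esub> r \<odot>\<^bsub>C\<^esub> m \<in> N"
        by (intro VM.submoduleE(4,5)[OF N_submodule] nm r)
      ultimately show "z \<in> ?B" by blast
    qed
    show "?B \<subseteq> ?A"
    proof
      fix z assume "z \<in> ?B"
      then obtain n where n: "n \<in> N" "z = n \<oplus>\<^bsub>C\<^esub> r \<odot>\<^bsub>C\<^esub> x" by blast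
      have "\<zero>\<^bsub>C\<^esub> \<in> N" using subgroup.one_closed[OF submodule.axioms(1)[OF N_submodule]] by simp
      moreover have "z = n \<oplus>\<^bsub>C\<^esub> r \<odot>\<^bsub>C\<^esub> (\<zero>\<^bsub>C\<^esub> \<oplus>\<^bsub>C\<^esub> x)" using n x by simp
      ultimately show "z \<in> ?A" using n(1) by blast
    qed
  qed
  then show ?thesis by (simp add: J_mod_def J_proj_def a_r_coset_def' set_add_def')
qed

lemma J_letters: "graded_letters R (shift (-1) (J_mod R C))"
proof (intro graded_letters.intro graded_letters_axioms.intro R.is_cring)
  let ?V = "shift (-1) (J_mod R C)"
  have g: "grade ?V i = J_proj R C ` grade C (i + 1)" for i by (simp add: shift_def J_mod_def)
  show "x \<oplus>\<^bsub>?V\<^esub> y \<in> grade ?V i" if xy: "x \<in> grade ?V i" "y \<in> grade ?V i" for x y i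
  proof -
    obtain a where a: "a \<in> grade C (i + 1)" "x = J_proj R C a" using xy(1) unfolding g by blast
    obtain b where b: "b \<in> grade C (i + 1)" "y = J_proj R C b" using xy(2) unfolding g by blast
    have "x \<oplus>\<^bsub>?V\<^esub> y = J_proj R C (a \<oplus>\<^bsub>C\<^esub> b)"
      using a b J_proj_add[of a b] grade_carrier[OF graded] by (simp add: shift_def)
    then show ?thesis unfolding g using grade_add[OF graded a(1) b(1)] by simp
  qed
  show "r \<odot>\<^bsub>?V\<^esub> x \<in> grade ?V i" if x: "r \<in> carrier R" "x \<in> grade ?V i" for r x i
  proof -
    obtain a where a: "a \<in> grade C (i + 1)" "x = J_proj R C a" using x(2) unfolding g by blast
    have "r \<odot>\<^bsub>?V\<^esub> x = J_proj R C (r \<odot>\<^bsub>C\<^esub> a)"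
      using a J_proj_smult[of r a] x(1) grade_carrier[OF graded] by (simp add: shift_def)
    then show ?thesis unfolding g using grade_smult[OF graded x(1) a(1)] by simp
  qed
qed

end

text \<open>
  The elements of \<open>loop_lie R C\<close> whose homogeneous components all have degree of sign \<open>s\<close> form a
  Lie subalgebra that contains the generators.
\<close>

lemma loop_lie_degrees:
  assumes C: "coaug_graded_coalgebra R C"
    and tw: "lie_twisting_cochain R C dC (loop_lie R C) dL (t_loop R C)"
    and conc: "\<And>i x. x \<in> grade C i \<Longrightarrow> s * (i - 1) \<le> 0 \<Longrightarrow> x \<in> coaug C ` carrier R"
    and i: "(s::int) * i \<le> 0"
  shows "grade (loop_lie R C) i = {\<zero>\<^bsub>loop_lie R C\<^esub>}"
proof -
  define V where "V = shift (-1) (J_mod R C)"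
  define L where "L = loop_lie R C"
  interpret C: graded_coalg R C by (rule graded_coalg.intro[OF C])
  interpret V: graded_letters R V unfolding V_def by (rule C.J_letters)
  interpret L: lie_alg R L dL
    using tw by unfold_locales (simp add: lie_twisting_cochain_def L_def)
  let ?T = "tens R V"
  let ?P = "{tclass R V f | f. f \<in> carrier (free_alg R V) \<and> (\<forall>w. f w \<noteq> \<zero>\<^bsub>R\<^esub> \<longrightarrow> 0 < s * wdeg w)}"
  let ?S = "\<Inter>{H. submodule H R ?T \<and> tgen R V ` carrier V \<subseteq> H \<and> (\<forall>x\<in>H. \<forall>y\<in>H. gcommutator ?T x y \<in> H)}"
  have Ls: "grade L k = grade ?T k \<inter> ?S" "zero L = zero ?T" "add L = add ?T" for k
    by (simp_all add: L_def loop_lie_def gen_lie_def V_def Let_def)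
  have Psub: "submodule ?P R ?T" by (rule V.word_support_submodule)
  have P0: "\<zero>\<^bsub>?T\<^esub> \<in> ?P" using subgroup.one_closed[OF submodule.axioms(1)[OF Psub]] by simp
  have Padd: "a \<oplus>\<^bsub>?T\<^esub> b \<in> ?P" if "a \<in> ?P" "b \<in> ?P" for a b using V.TM.submoduleE(5)[OF Psub that] .
  have Pgrade: "x \<in> ?P" if x: "x \<in> grade ?T k" and k: "0 < s * k" for x k
  proof -
    obtain f where "f \<in> carrier (free_alg R V)" "\<And>w. f w \<noteq> \<zero>\<^bsub>R\<^esub> \<Longrightarrow> wdeg w = k" "x = tclass R V f"
      by (rule V.grade_TE[OF x]) blast
    then show ?thesis using k by blast
  qed
  have Pdeg: "V.deg_part k x = \<zero>\<^bsub>?T\<^esub>" if x: "x \<in> ?P" and k: "s * k \<le> 0" for x k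
  proof -
    obtain f where f: "f \<in> carrier (free_alg R V)" "\<forall>w. f w \<noteq> \<zero>\<^bsub>R\<^esub> \<longrightarrow> 0 < s * wdeg w" "x = tclass R V f"
      using x by blast
    have "sum_list (map fst w) \<noteq> k" if "f w \<noteq> \<zero>\<^bsub>R\<^esub>" for w
      using f(2) that k by (auto simp: wdeg_def)
    then show ?thesis unfolding f(3) by (intro V.deg_proj_zero f(1)) blast
  qed
  have Pcar: "x \<in> carrier ?T" if "x \<in> ?P" for x using V.TM.submoduleE(1)[OF Psub] that by (rule subsetD)
  have Psum: "(\<Oplus>\<^bsub>?T\<^esub> k \<in> K. f k) \<in> ?P" if "\<And>k. k \<in> K \<Longrightarrow> f k \<in> ?P" for K and f :: "int \<Rightarrow> _"
    using that
  proof (induction K rule: infinite_finite_induct)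
    case (insert k K)
    have fc: "f j \<in> carrier ?T" if "j \<in> insert k K" for j by (rule Pcar[OF insert.prems[OF that]])
    then have "(\<Oplus>\<^bsub>?T\<^esub> k \<in> insert k K. f k) = f k \<oplus>\<^bsub>?T\<^esub> (\<Oplus>\<^bsub>?T\<^esub> k \<in> K. f k)"
      using insert.hyps by (intro V.T.finsum_insert) auto
    moreover have "f k \<in> ?P" "(\<Oplus>\<^bsub>?T\<^esub> k \<in> K. f k) \<in> ?P" using insert by blast+
    ultimately show ?case using Padd by simp
  qed (use P0 in simp_all)
  have gens: "tgen R V ` carrier V \<subseteq> ?P"
  proof
    fix z assume "z \<in> tgen R V ` carrier V"
    moreover have "carrier V = (\<Union>x\<in>carrier C. {J_proj R C x})"
      by (simp add: V_def shift_def J_mod_def J_proj_def A_RCOSETS_def')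
    ultimately have "z \<in> tgen R V ` (\<Union>x\<in>carrier C. {J_proj R C x})" by simp
    then obtain x where x: "x \<in> carrier C" "z = tgen R V (J_proj R C x)"
      by (elim imageE UN_E) simp
    then have x: "x \<in> carrier C" "z = t_loop R C x" by (simp_all add: t_loop_def V_def)
    \<comment> \<open>The behaviour of the generators is read off from the twisting cochain
      property: \<open>t_loop\<close> has degree -1 and kills the coaugmentation. No grading of
      \<open>J_mod\<close> has to be established.\<close>
    have t: "t_loop R C \<in> gmor R C L (-1)" and tc: "\<And>r. r \<in> carrier R \<Longrightarrow> t_loop R C (coaug C r) = \<zero>\<^bsub>L\<^esub>"
      using tw by (simp_all add: lie_twisting_cochain_def L_def)
    have "t_loop R C x \<in> ?P"
      using C.graded x(1)
    proof (induction x rule: graded_induct)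
      case zero
      then show ?case using P0
        by (simp only: rlin_zero[OF C.VM.module_axioms L.LM.module_axioms gmor_rlin[OF t]] Ls)
    next
      case (add x y)
      then show ?case using Padd[OF add(3,4)] by (simp only: rlin_add[OF gmor_rlin[OF t] add(1,2)] Ls)
    next
      case (homogeneous k x)
      show ?case
      proof (cases "s * (k - 1) \<le> 0")
        case True
        \<comment> \<open>A degree that would give a generator the wrong sign occurs in
          \<open>C\<close> only inside the image of the coaugmentation.\<close>
        then obtain r where "r \<in> carrier R" "x = coaug C r" using conc[OF homogeneous] by blast
        then have "t_loop R C x = \<zero>\<^bsub>?T\<^esub>" using tc Ls by simp
        then show ?thesis using P0 by simp
      next
        case False
        have "t_loop R C x \<in> grade ?T (k - 1)" using gmor_grade[OF t homogeneous] Ls by simp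
        then show ?thesis using False by (intro Pgrade) auto
      qed
    qed
    then show "z \<in> ?P" using x by simp
  qed
  have comm: "gcommutator ?T x y \<in> ?P" if xy: "x \<in> ?P" "y \<in> ?P" for x y
  proof -
    let ?c = "\<lambda>a b. (gcomp ?T a x \<otimes>\<^bsub>?T\<^esub> gcomp ?T b y) \<ominus>\<^bsub>?T\<^esub> ksgn ?T (a * b) (gcomp ?T b y \<otimes>\<^bsub>?T\<^esub> gcomp ?T a x)"
    have pos: "0 < s * k \<and> gcomp ?T k z \<in> grade ?T k" if z: "z \<in> ?P" "k \<in> gsupp ?T z" for z k
    proof -
      have eq: "gcomp ?T k z = V.deg_part k z" by (rule V.gcomp_T[OF Pcar[OF z(1)]])
      then have "V.deg_part k z \<noteq> \<zero>\<^bsub>?T\<^esub>" using z(2) by (simp add: gsupp_def)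
      then have "0 < s * k" using Pdeg[OF z(1), of k] by linarith
      then show ?thesis using V.deg_part_grade[OF Pcar[OF z(1)]] eq by simp
    qed
    have "?c a b \<in> ?P"
      if ab: "a \<in> gsupp ?T x" "b \<in> gsupp ?T y" for a b
    proof (rule Pgrade)
      \<comment> \<open>Degrees of sign \<open>s\<close> are closed under addition, so every summand
        of the graded commutator is again of this kind.\<close>
      note a = pos[OF xy(1) ab(1)] and b = pos[OF xy(2) ab(2)]
      show "0 < s * (a + b)" using a b by (simp add: distrib_left)
      have m: "gcomp ?T a x \<otimes>\<^bsub>?T\<^esub> gcomp ?T b y \<in> grade ?T (a + b)"
        using a b by (intro V.grade_T_mult) simp_all
      have "gcomp ?T b y \<otimes>\<^bsub>?T\<^esub> gcomp ?T a x \<in> grade ?T (b + a)"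
        using a b by (intro V.grade_T_mult) simp_all
      then have m': "gcomp ?T b y \<otimes>\<^bsub>?T\<^esub> gcomp ?T a x \<in> grade ?T (a + b)" by (simp only: add.commute)
      show "?c a b \<in> grade ?T (a + b)"
        unfolding a_minus_def
        by (rule grade_add[OF V.T_graded m grade_neg[OF V.T_graded grade_ksgn[OF V.T_graded m']]])
    qed
    then show ?thesis unfolding gcommutator_def by (intro Psum)
  qed
  have SP: "?S \<subseteq> ?P"
    by (rule Inter_lower, rule CollectI, intro conjI ballI) (rule Psub gens comm, assumption?)+
  show ?thesis
  proof
    show "grade (loop_lie R C) i \<subseteq> {\<zero>\<^bsub>loop_lie R C\<^esub>}"
    proof
      fix x assume "x \<in> grade (loop_lie R C) i"
      then have S: "x \<in> grade ?T i \<inter> ?S" by (simp only: Ls(1)[of i, unfolded L_def])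
      note x = IntD1[OF S] subsetD[OF SP IntD2[OF S]]
      have "x = V.deg_part i x" using V.deg_part_id[OF x(1)] by simp
      also have "\<dots> = \<zero>\<^bsub>?T\<^esub>" by (rule Pdeg[OF x(2) i])
      finally show "x \<in> {\<zero>\<^bsub>loop_lie R C\<^esub>}" using Ls(2) by (simp add: L_def)
    qed
    show "{\<zero>\<^bsub>loop_lie R C\<^esub>} \<subseteq> grade (loop_lie R C) i"
      using grade_zero[OF L.L_graded, of i] by (simp add: L_def)
  qed
qed

text \<open>A nonempty word of nonzero letters has degree at least 2 if \<open>s = 1\<close> and at
  most 0 if \<open>s = -1\<close>, as \<open>sM\<close> does. In the degrees allowed by
  \<open>k\<close>, every nonempty word thus contains a zero letter, and only multiples of the empty
  word are left.\<close>

lemma Sc_degrees: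
  assumes M: "graded_module R M" and s: "s = 1 \<or> s = -1"
    and conn: "\<And>i. s * i \<le> 0 \<Longrightarrow> grade M i = {\<zero>\<^bsub>M\<^esub>}"
    and x: "x \<in> grade (Sc R M) k" and k: "(s::int) * (k - 1) \<le> 0"
  shows "x \<in> coaug (Sc R M) ` carrier R"
proof -
  define V where "V = shift 1 M"
  interpret M: graded_mod R M by (rule graded_mod.intro[OF M])
  interpret V: graded_letters R V
    by (intro graded_letters.intro graded_letters_axioms.intro M.R.is_cring)
       (simp_all add: V_def shift_def M.grade_add_closed M.grade_smult_closed)
  let ?T = "tens R V"
  have "x \<in> grade ?T k" using x by (simp add: Sc_def sym_coalg_def sym_mod_def Let_def V_def)
  then obtain f where f: "f \<in> carrier (free_alg R V)" "\<And>w. f w \<noteq> \<zero>\<^bsub>R\<^esub> \<Longrightarrow> wdeg w = k" "x = tclass R V f"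
    by (rule V.grade_TE) blast
  have zero: "tword R V w = \<zero>\<^bsub>?T\<^esub>" if w: "w \<in> lists (letters V)" "w \<noteq> []" "wdeg w = k" for w
  proof -
    \<comment> \<open>Otherwise all letters of the word have degrees at least 2, or all have degrees
      at most 0. Their sum then stays in that range, where the degree minus 1 has sign
      \<open>s\<close>, against the choice of \<open>k\<close>.\<close>
    have "\<exists>p\<in>set w. s * (fst p - 1) \<le> 0"
    proof (rule ccontr)
      assume "\<not> ?thesis"
      then have n: "\<And>p. p \<in> set w \<Longrightarrow> 0 < s * (fst p - 1)" by (auto simp: not_le)
      have "0 < s * (wdeg w - 1)"
        using s
      proof
        assume s1: "s = 1"
        have "w \<noteq> [] \<Longrightarrow> (\<And>p. p \<in> set w \<Longrightarrow> 2 \<le> fst p) \<Longrightarrow> 2 \<le> wdeg w" for w :: "(int \<times> 'b) list"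
          by (induction w) (auto simp: wdeg_def, metis add_increasing2 list.simps(8) sum_list.Nil
            zero_le_numeral dual_order.trans order.refl)
        then show ?thesis using n w(2) s1 by fastforce
      next
        assume s1: "s = -1"
        have "(\<And>p. p \<in> set w \<Longrightarrow> fst p \<le> 0) \<Longrightarrow> wdeg w \<le> 0" for w :: "(int \<times> 'b) list"
          by (induction w) (auto simp: wdeg_def add_nonpos_nonpos)
        then show ?thesis using n s1 by fastforce
      qed
      then show False using k w(3) by simp
    qed
    then obtain u p v where p: "w = u @ p # v" "s * (fst p - 1) \<le> 0" by (metis split_list)
    obtain j m where jm: "p = (j, m)" by (cases p)
    have "m \<in> grade V j" using w(1) p jm by (simp add: letters_def)
    then have m: "m = \<zero>\<^bsub>M\<^esub>" using conn[of "j - 1"] p(2) jm by (simp add: V_def shift_def)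
    have "\<zero>\<^bsub>R\<^esub> \<odot>\<^bsub>V\<^esub> m = m" unfolding m by (simp add: V_def shift_def)
    \<comment> \<open>The letter vanishes, hence equals 0 times itself, and linearity in this letter
      makes the whole word 0.\<close>
    then have "tword R V w = tword R V (u @ (j, \<zero>\<^bsub>R\<^esub> \<odot>\<^bsub>V\<^esub> m) # v)" using p jm by simp
    also have "\<dots> = \<zero>\<^bsub>R\<^esub> \<odot>\<^bsub>?T\<^esub> tword R V (u @ (j, m) # v)"
      using w(1) p jm \<open>m \<in> grade V j\<close> by (intro
        grade_linear_smult[OF multilinearD[OF V.multilinear_tword]]) simp_all
    also have "\<dots> = \<zero>\<^bsub>?T\<^esub>" using w(1) p jm by (intro V.TM.smult_l_null V.tword_closed) simp
    finally show ?thesis .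
  qed
  have e: "tword R V [] \<in> carrier ?T" by simp
  have "\<exists>r\<in>carrier R. x = r \<odot>\<^bsub>?T\<^esub> tword R V []"
    unfolding f(3)
  proof (rule V.T_induct[OF f(1), where W = "{w. wdeg w = k}"])
    show "{w. f w \<noteq> \<zero>\<^bsub>R\<^esub>} \<subseteq> {w. wdeg w = k}" using f(2) by blast
    show "\<exists>r\<in>carrier R. \<zero>\<^bsub>?T\<^esub> = r \<odot>\<^bsub>?T\<^esub> tword R V []"
      by (rule bexI[of _ "\<zero>\<^bsub>R\<^esub>"]) simp_all
    fix A r w assume *: "A \<in> carrier ?T" "\<exists>r\<in>carrier R. A = r \<odot>\<^bsub>?T\<^esub> tword R V []" "r \<in> carrier R"
      "w \<in> lists (letters V)" "w \<in> {w. wdeg w = k}"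
    obtain q where q: "q \<in> carrier R" "A = q \<odot>\<^bsub>?T\<^esub> tword R V []" using *(2) by blast
    show "\<exists>q\<in>carrier R. A \<oplus>\<^bsub>?T\<^esub> r \<odot>\<^bsub>?T\<^esub> tword R V w = q \<odot>\<^bsub>?T\<^esub> tword R V []"
    proof (cases "w = []")
      case True
      then show ?thesis using q *(3) by (intro bexI[of _ "q \<oplus>\<^bsub>R\<^esub> r"]) (simp_all add: V.TM.smult_l_distr)
    next
      case False
      then show ?thesis using q *(3,4,5) zero[of w] by (intro bexI[of _ q]) simp_all
    qed
  qed
  then obtain r where "r \<in> carrier R" "x = r \<odot>\<^bsub>?T\<^esub> tword R V []" by blast
  then have "x = coaug (Sc R M) r" by (simp add: Sc_def sym_coalg_def sym_mod_def Let_def V_def)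
  then show ?thesis using \<open>r \<in> carrier R\<close> by blast
qed

theorem lemma4p1:
  fixes R :: "'r ring"
    and g :: "('r, 'g) glie" and dg :: "'g \<Rightarrow> 'g"
    and M :: "('r, 'm) gmod" and dM :: "'m \<Rightarrow> 'm"
    and nabla :: "'m \<Rightarrow> 'g" and prj :: "'g \<Rightarrow> 'm" and h :: "'g \<Rightarrow> 'g"
    and Dpert :: "('r, 'm) tensor \<Rightarrow> ('r, 'm) tensor"
    and tau :: "('r, 'm) tensor \<Rightarrow> 'g"
    and dbr :: "('r, 'g) tensor \<Rightarrow> ('r, 'g) tensor"
    and taubar :: "('r, 'm) tensor \<Rightarrow> ('r, 'g) tensor"
    and Prj :: "('r, 'g) tensor \<Rightarrow> ('r, 'm) tensor"
    and H :: "('r, 'g) tensor \<Rightarrow> ('r, 'g) tensor"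
    and dL :: "('r, ('r, 'm) tensor set) tensor \<Rightarrow> ('r, ('r, 'm) tensor set) tensor"
  assumes "cring R" and "contains_rat R"
    and "dg_lie_algebra R g dg"
    and "contraction R M dM g dg nabla prj h"
    and "connected_gmod M"
    \<comment> \<open>\<open>Sc R g\<close> with differential \<open>d0 R g dg + dbr\<close> is the classifying coalgebra of \<open>g\<close>\<close>
    and "classifying_coderivation R g dbr"
    \<comment> \<open>the data of the Lie algebra perturbation lemma\<close>
    and "coalgebra_perturbation R (Sc R M) (d0 R M dM) Dpert"
    and "lie_twisting_cochain R (Sc R M) (add_map (Sc R M) (d0 R M dM) Dpert) g dg tau"
    and "\<forall>x\<in>carrier (Sc R M). prj (tau x) = tau_univ R M x"
    and "\<forall>x\<in>carrier (Sc R M). h (tau x) = \<zero>\<^bsub>g\<^esub>"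
    and "lie_adjoint R (Sc R M) (add_map (Sc R M) (d0 R M dM) Dpert) g dg dbr tau taubar"
    and "contraction R (Sc R M) (add_map (Sc R M) (d0 R M dM) Dpert)
           (Sc R g) (add_map (Sc R g) (d0 R g dg) dbr) taubar Prj H"
    and "loop_differential R (Sc R M) (add_map (Sc R M) (d0 R M dM) Dpert) dL"
  shows "let L = loop_lie R (Sc R M);
             tL = t_loop R (Sc R M);
             th = theta R (Sc R g) L (tL \<circ> Prj) H;
             Th = theta_sum R (Sc R g) L (tL \<circ> Prj) H
         in (\<forall>x\<in>carrier (Sc R g). finite {n. th n x \<noteq> \<zero>\<^bsub>L\<^esub>}) \<and>
            (\<forall>x\<in>carrier (Sc R g).
               Th x = tL (Prj x) \<oplus>\<^bsub>L\<^esub> half R L (cup_bracket R (Sc R g) L (-1) Th Th (H x))) \<and>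
            lie_twisting_cochain R (Sc R g) (add_map (Sc R g) (d0 R g dg) dbr) L dL Th \<and>
            (\<forall>x\<in>carrier (Sc R M). Th (taubar x) = tL x)"
proof -
  let ?C = "Sc R M" and ?E = "Sc R g"
  let ?dC = "add_map ?C (d0 R M dM) Dpert" and ?dE = "add_map ?E (d0 R g dg) dbr"
  let ?L = "loop_lie R ?C" and ?t = "t_loop R ?C"
  have M: "graded_module R M"
    using assms(4) by (simp add: contraction_def chain_complex_def)
  have hom: "dg_cocomm_coalgebra_hom R ?C ?dC ?E ?dE taubar"
    using assms(11) by (simp add: lie_adjoint_def)
  have tw: "lie_twisting_cochain R ?C ?dC ?L dL ?t"
    using assms(13) by (simp add: loop_differential_def)
  have coalg: "coaug_graded_coalgebra R ?C"
    using hom by (simp add: dg_cocomm_coalgebra_hom_def coaug_dg_cocomm_coalgebra_def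
      coaug_dg_coalgebra_def)
  \<comment> \<open>The two alternatives of connectedness become \<open>s = 1\<close> and
    \<open>s = -1\<close>: in each case the grades of \<open>M\<close> vanish wherever
    \<open>s * i\<close> is not positive.\<close>
  obtain s :: int where s: "s = 1 \<or> s = -1" "\<And>i. s * i \<le> 0 \<Longrightarrow> grade M i = {\<zero>\<^bsub>M\<^esub>}"
  proof (cases "\<forall>i\<le>0. grade M i = {\<zero>\<^bsub>M\<^esub>}")
    case True
    then show thesis by (intro that[of 1]) auto
  next
    case False
    then show thesis using assms(5) by (intro that[of "-1"]) (auto simp: connected_gmod_def)
  qed
  \<comment> \<open>The concentration of \<open>M\<close> passes to the symmetric coalgebra modulo
    its coaugmentation, and from there to the loop Lie algebra.\<close>
  have "grade ?L i = {\<zero>\<^bsub>?L\<^esub>}" if "s * i \<le> 0" for i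
    by (rule loop_lie_degrees[OF coalg tw Sc_degrees[OF M s] that])
  then interpret twisted_contraction R ?C ?dC ?E ?dE ?L dL taubar Prj H ?t s
    by (intro twisted_contraction.intro assms(2,12) hom tw s(1))
  show ?thesis
    unfolding Let_def
    using th_finite Th_fixed_point Th_twisting Th_tb by simp
qed

end
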